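(* Suppose $\mathbb{K}$ has characteristic not two. Put $d=\sum_{j=1}^{n+2} b_j-\sum_{i=1}^n a_i$ and $d'=\sum_{i=1}^n (b_i-a_i)$. The Hilbert function of $M$ is unimodal if $a_1=0$ and one of the following holds: (a) $d$ is even and $b_{n+2}<d'+b_{n+1}+2$; (b) $d$ is odd and $b_{n+2}<d'+b_{n+1}+1$.
   Context: Let $\mathbb{K}$ be an algebraically closed field, $R=\mathbb{K}[x,y,z]$ with the standard grading, $n>0$ an integer, and $a_1\le a_2\le\cdots\le a_n$, $b_1\le b_2\le\cdots\le b_{n+2}$ integers. Let $\varphi:\bigoplus_{j=1}^{n+2}R(-b_j)\to\bigoplus_{i=1}^nR(-a_i)$ be a degree-zero graded $R$-linear map with matrix $(\varphi_{i,j})$, such that each entry $\varphi_{i,j}$ is either $0$ or homogeneous of positive degree (necessarily equal to $b_j-a_i$). Let $I\subset R$ be the ideal generated by the $n\times n$ minors of $\varphi$, and assume that $I$ has codimension $3$. Let $M=\operatorname{coker}(\varphi)$; it is a graded $R$-module of finite length. The Hilbert function is $h_M(t)=\dim_{\mathbb{K}}M_t$. It is unimodal if there is an integer $j$ such that $h_M(t)\le h_M(t+1)$ for all $t<j$ and $h_M(t)\ge h_M(t+1)$ for all $t\ge j$. *)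

theory Defs
  imports
    "Jordan_Normal_Form.VS_Connect"
    "Jordan_Normal_Form.DL_Submatrix"
    "HOL-Algebra.Ideal"
    "HOL-Library.Poly_Mapping"
    "HOL-Library.Numeral_Type"
    "HOL-Library.Extended_Nat"
begin

text \<open>
  The type \<^typ>\<open>3\<close> has exactly three elements, one for each variable; a monomial is its
  exponent function and a polynomial is a finitely supported function from monomials to
  coefficients, with the convolution product.
\<close>

type_synonym 'k poly3 = "(3 \<Rightarrow>\<^sub>0 nat) \<Rightarrow>\<^sub>0 'k"

definition const3 :: "'k::zero \<Rightarrow> 'k poly3" where
  "const3 c = Poly_Mapping.single 0 c"

definition homogeneous :: "int \<Rightarrow> 'k::zero poly3 \<Rightarrow> bool" where
  "homogeneous d p \<longleftrightarrow>
     (\<forall>m \<in> Poly_Mapping.keys p. int (\<Sum>i\<in>UNIV. Poly_Mapping.lookup m i) = d)"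


text \<open>The codimension (height) of an ideal; it is \<open>\<infinity>\<close> for the unit ideal.\<close>

definition prime_height :: "('r, 'x) ring_scheme \<Rightarrow> 'r set \<Rightarrow> enat" where
  "prime_height R P =
     (SUP l \<in> {l. \<exists>C. (\<forall>i\<le>l. primeideal (C i) R) \<and> (\<forall>i<l. C i \<subset> C (Suc i)) \<and> C l = P}. enat l)"

definition codimension :: "('r, 'x) ring_scheme \<Rightarrow> 'r set \<Rightarrow> enat" where
  "codimension R I = (INF P \<in> {P. primeideal P R \<and> I \<subseteq> P}. prime_height R P)"

definition maximal_minors :: "'r::comm_ring_1 mat \<Rightarrow> 'r set" where
  "maximal_minors A = {det (submatrix A UNIV J) | J. J \<subseteq> {..<dim_col A} \<and> card J = dim_row A}"

definition minor_ideal :: "'r::comm_ring_1 mat \<Rightarrow> 'r set" where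
  "minor_ideal A = Idl\<^bsub>class_ring\<^esub> (maximal_minors A)"


text \<open>
  The quotient module \<open>V / N\<close>, with cosets as elements. The scalar action is \<open>r (v + N) = r v + N\<close>.
  As in \<^const>\<open>module_vec\<close>, the ring fields of the module record are irrelevant.
\<close>

definition quotient_module ::
  "('r, 'm, 'x) module_scheme \<Rightarrow> 'm set \<Rightarrow> ('r, 'm set) module" where
  "quotient_module V N =
     \<lparr> carrier = a_rcosets\<^bsub>V\<^esub> N, monoid.mult = undefined, one = undefined,
       zero = N, add = set_add V,
       smult = (\<lambda>r A. \<Union>v\<in>A. N +>\<^bsub>V\<^esub> (r \<odot>\<^bsub>V\<^esub> v)) \<rparr>"

definition mat_image :: "'r::comm_ring_1 mat \<Rightarrow> 'r vec set" where
  "mat_image A = (\<lambda>w. A *\<^sub>v w) ` carrier_vec (dim_col A)"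

definition coker :: "'r::comm_ring_1 mat \<Rightarrow> ('r, 'r vec set) module" where
  "coker A = quotient_module (module_vec TYPE('r) (dim_row A)) (mat_image A)"

text \<open>
  The degree \<open>t\<close> part of \<open>R(-a\<^sub>1) \<oplus> \<dots> \<oplus> R(-a\<^sub>n)\<close>, whose \<open>i\<close>-th component is
  \<open>R(-a\<^sub>i)\<^sub>t = R\<^bsub>t - a\<^sub>i\<^esub>\<close>. Indices start at \<open>0\<close>.
\<close>

definition free_part :: "nat \<Rightarrow> (nat \<Rightarrow> int) \<Rightarrow> int \<Rightarrow> 'k::zero poly3 vec set" where
  "free_part n a t = {v \<in> carrier_vec n. \<forall>i<n. homogeneous (t - a i) (v $ i)}"

text \<open>
  The degree \<open>t\<close> part of the cokernel, as a vector space over the field of constants: the image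
  of the degree \<open>t\<close> part of the target.
\<close>

definition coker_part ::
  "(nat \<Rightarrow> int) \<Rightarrow> 'k::field poly3 mat \<Rightarrow> int \<Rightarrow> ('k, 'k poly3 vec set) module" where
  "coker_part a A t =
     \<lparr> carrier = (\<lambda>v. mat_image A +>\<^bsub>module_vec TYPE('k poly3) (dim_row A)\<^esub> v)
                   ` free_part (dim_row A) a t,
       monoid.mult = undefined, one = undefined,
       zero = \<zero>\<^bsub>coker A\<^esub>, add = add (coker A),
       smult = (\<lambda>c. smult (coker A) (const3 c)) \<rparr>"

definition hilbert_function ::
  "(nat \<Rightarrow> int) \<Rightarrow> 'k::field poly3 mat \<Rightarrow> int \<Rightarrow> nat" where
  "hilbert_function a A t = vectorspace.dim (class_ring :: 'k ring) (coker_part a A t)"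

definition unimodal :: "(int \<Rightarrow> nat) \<Rightarrow> bool" where
  "unimodal h \<longleftrightarrow> (\<exists>j. (\<forall>t<j. h t \<le> h (t + 1)) \<and> (\<forall>t\<ge>j. h t \<ge> h (t + 1)))"

end

theory Submission
  imports Defs
begin

text \<open>Put \<open>\<Delta>\<^sub>k\<^sub>l = det [\<phi>; e\<^sub>k; e\<^sub>l]\<close>, a skew-symmetric matrix whose entries are the signed maximal minors of
  \<open>\<phi>\<close>. The Buchsbaum-Rim complex
  \<open>0 \<rightarrow> R\<^sup>n \<rightarrow> R\<^sup>n\<^sup>+\<^sup>2 \<rightarrow> R\<^sup>n\<^sup>+\<^sup>2 \<rightarrow> R\<^sup>n \<rightarrow> M \<rightarrow> 0\<close> with maps \<open>\<phi>\<^sup>T\<close>, \<open>\<Delta>\<close>, \<open>\<phi>\<close> is exact because its homology is killed by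
  the \<open>\<Delta>\<^sub>k\<^sub>l\<close>, hence by powers of the three variables, and these form a regular sequence. (A
  homogeneous prime over \<open>I\<close> other than the irrelevant ideal would, by the codimension hypothesis,
  sit on top of a chain of primes that is too long for \<open>K[x, y, z]\<close>.) Exactness in each degree expresses the Hilbert
  function through \<open>a\<close> and \<open>b\<close>, symmetric about \<open>(d - 3) / 2\<close>. Exactness also forces \<open>a\<^sub>i < b\<^sub>i\<close>,
  and the hypothesis says \<open>2 b\<^sub>j \<le> d\<close> for all \<open>j\<close>, so that the increments are visibly nonnegative
  up to the centre of symmetry.\<close>

section \<open>The Buchsbaum-Rim complex\<close>

text \<open>Three choices shape the proof. A general acyclicity criterion is replaced by explicit
  lifting: once powers of the variables kill the homology, one nonzerodivisor settles the injective
  end, two terms of a regular sequence the next spot and three the last, each spot using the earlier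
  ones. The characteristic enters on the way from minors to powers: if \<open>f\<close> kills the
  cokernel, a trace computation writes \<open>2 * f ^ (n + 2)\<close> as a combination of entries of
  the middle map, the 2 arising because every pair of indices is counted in both orders. Finally,
  exactness is also applied to a block of the matrix, for which no codimension is known; so the
  codimension hypothesis is turned early into nilpotence of the variables on the cokernel, a
  property that passes to this block. In that conversion arbitrary primes are replaced by the
  homogeneous ideals inside them, since only those must lie below the irrelevant ideal.\<close>

lemma mult_mat_smult_vec:
  fixes A :: "'r::comm_ring_1 mat"
  assumes "A \<in> carrier_mat m n" "v \<in> carrier_vec n"
  shows "A *\<^sub>v (c \<cdot>\<^sub>v v) = c \<cdot>\<^sub>v (A *\<^sub>v v)"
  using assms by (intro eq_vecI) auto

lemma transpose_smult_one: "transpose_mat (c \<cdot>\<^sub>m 1\<^sub>m n) = (c :: 'r::comm_ring_1) \<cdot>\<^sub>m 1\<^sub>m n"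
  by (intro eq_matI) auto

text \<open>A weakly regular sequence: \<open>f\<close>, \<open>g\<close>, \<open>h\<close> are
  nonzerodivisors on \<open>R\<close>, \<open>R / (f)\<close>, \<open>R / (f, g)\<close> in turn.
  Written with witnesses, the conditions apply to vectors entry by entry, without quotient
  rings.\<close>

definition regular3 :: "'r::comm_ring_1 \<Rightarrow> 'r \<Rightarrow> 'r \<Rightarrow> bool" where
  "regular3 f g h \<longleftrightarrow>
     (\<forall>p. f * p = 0 \<longrightarrow> p = 0) \<and>
     (\<forall>p q. g * p = f * q \<longrightarrow> (\<exists>r. p = f * r)) \<and>
     (\<forall>p q r. h * p = f * q + g * r \<longrightarrow> (\<exists>s t. p = f * s + g * t))"

lemma regular3_vec1:
  assumes "regular3 f g h" "p \<in> carrier_vec n" "f \<cdot>\<^sub>v p = 0\<^sub>v n"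
  shows "p = 0\<^sub>v n"
proof (rule eq_vecI)
  fix i assume "i < dim_vec (0\<^sub>v n :: 'a vec)"
  then have "f * p $ i = 0" using assms(2,3) by (metis carrier_vecD index_smult_vec(1) index_zero_vec)
  then show "p $ i = 0\<^sub>v n $ i" using assms(1) \<open>i < _\<close> by (auto simp: regular3_def)
qed (use assms in auto)

lemma regular3_cancel_vec:
  assumes "regular3 f g h" "p \<in> carrier_vec n" "q \<in> carrier_vec n" "f \<cdot>\<^sub>v p = f \<cdot>\<^sub>v q"
  shows "p = q"
proof -
  have "f \<cdot>\<^sub>v (p - q) = f \<cdot>\<^sub>v p - f \<cdot>\<^sub>v q"
    using assms(2,3) by (intro eq_vecI) (auto simp: algebra_simps)
  then have "f \<cdot>\<^sub>v (p - q) = 0\<^sub>v n" using assms by auto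
  then have "p - q = 0\<^sub>v n" using regular3_vec1[OF assms(1)] assms by auto
  then have "p $ i - q $ i = 0" if "i < n" for i
    using assms(2,3) that by (metis carrier_vecD index_minus_vec(1) index_zero_vec(1))
  then show ?thesis using assms(2,3) by (intro eq_vecI) auto
qed

lemma regular3_vec2:
  assumes "regular3 f g h" "p \<in> carrier_vec n" "q \<in> carrier_vec n" "g \<cdot>\<^sub>v p = f \<cdot>\<^sub>v q"
  shows "\<exists>r \<in> carrier_vec n. p = f \<cdot>\<^sub>v r"
proof -
  have "\<exists>r. p $ i = f * r" if "i < n" for i
  proof -
    have "g * p $ i = f * q $ i" using assms that by (metis carrier_vecD index_smult_vec(1))
    then show ?thesis using assms(1) by (auto simp: regular3_def)
  qed
  then obtain r where "\<And>i. i < n \<Longrightarrow> p $ i = f * r i" by metis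
  then show ?thesis using assms(2) by (intro bexI[of _ "vec n r"]) (auto intro!: eq_vecI)
qed

lemma regular3_vec3:
  assumes "regular3 f g h" "p \<in> carrier_vec n" "q \<in> carrier_vec n" "r \<in> carrier_vec n"
    and "h \<cdot>\<^sub>v p = f \<cdot>\<^sub>v q + g \<cdot>\<^sub>v r"
  shows "\<exists>s \<in> carrier_vec n. \<exists>t \<in> carrier_vec n. p = f \<cdot>\<^sub>v s + g \<cdot>\<^sub>v t"
proof -
  have "\<exists>s t. p $ i = f * s + g * t" if "i < n" for i
  proof -
    have "(h \<cdot>\<^sub>v p) $ i = (f \<cdot>\<^sub>v q + g \<cdot>\<^sub>v r) $ i" using assms(5) by simp
    then have "h * p $ i = f * q $ i + g * r $ i" using assms(2-4) that by simp
    then show ?thesis using assms(1) unfolding regular3_def by blast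
  qed
  then obtain s t where "\<And>i. i < n \<Longrightarrow> p $ i = f * s i + g * t i" by metis
  then show ?thesis using assms(2)
    by (intro bexI[of _ "vec n s"] bexI[of _ "vec n t"]) (auto intro!: eq_vecI)
qed

text \<open>Injectivity of \<open>A\<close> turns \<open>A (g w - f w') = 0\<close> into
  \<open>g w = f w'\<close>. So \<open>f\<close> divides \<open>w\<close>, and cancelling
  \<open>f\<close> puts \<open>u\<close> itself into the image. In other words, no nonzero element
  of the cokernel of an injective \<open>A\<close> is killed by both \<open>f\<close> and
  \<open>g\<close>.\<close>

lemma mem_image_of_two_multiples:
  fixes A :: "'r::comm_ring_1 mat"
  assumes reg: "regular3 f g h" and A: "A \<in> carrier_mat m n"
    and inj: "\<And>v. v \<in> carrier_vec n \<Longrightarrow> A *\<^sub>v v = 0\<^sub>v m \<Longrightarrow> v = 0\<^sub>v n"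
    and u: "u \<in> carrier_vec m"
    and w: "w \<in> carrier_vec n" "f \<cdot>\<^sub>v u = A *\<^sub>v w"
    and w': "w' \<in> carrier_vec n" "g \<cdot>\<^sub>v u = A *\<^sub>v w'"
  shows "\<exists>v \<in> carrier_vec n. u = A *\<^sub>v v"
proof -
  have "A *\<^sub>v (g \<cdot>\<^sub>v w - f \<cdot>\<^sub>v w') = g \<cdot>\<^sub>v (A *\<^sub>v w) - f \<cdot>\<^sub>v (A *\<^sub>v w')"
    using A w(1) w'(1) by (simp add: mult_minus_distrib_mat_vec mult_mat_smult_vec)
  also have "\<dots> = 0\<^sub>v m"
    unfolding w(2)[symmetric] w'(2)[symmetric] using u by (auto intro!: eq_vecI simp: mult.left_commute)
  finally have "g \<cdot>\<^sub>v w - f \<cdot>\<^sub>v w' = 0\<^sub>v n" by (intro inj) (use w w' in auto)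
  then have "(g \<cdot>\<^sub>v w - f \<cdot>\<^sub>v w') $ i = 0" if "i < n" for i using that by simp
  then have "g \<cdot>\<^sub>v w = f \<cdot>\<^sub>v w'" using w(1) w'(1) by (intro eq_vecI) auto
  then obtain r where r: "r \<in> carrier_vec n" "w = f \<cdot>\<^sub>v r"
    using regular3_vec2[OF reg w(1) w'(1)] by auto
  have "f \<cdot>\<^sub>v u = f \<cdot>\<^sub>v (A *\<^sub>v r)" unfolding w(2) using r A by (simp add: mult_mat_smult_vec)
  then show ?thesis using regular3_cancel_vec[OF reg u, of "A *\<^sub>v r"] A r by auto
qed

text \<open>The same idea one spot further. Suitably scaled, the preimages \<open>u1\<close>,
  \<open>u2\<close>, \<open>u3\<close> differ by elements of the kernel of \<open>B\<close>, which
  come from \<open>A\<close>. Regularity of all three elements allows \<open>u1\<close> to be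
  changed by an image under \<open>A\<close> so that it becomes divisible by
  \<open>f\<close>.\<close>

lemma mem_image_of_three_multiples:
  fixes A B :: "'r::comm_ring_1 mat"
  assumes reg: "regular3 f g h" and A: "A \<in> carrier_mat m n" and B: "B \<in> carrier_mat k m"
    and inj: "\<And>v. v \<in> carrier_vec n \<Longrightarrow> A *\<^sub>v v = 0\<^sub>v m \<Longrightarrow> v = 0\<^sub>v n"
    and BA: "B * A = 0\<^sub>m k n"
    and exact: "\<And>u. u \<in> carrier_vec m \<Longrightarrow> B *\<^sub>v u = 0\<^sub>v k \<Longrightarrow> \<exists>v \<in> carrier_vec n. u = A *\<^sub>v v"
    and e: "e \<in> carrier_vec k"
    and u1: "u1 \<in> carrier_vec m" "f \<cdot>\<^sub>v e = B *\<^sub>v u1"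
    and u2: "u2 \<in> carrier_vec m" "g \<cdot>\<^sub>v e = B *\<^sub>v u2"
    and u3: "u3 \<in> carrier_vec m" "h \<cdot>\<^sub>v e = B *\<^sub>v u3"
  shows "\<exists>u \<in> carrier_vec m. e = B *\<^sub>v u"
proof -
  have diff: "\<exists>v \<in> carrier_vec n. q \<cdot>\<^sub>v x - p \<cdot>\<^sub>v y = A *\<^sub>v v"
    if "x \<in> carrier_vec m" "y \<in> carrier_vec m" "p \<cdot>\<^sub>v e = B *\<^sub>v x" "q \<cdot>\<^sub>v e = B *\<^sub>v y" for x y p q
  proof (rule exact)
    have "B *\<^sub>v (q \<cdot>\<^sub>v x - p \<cdot>\<^sub>v y) = q \<cdot>\<^sub>v (B *\<^sub>v x) - p \<cdot>\<^sub>v (B *\<^sub>v y)"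
      using B that(1,2) by (simp add: mult_minus_distrib_mat_vec mult_mat_smult_vec)
    also have "\<dots> = 0\<^sub>v k"
      unfolding that(3,4)[symmetric] using e by (auto intro!: eq_vecI simp: mult.left_commute)
    finally show "B *\<^sub>v (q \<cdot>\<^sub>v x - p \<cdot>\<^sub>v y) = 0\<^sub>v k" .
  qed (use that in auto)
  obtain v1 where v1: "v1 \<in> carrier_vec n" "g \<cdot>\<^sub>v u1 - f \<cdot>\<^sub>v u2 = A *\<^sub>v v1"
    using diff[OF u1(1) u2(1) u1(2) u2(2)] by auto
  obtain v2 where v2: "v2 \<in> carrier_vec n" "h \<cdot>\<^sub>v u2 - g \<cdot>\<^sub>v u3 = A *\<^sub>v v2"
    using diff[OF u2(1) u3(1) u2(2) u3(2)] by auto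
  obtain v3 where v3: "v3 \<in> carrier_vec n" "h \<cdot>\<^sub>v u1 - f \<cdot>\<^sub>v u3 = A *\<^sub>v v3"
    using diff[OF u1(1) u3(1) u1(2) u3(2)] by auto
  \<comment> \<open>The Koszul relation
    \<open>h (g u1 - f u2) = g (h u1 - f u3) - f (h u2 - g u3)\<close>, pulled back along the
    injective \<open>A\<close>.\<close>
  have "A *\<^sub>v (h \<cdot>\<^sub>v v1 - (g \<cdot>\<^sub>v v3 - f \<cdot>\<^sub>v v2))
      = h \<cdot>\<^sub>v (A *\<^sub>v v1) - (g \<cdot>\<^sub>v (A *\<^sub>v v3) - f \<cdot>\<^sub>v (A *\<^sub>v v2))"
    using A v1(1) v2(1) v3(1) by (simp add: mult_minus_distrib_mat_vec mult_mat_smult_vec)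
  also have "\<dots> = 0\<^sub>v m"
    unfolding v1(2)[symmetric] v2(2)[symmetric] v3(2)[symmetric]
    using u1 u2 u3 by (intro eq_vecI) (auto simp: algebra_simps)
  finally have "h \<cdot>\<^sub>v v1 - (g \<cdot>\<^sub>v v3 - f \<cdot>\<^sub>v v2) = 0\<^sub>v n"
    by (intro inj) (use v1 v2 v3 in auto)
  then have "(h \<cdot>\<^sub>v v1 - (g \<cdot>\<^sub>v v3 - f \<cdot>\<^sub>v v2)) $ i = 0" if "i < n" for i using that by simp
  then have "h \<cdot>\<^sub>v v1 = f \<cdot>\<^sub>v (- v2) + g \<cdot>\<^sub>v v3"
    using v1(1) v2(1) v3(1) by (intro eq_vecI) (auto simp: algebra_simps)
  then obtain s t where st: "s \<in> carrier_vec n" "t \<in> carrier_vec n" "v1 = f \<cdot>\<^sub>v s + g \<cdot>\<^sub>v t"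
    using regular3_vec3[OF reg v1(1) _ v3(1), of "- v2"] v2(1) by auto
  have "A *\<^sub>v v1 = f \<cdot>\<^sub>v (A *\<^sub>v s) + g \<cdot>\<^sub>v (A *\<^sub>v t)"
    unfolding st(3) using A st(1,2) by (simp add: mult_add_distrib_mat_vec mult_mat_smult_vec)
  with v1(2) have eq: "(g \<cdot>\<^sub>v u1 - f \<cdot>\<^sub>v u2) $ i = (f \<cdot>\<^sub>v (A *\<^sub>v s) + g \<cdot>\<^sub>v (A *\<^sub>v t)) $ i" for i by simp
  \<comment> \<open>Insert \<open>v1 = f s + g t\<close> into \<open>g u1 - f u2 = A v1\<close> and
    sort by \<open>f\<close> and \<open>g\<close>.\<close>
  have "g \<cdot>\<^sub>v (u1 - A *\<^sub>v t) = f \<cdot>\<^sub>v (u2 + A *\<^sub>v s)"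
  proof (rule eq_vecI)
    fix i assume "i < dim_vec (f \<cdot>\<^sub>v (u2 + A *\<^sub>v s))"
    then have i: "i < m" using A by simp
    then have "g * u1 $ i - f * u2 $ i = f * (A *\<^sub>v s) $ i + g * (A *\<^sub>v t) $ i"
      using eq[of i] u1(1) u2(1) A st(1,2) by auto
    then show "(g \<cdot>\<^sub>v (u1 - A *\<^sub>v t)) $ i = (f \<cdot>\<^sub>v (u2 + A *\<^sub>v s)) $ i"
      using i u1(1) u2(1) A by (auto simp: algebra_simps)
  qed (use u1(1) u2(1) A in auto)
  then obtain r where r: "r \<in> carrier_vec m" "u1 - A *\<^sub>v t = f \<cdot>\<^sub>v r"
    using regular3_vec2[OF reg, of "u1 - A *\<^sub>v t" m "u2 + A *\<^sub>v s"] u1(1) u2(1) A st by auto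
  \<comment> \<open>The correction \<open>A t\<close> is invisible to \<open>B\<close>, so
    \<open>f r\<close> is still a preimage of \<open>f e\<close>, and \<open>f\<close>
    cancels.\<close>
  have "B *\<^sub>v (A *\<^sub>v t) = (B * A) *\<^sub>v t" using A B st(2) by (simp add: assoc_mult_mat_vec)
  moreover have "0\<^sub>m k n *\<^sub>v t = 0\<^sub>v k" using st(2) by (intro eq_vecI) auto
  ultimately have "B *\<^sub>v (u1 - A *\<^sub>v t) = B *\<^sub>v u1"
    using A B st(2) u1(1) BA by (simp add: mult_minus_distrib_mat_vec[of _ k m])
  then have "f \<cdot>\<^sub>v e = f \<cdot>\<^sub>v (B *\<^sub>v r)" using r B u1(2) by (simp add: mult_mat_smult_vec)
  then show ?thesis using regular3_cancel_vec[OF reg e, of "B *\<^sub>v r"] B r by auto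
qed

section \<open>Bordered determinants and the middle map\<close>

definition unit_row :: "nat \<Rightarrow> nat \<Rightarrow> 'r::zero_neq_one" where
  "unit_row k = (\<lambda>j. if j = k then 1 else 0)"

text \<open>Two further rows make an \<open>n\<close> by \<open>n + 2\<close> matrix square. The
  determinant is an alternating bilinear form in \<open>y\<close> and \<open>z\<close> with the
  signed maximal minors as coefficients, so relations among minors become expansions of one
  determinant.\<close>

definition bordered :: "'r mat \<Rightarrow> (nat \<Rightarrow> 'r) \<Rightarrow> (nat \<Rightarrow> 'r) \<Rightarrow> 'r mat" where
  "bordered A y z = mat (dim_row A + 2) (dim_col A)
     (\<lambda>(i, j). if i < dim_row A then A $$ (i, j) else if i = dim_row A then y j else z j)"

lemma bordered_carrier: "A \<in> carrier_mat n (n + 2) \<Longrightarrow> bordered A y z \<in> carrier_mat (n + 2) (n + 2)"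
  by (auto simp: bordered_def)

lemma det_bordered_swap:
  fixes A :: "'r::comm_ring_1 mat"
  assumes A: "A \<in> carrier_mat n (n + 2)"
  shows "det (bordered A z y) = - det (bordered A y z)"
proof -
  have "swaprows n (Suc n) (bordered A y z) = bordered A z y"
    using A by (intro eq_matI) (auto simp: bordered_def)
  then show ?thesis
    using det_swaprows[OF _ _ _ bordered_carrier[OF A, of y z], of n "Suc n"] by auto
qed

lemma det_bordered_row:
  fixes A :: "'r::comm_ring_1 mat"
  assumes A: "A \<in> carrier_mat n (n + 2)" and i: "i < n"
  shows "det (bordered A (\<lambda>j. A $$ (i, j)) z) = 0"
  by (rule det_identical_rows[OF bordered_carrier[OF A], of i n])
    (use A i in \<open>auto simp: bordered_def intro!: eq_vecI\<close>)

text \<open>A cofactor does not see the row that it deletes, so this row may be replaced by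
  \<open>unit_row k\<close>; expansion along a unit row then leaves just this cofactor.\<close>

lemma cofactor_bordered:
  fixes A :: "'r::comm_ring_1 mat"
  assumes A: "A \<in> carrier_mat n (n + 2)" and k: "k < n + 2"
  shows "cofactor (bordered A y z) n k = det (bordered A (unit_row k) z)"
    and "cofactor (bordered A y z) (Suc n) k = det (bordered A y (unit_row k))"
proof -
  have "mat_delete (bordered A y z) n k = mat_delete (bordered A (unit_row k) z) n k"
    using A by (intro eq_matI) (auto simp: mat_delete_def bordered_def)
  then have "cofactor (bordered A y z) n k = cofactor (bordered A (unit_row k) z) n k"
    by (simp add: cofactor_def)
  also have "\<dots> = (\<Sum>j<n + 2. if j = k then cofactor (bordered A (unit_row k) z) n j else 0)"
    using k by simp
  also have "\<dots> = (\<Sum>j<n + 2. bordered A (unit_row k) z $$ (n, j) *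
      cofactor (bordered A (unit_row k) z) n j)"
    using A by (intro sum.cong) (auto simp: bordered_def unit_row_def)
  also have "\<dots> = det (bordered A (unit_row k) z)"
    by (rule laplace_expansion_row[OF bordered_carrier[OF A], symmetric]) auto
  finally show "cofactor (bordered A y z) n k = det (bordered A (unit_row k) z)" .
  have "mat_delete (bordered A y z) (Suc n) k = mat_delete (bordered A y (unit_row k)) (Suc n) k"
    using A by (intro eq_matI) (auto simp: mat_delete_def bordered_def)
  then have "cofactor (bordered A y z) (Suc n) k = cofactor (bordered A y (unit_row k)) (Suc n) k"
    by (simp add: cofactor_def)
  also have "\<dots> = (\<Sum>j<n + 2. if j = k then cofactor (bordered A y (unit_row k)) (Suc n) j else 0)"
    using k by simp
  also have "\<dots> = (\<Sum>j<n + 2. bordered A y (unit_row k) $$ (Suc n, j) *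
      cofactor (bordered A y (unit_row k)) (Suc n) j)"
    using A by (intro sum.cong) (auto simp: bordered_def unit_row_def)
  also have "\<dots> = det (bordered A y (unit_row k))"
    by (rule laplace_expansion_row[OF bordered_carrier[OF A], symmetric]) auto
  finally show "cofactor (bordered A y z) (Suc n) k = det (bordered A y (unit_row k))" .
qed

lemma det_bordered_expand:
  fixes A :: "'r::comm_ring_1 mat"
  assumes A: "A \<in> carrier_mat n (n + 2)"
  shows "det (bordered A y z) = (\<Sum>k<n + 2. y k * det (bordered A (unit_row k) z))"
proof -
  have "det (bordered A y z) = (\<Sum>k<n + 2. bordered A y z $$ (n, k) * cofactor (bordered A y z) n k)"
    by (rule laplace_expansion_row[OF bordered_carrier[OF A]]) auto
  also have "\<dots> = (\<Sum>k<n + 2. y k * det (bordered A (unit_row k) z))"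
    using A by (intro sum.cong) (auto simp: cofactor_bordered[OF A], simp add: bordered_def)
  finally show ?thesis .
qed

text \<open>Up to sign, the entry \<open>(k, l)\<close> is the maximal minor of \<open>A\<close> that omits the columns \<open>k\<close> and
  \<open>l\<close>; this is the middle map of the Buchsbaum-Rim complex of \<open>A\<close>.\<close>

definition br_map :: "'r::comm_ring_1 mat \<Rightarrow> 'r mat" where
  "br_map A = mat (dim_col A) (dim_col A) (\<lambda>(k, l). det (bordered A (unit_row k) (unit_row l)))"

lemma br_map_carrier: "A \<in> carrier_mat n (n + 2) \<Longrightarrow> br_map A \<in> carrier_mat (n + 2) (n + 2)"
  by (auto simp: br_map_def)

lemma br_map_index:
  "A \<in> carrier_mat n (n + 2) \<Longrightarrow> k < n + 2 \<Longrightarrow> l < n + 2 \<Longrightarrow>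
    br_map A $$ (k, l) = det (bordered A (unit_row k) (unit_row l))"
  by (auto simp: br_map_def)

lemma br_map_transpose:
  fixes A :: "'r::comm_ring_1 mat"
  assumes A: "A \<in> carrier_mat n (n + 2)"
  shows "transpose_mat (br_map A) = - br_map A"
  using A by (intro eq_matI) (auto simp: br_map_def intro: det_bordered_swap)

text \<open>By expansion along the first border row, entry \<open>(i, l)\<close> of the product is a
  determinant in which row \<open>i\<close> of \<open>A\<close> occurs twice.\<close>

lemma mult_br_map:
  fixes A :: "'r::comm_ring_1 mat"
  assumes A: "A \<in> carrier_mat n (n + 2)"
  shows "A * br_map A = 0\<^sub>m n (n + 2)"
proof (rule eq_matI)
  fix i l assume "i < dim_row (0\<^sub>m n (n + 2) :: 'r mat)" "l < dim_col (0\<^sub>m n (n + 2) :: 'r mat)"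
  then have i: "i < n" and l: "l < n + 2" by auto
  have "(A * br_map A) $$ (i, l) = (\<Sum>k<n + 2. A $$ (i, k) * br_map A $$ (k, l))"
    using A i l br_map_carrier[OF A] by (simp add: scalar_prod_def atLeast0LessThan)
  also have "\<dots> = det (bordered A (\<lambda>j. A $$ (i, j)) (unit_row l))"
    by (subst det_bordered_expand[OF A]) (use l in \<open>auto simp: br_map_index[OF A]\<close>)
  also have "\<dots> = 0" by (rule det_bordered_row[OF A i])
  finally show "(A * br_map A) $$ (i, l) = 0\<^sub>m n (n + 2) $$ (i, l)" using i l by simp
qed (use A br_map_carrier[OF A] in auto)

text \<open>The transpose of \<open>mult_br_map\<close>, by skew-symmetry of
  \<open>br_map A\<close>.\<close>

lemma br_map_mult_transpose:
  fixes A :: "'r::comm_ring_1 mat"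
  assumes A: "A \<in> carrier_mat n (n + 2)"
  shows "br_map A * transpose_mat A = 0\<^sub>m (n + 2) n"
proof -
  have "transpose_mat (A * br_map A) = transpose_mat (br_map A) * transpose_mat A"
    using A br_map_carrier[OF A] by (rule transpose_mult)
  then have *: "- br_map A * transpose_mat A = 0\<^sub>m (n + 2) n"
    by (simp add: mult_br_map[OF A] br_map_transpose[OF A])
  have "br_map A * transpose_mat A = - (- br_map A * transpose_mat A)"
    using A br_map_carrier[OF A] by (subst uminus_mult_left_mat) auto
  then show ?thesis using * by (auto intro!: eq_matI)
qed

section \<open>Entries of the middle map kill the homology\<close>

lemma sum_two_last: "(\<Sum>i<n + 2. f i) = (\<Sum>i<n. f i) + f n + (f (Suc n) :: 'r::comm_ring_1)"
  by (simp add: add.assoc)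

text \<open>As \<open>A e = 0\<close>, the bordered matrix sends \<open>e\<close> to a vector
  supported in the last two places, with values \<open>e $ k\<close> and \<open>e $ l\<close>.
  Applying the adjugate recovers the determinant times \<open>e\<close> from the last two columns of
  the adjugate, which are columns of \<open>br_map A\<close> up to sign.\<close>

lemma br_map_smult_kernel:
  fixes A :: "'r::comm_ring_1 mat"
  assumes A: "A \<in> carrier_mat n (n + 2)" and e: "e \<in> carrier_vec (n + 2)" "A *\<^sub>v e = 0\<^sub>v n"
    and k: "k < n + 2" and l: "l < n + 2"
  shows "\<exists>u \<in> carrier_vec (n + 2). br_map A $$ (k, l) \<cdot>\<^sub>v e = br_map A *\<^sub>v u"
\<comment> \<open>Column \<open>n\<close> of the adjugate is column \<open>l\<close> of
  \<open>br_map A\<close>, and its last column is minus column \<open>k\<close>; hence these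
  coefficients.\<close>
proof (rule bexI[of _ "vec (n + 2) (\<lambda>i. e $ k * unit_row l i - e $ l * unit_row k i)"])
  let ?M = "bordered A (unit_row k) (unit_row l)"
  let ?u = "vec (n + 2) (\<lambda>i. e $ k * unit_row l i - e $ l * unit_row k i)"
  note M = bordered_carrier[OF A, of "unit_row k" "unit_row l"]
  have Me: "(?M *\<^sub>v e) $ i = (if i < n then 0 else if i = n then e $ k else e $ l)" if "i < n + 2" for i
  proof -
    have *: "(?M *\<^sub>v e) $ i = (\<Sum>j<n + 2. ?M $$ (i, j) * e $ j)"
      using M e that by (simp add: scalar_prod_def atLeast0LessThan)
    consider "i < n" | "i = n" | "i = Suc n" using \<open>i < n + 2\<close> by force
    then show ?thesis
    proof cases
      case 1
      then have "(?M *\<^sub>v e) $ i = (\<Sum>j<n + 2. A $$ (i, j) * e $ j)"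
        unfolding * using A by (intro sum.cong) (auto simp: bordered_def)
      also have "\<dots> = (A *\<^sub>v e) $ i"
        using 1 A e(1) by (simp add: scalar_prod_def atLeast0LessThan)
      finally show ?thesis using 1 e(2) by simp
    next
      case 2
      then have "(?M *\<^sub>v e) $ i = (\<Sum>j<n + 2. if j = k then e $ j else 0)"
        unfolding * using A by (intro sum.cong) (auto simp: bordered_def unit_row_def)
      then show ?thesis using 2 k by simp
    next
      case 3
      then have "(?M *\<^sub>v e) $ i = (\<Sum>j<n + 2. if j = l then e $ j else 0)"
        unfolding * using A by (intro sum.cong) (auto simp: bordered_def unit_row_def)
      then show ?thesis using 3 l by simp
    qed
  qed
  show "br_map A $$ (k, l) \<cdot>\<^sub>v e = br_map A *\<^sub>v ?u"
  proof (rule eq_vecI)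
    fix i assume "i < dim_vec (br_map A *\<^sub>v ?u)"
    then have i: "i < n + 2" using br_map_carrier[OF A] by simp
    have "adj_mat ?M *\<^sub>v (?M *\<^sub>v e) = (det ?M \<cdot>\<^sub>m 1\<^sub>m (n + 2)) *\<^sub>v e"
      using adj_mat[OF M] M e by (metis assoc_mult_mat_vec)
    also have "\<dots> = det ?M \<cdot>\<^sub>v e" using e by auto
    finally have "det ?M * e $ i = (adj_mat ?M *\<^sub>v (?M *\<^sub>v e)) $ i" using i e by simp
    also have "\<dots> = (\<Sum>r<n + 2. adj_mat ?M $$ (i, r) * (?M *\<^sub>v e) $ r)"
      using adj_mat(1)[OF M] M i by (simp add: scalar_prod_def atLeast0LessThan)
    also have "\<dots> = (\<Sum>r<n + 2. cofactor ?M r i * (if r < n then 0 else if r = n then e $ k else e $ l))"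
      using M i by (intro sum.cong) (simp_all add: Me adj_mat_def del: index_mult_mat_vec)
    also have "\<dots> = cofactor ?M n i * e $ k + cofactor ?M (Suc n) i * e $ l"
      unfolding sum_two_last by simp
    also have "\<dots> = e $ k * br_map A $$ (i, l) - e $ l * br_map A $$ (i, k)"
      using i k l det_bordered_swap[OF A, of "unit_row k" "unit_row i"]
      by (simp add: cofactor_bordered[OF A] br_map_index[OF A] mult.commute)
    also have "\<dots> = (\<Sum>r<n + 2. if r = l then e $ k * br_map A $$ (i, r) else 0)
        - (\<Sum>r<n + 2. if r = k then e $ l * br_map A $$ (i, r) else 0)"
      using k l by (simp del: add_2_eq_Suc')
    also have "\<dots> = (\<Sum>r<n + 2. br_map A $$ (i, r) * ?u $ r)"
      unfolding sum_subtractf[symmetric]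
      by (intro sum.cong) (auto simp: unit_row_def algebra_simps)
    also have "\<dots> = (br_map A *\<^sub>v ?u) $ i"
      using br_map_carrier[OF A] i by (simp add: scalar_prod_def atLeast0LessThan)
    finally show "(br_map A $$ (k, l) \<cdot>\<^sub>v e) $ i = (br_map A *\<^sub>v ?u) $ i"
      using i k l e by (simp add: br_map_index[OF A])
  qed (use e br_map_carrier[OF A] in auto)
qed simp

text \<open>The transposed argument. For \<open>w\<close> the transposed adjugate applied to
  \<open>u\<close>, the last two entries are, up to sign, entries of \<open>br_map A\<close> applied
  to \<open>u\<close>, hence 0. So only the rows of \<open>A\<close> contribute when the transposed
  bordered matrix sends \<open>w\<close> to the determinant times \<open>u\<close>.\<close>

lemma br_map_smult_image:
  fixes A :: "'r::comm_ring_1 mat"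
  assumes A: "A \<in> carrier_mat n (n + 2)" and u: "u \<in> carrier_vec (n + 2)" "br_map A *\<^sub>v u = 0\<^sub>v (n + 2)"
    and k: "k < n + 2" and l: "l < n + 2"
  shows "\<exists>w \<in> carrier_vec n. br_map A $$ (k, l) \<cdot>\<^sub>v u = transpose_mat A *\<^sub>v w"
proof -
  let ?M = "bordered A (unit_row k) (unit_row l)"
  note M = bordered_carrier[OF A, of "unit_row k" "unit_row l"]
  define w where "w = transpose_mat (adj_mat ?M) *\<^sub>v u"
  have w: "w $ r = (\<Sum>i<n + 2. cofactor ?M r i * u $ i)" if "r < n + 2" for r
    using that M u adj_mat(1)[OF M] unfolding w_def
    by (auto simp: scalar_prod_def atLeast0LessThan adj_mat_def)
  have wc: "w \<in> carrier_vec (n + 2)"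
    unfolding w_def by (rule mult_mat_vec_carrier[OF _ u(1)]) (use adj_mat(1)[OF M] in simp)
  have zero: "(\<Sum>i<n + 2. br_map A $$ (r, i) * u $ i) = 0" if "r < n + 2" for r
  proof -
    have "(\<Sum>i<n + 2. br_map A $$ (r, i) * u $ i) = (br_map A *\<^sub>v u) $ r"
      using br_map_carrier[OF A] u(1) that by (simp add: scalar_prod_def atLeast0LessThan)
    then show ?thesis using u(2) that by simp
  qed
  have Suc_n: "Suc n < n + 2" and n: "n < n + 2" by simp_all
  have "w $ Suc n = (\<Sum>i<n + 2. br_map A $$ (k, i) * u $ i)"
    unfolding w[of "Suc n", OF Suc_n] using k
    by (intro sum.cong) (simp_all add: cofactor_bordered[OF A] br_map_index[OF A] k)
  then have "w $ Suc n = 0" using zero[OF k] by simp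
  have "w $ n = (\<Sum>i<n + 2. - (br_map A $$ (l, i) * u $ i))"
    unfolding w[of n, OF n] using l by (intro sum.cong)
      (simp_all add: cofactor_bordered[OF A] br_map_index[OF A] l det_bordered_swap[OF A, of "unit_row l"])
  then have "w $ n = 0" by (simp only: sum_negf zero[OF l] minus_zero)
  show ?thesis
  proof (rule bexI[of _ "vec n (\<lambda>r. w $ r)"])
    have "transpose_mat ?M *\<^sub>v w = transpose_mat (adj_mat ?M * ?M) *\<^sub>v u"
      unfolding w_def using adj_mat(1)[OF M] M u
      by (simp add: transpose_mult[OF adj_mat(1)[OF M] M] assoc_mult_mat_vec[of _ "n+2" "n+2"])
    also have "\<dots> = (det ?M \<cdot>\<^sub>m 1\<^sub>m (n + 2)) *\<^sub>v u"
      unfolding adj_mat(3)[OF M] by (simp add: transpose_smult_one)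
    also have "\<dots> = det ?M \<cdot>\<^sub>v u" using u by auto
    finally have eq: "det ?M \<cdot>\<^sub>v u = transpose_mat ?M *\<^sub>v w" ..
    show "br_map A $$ (k, l) \<cdot>\<^sub>v u = transpose_mat A *\<^sub>v vec n (\<lambda>r. w $ r)"
    proof (rule eq_vecI)
      fix i assume "i < dim_vec (transpose_mat A *\<^sub>v vec n (\<lambda>r. w $ r))"
      then have i: "i < n + 2" using A by simp
      have "(br_map A $$ (k, l) \<cdot>\<^sub>v u) $ i = (transpose_mat ?M *\<^sub>v w) $ i"
        using eq k l by (simp add: br_map_index[OF A])
      also have "\<dots> = (\<Sum>r<n + 2. ?M $$ (r, i) * w $ r)"
        using M wc i by (simp add: scalar_prod_def atLeast0LessThan)
      also have "\<dots> = (\<Sum>r<n. A $$ (r, i) * w $ r)"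
        unfolding sum_two_last using \<open>w $ n = 0\<close> \<open>w $ Suc n = 0\<close> A i
        by (simp add: bordered_def)
      also have "\<dots> = (transpose_mat A *\<^sub>v vec n (\<lambda>r. w $ r)) $ i"
        using A i by (simp add: scalar_prod_def atLeast0LessThan)
      finally show "(br_map A $$ (k, l) \<cdot>\<^sub>v u) $ i = (transpose_mat A *\<^sub>v vec n (\<lambda>r. w $ r)) $ i" .
    qed (use A u in auto)
  qed simp
qed

section \<open>From annihilators of the cokernel to combinations of minors\<close>

lemma det_two_by_two:
  fixes M :: "'r::comm_ring_1 mat"
  assumes M: "M \<in> carrier_mat 2 2"
  shows "det M = M $$ (0, 0) * M $$ (1, 1) - M $$ (0, 1) * M $$ (1, 0)"
proof -
  have two: "{..<2::nat} = {0, 1}" by auto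
  have "det M = (\<Sum>j<2. M $$ (0, j) * cofactor M 0 j)"
    by (rule laplace_expansion_row[OF M]) simp
  also have "\<dots> = M $$ (0, 0) * det (mat_delete M 0 0) - M $$ (0, 1) * det (mat_delete M 0 1)"
    by (simp add: two cofactor_def)
  also have "det (mat_delete M 0 0) = M $$ (1, 1)"
    using M by (subst det_single) (auto simp: mat_delete_def)
  also have "det (mat_delete M 0 1) = M $$ (1, 0)"
    using M by (subst det_single) (auto simp: mat_delete_def)
  finally show ?thesis .
qed

text \<open>\<open>P = f - B A\<close> is \<open>f\<close> times a projection of rank two, so its principal 2-minors add up to \<open>f\<^sup>2\<close>;
  each of them, times \<open>f ^ n\<close>, is a multiple of an entry of \<open>br_map A\<close>.\<close>

lemma br_map_combination:
  fixes A :: "'r::idom mat"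
  assumes A: "A \<in> carrier_mat n (n + 2)" and B: "B \<in> carrier_mat (n + 2) n"
    and AB: "A * B = f \<cdot>\<^sub>m 1\<^sub>m n"
  shows "\<exists>c. 2 * f ^ (n + 2) = (\<Sum>k<n + 2. \<Sum>l<n + 2. br_map A $$ (k, l) * c k l)"
proof -
  define N where "N = n + 2"
  define P where "P = f \<cdot>\<^sub>m 1\<^sub>m N - B * A"
  have P: "P \<in> carrier_mat N N" using A B by (auto simp: P_def N_def)
  have Pi: "P $$ (i, j) = (if i = j then f else 0) - (\<Sum>r<n. B $$ (i, r) * A $$ (r, j))"
    if "i < N" "j < N" for i j
    using that A B by (simp add: P_def N_def scalar_prod_def atLeast0LessThan)
  have ABi: "(\<Sum>j<N. A $$ (r, j) * B $$ (j, s)) = (if r = s then f else 0)" if "r < n" "s < n" for r s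
  proof -
    have "(A * B) $$ (r, s) = (\<Sum>j<N. A $$ (r, j) * B $$ (j, s))"
      using that A B by (simp add: N_def scalar_prod_def atLeast0LessThan)
    then show ?thesis using that by (cases "r = s") (simp_all add: AB)
  qed
  have AP: "A * P = 0\<^sub>m n N"
  proof -
    have "A * P = A * (f \<cdot>\<^sub>m 1\<^sub>m N) - A * (B * A)"
      unfolding P_def by (rule mult_minus_distrib_mat) (use A B in \<open>auto simp: N_def\<close>)
    also have "A * (B * A) = (f \<cdot>\<^sub>m 1\<^sub>m n) * A"
      using A B AB by (simp add: assoc_mult_mat[symmetric])
    also have "A * (f \<cdot>\<^sub>m 1\<^sub>m N) - \<dots> = 0\<^sub>m n N"
      using A by (auto simp: N_def mult_smult_distrib)
    finally show ?thesis .
  qed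
  have APi: "(\<Sum>j<N. A $$ (r, j) * P $$ (j, k)) = 0" if "r < n" "k < N" for r k
  proof -
    have "(A * P) $$ (r, k) = (\<Sum>j<N. A $$ (r, j) * P $$ (j, k))"
      using that A P by (simp add: N_def scalar_prod_def atLeast0LessThan)
    then show ?thesis using that by (simp add: AP)
  qed
  \<comment> \<open>\<open>B A\<close> has the same trace as \<open>A B\<close>, namely
    \<open>n\<close> times \<open>f\<close>, while \<open>f\<close> times the identity has trace
    \<open>(n + 2) f\<close>.\<close>
  have tr: "(\<Sum>k<N. P $$ (k, k)) = 2 * f"
  proof -
    have "(\<Sum>k<N. P $$ (k, k)) = (\<Sum>k<N. f) - (\<Sum>k<N. \<Sum>r<n. B $$ (k, r) * A $$ (r, k))"
      by (simp add: Pi sum_subtractf)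
    also have "(\<Sum>k<N. \<Sum>r<n. B $$ (k, r) * A $$ (r, k)) = (\<Sum>r<n. \<Sum>k<N. A $$ (r, k) * B $$ (k, r))"
      by (subst sum.swap) (simp add: mult.commute)
    also have "\<dots> = (\<Sum>r<n. f)" by (simp add: ABi)
    finally show ?thesis by (simp add: N_def algebra_simps)
  qed
  \<comment> \<open>The diagonal of \<open>P P = f P\<close>, which holds because
    \<open>B A P = 0\<close>.\<close>
  have PP: "(\<Sum>l<N. P $$ (k, l) * P $$ (l, k)) = f * P $$ (k, k)" if k: "k < N" for k
  proof -
    have "(\<Sum>l<N. P $$ (k, l) * P $$ (l, k)) =
        (\<Sum>l<N. (if k = l then f * P $$ (l, k) else 0)) - (\<Sum>l<N. \<Sum>r<n. B $$ (k, r) * (A $$ (r, l) * P $$ (l, k)))"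
      unfolding sum_subtractf[symmetric] using k
      by (intro sum.cong) (auto simp: Pi[of k] algebra_simps sum_distrib_left sum_distrib_right)
    also have "(\<Sum>l<N. \<Sum>r<n. B $$ (k, r) * (A $$ (r, l) * P $$ (l, k)))
        = (\<Sum>r<n. B $$ (k, r) * (\<Sum>l<N. A $$ (r, l) * P $$ (l, k)))"
      by (subst sum.swap) (simp add: sum_distrib_left)
    also have "\<dots> = 0" using k by (simp add: APi)
    finally show ?thesis using k by simp
  qed
  \<comment> \<open>\<open>Q k l\<close> is \<open>B\<close> followed by columns \<open>k\<close>
    and \<open>l\<close> of \<open>P\<close>. Multiplied by the bordered matrix, its upper rows
    become \<open>A B\<close> and \<open>A P = 0\<close>, so the product is block triangular with a
    principal 2-minor of \<open>P\<close> in the corner.\<close>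
  define Q where "Q k l = mat N N (\<lambda>(i, j). if j < n then B $$ (i, j) else if j = n then P $$ (i, k) else P $$ (i, l))" for k l
  have minor: "br_map A $$ (k, l) * det (Q k l) = f ^ n * (P $$ (k, k) * P $$ (l, l) - P $$ (k, l) * P $$ (l, k))"
    if k: "k < N" and l: "l < N" for k l
  proof -
    let ?M = "bordered A (unit_row k) (unit_row l)"
    have M: "?M \<in> carrier_mat N N" using bordered_carrier[OF A] by (simp add: N_def)
    let ?C = "mat 2 n (\<lambda>(i, j). B $$ (if i = 0 then k else l, j))"
    let ?D = "mat 2 2 (\<lambda>(i, j). P $$ (if i = 0 then k else l, if j = 0 then k else l))"
    have entry: "(?M * Q k l) $$ (i, j) = (if i < n then \<Sum>r<N. A $$ (i, r) * Q k l $$ (r, j)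
        else Q k l $$ (if i = n then k else l, j))" if "i < N" "j < N" for i j
    proof -
      have *: "(?M * Q k l) $$ (i, j) = (\<Sum>r<N. ?M $$ (i, r) * Q k l $$ (r, j))"
        using that M by (simp add: Q_def scalar_prod_def atLeast0LessThan)
      have "\<dots> = (\<Sum>r<N. if i < n then A $$ (i, r) * Q k l $$ (r, j)
          else if r = (if i = n then k else l) then Q k l $$ (r, j) else 0)"
        using A that by (intro sum.cong) (auto simp: bordered_def unit_row_def N_def)
      then show ?thesis unfolding * using k l by auto
    qed
    have "?M * Q k l = four_block_mat (f \<cdot>\<^sub>m 1\<^sub>m n) (0\<^sub>m n 2) ?C ?D"
    proof (rule eq_matI)
      fix i j assume "i < dim_row (four_block_mat (f \<cdot>\<^sub>m 1\<^sub>m n) (0\<^sub>m n 2) ?C ?D)"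
        "j < dim_col (four_block_mat (f \<cdot>\<^sub>m 1\<^sub>m n) (0\<^sub>m n 2) ?C ?D)"
      then have ij: "i < N" "j < N" by (auto simp: N_def)
      show "(?M * Q k l) $$ (i, j) = four_block_mat (f \<cdot>\<^sub>m 1\<^sub>m n) (0\<^sub>m n 2) ?C ?D $$ (i, j)"
      proof (cases "i < n")
        case True
        have "(\<Sum>r<N. A $$ (i, r) * Q k l $$ (r, j)) = (if j < n then if i = j then f else 0 else 0)"
          using ij True ABi[of i j] APi[of i k] APi[of i l] k l
          by (cases "j < n"; cases "j = n") (simp_all add: Q_def)
        then show ?thesis unfolding entry[OF ij] using True ij by (auto simp: N_def)
      next
        case False
        then show ?thesis unfolding entry[OF ij] using ij k l by (auto simp: N_def Q_def)
      qed
    qed (use M in \<open>auto simp: Q_def N_def\<close>)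
    then have "det ?M * det (Q k l) = det (four_block_mat (f \<cdot>\<^sub>m 1\<^sub>m n) (0\<^sub>m n 2) ?C ?D)"
      using det_mult[OF M, of "Q k l"] by (simp add: Q_def)
    also have "\<dots> = det (f \<cdot>\<^sub>m 1\<^sub>m n) * det ?D"
      by (rule det_four_block_mat_upper_right_zero) auto
    also have "det ?D = P $$ (k, k) * P $$ (l, l) - P $$ (k, l) * P $$ (l, k)"
      by (subst det_two_by_two) auto
    finally show ?thesis using k l by (simp add: br_map_index[OF A] N_def)
  qed
  \<comment> \<open>The sum is \<open>f ^ n\<close> times the square of the trace of
    \<open>P\<close> minus the trace of \<open>P P\<close>, that is, \<open>4 f^2 - 2 f^2\<close>.
    All ordered pairs are summed, hence the factor 2.\<close>
  have "(\<Sum>k<N. \<Sum>l<N. br_map A $$ (k, l) * det (Q k l))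
      = (\<Sum>k<N. \<Sum>l<N. f ^ n * (P $$ (k, k) * P $$ (l, l) - P $$ (k, l) * P $$ (l, k)))"
    by (simp add: minor)
  also have "\<dots> = f ^ n * ((\<Sum>k<N. P $$ (k, k)) * (\<Sum>l<N. P $$ (l, l)) - (\<Sum>k<N. \<Sum>l<N. P $$ (k, l) * P $$ (l, k)))"
    by (simp add: sum_distrib_left[symmetric] sum_distrib_right[symmetric] sum_subtractf right_diff_distrib)
  also have "(\<Sum>k<N. \<Sum>l<N. P $$ (k, l) * P $$ (l, k)) = f * (\<Sum>k<N. P $$ (k, k))"
    by (simp add: PP sum_distrib_left)
  also have "f ^ n * ((\<Sum>k<N. P $$ (k, k)) * (\<Sum>l<N. P $$ (l, l)) - \<dots>) = 2 * f ^ (n + 2)"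
    unfolding tr by (simp add: algebra_simps)
  finally show ?thesis unfolding N_def by (intro exI[of _ "\<lambda>k l. det (Q k l)"]) simp
qed

text \<open>Column \<open>s\<close> of \<open>B\<close> is a preimage of \<open>f\<close> times the
  basis vector \<open>s\<close>, so this says that \<open>f\<close> kills the cokernel, in a form
  that multiplies well with other matrices.\<close>

definition annihilates_coker :: "'r::comm_ring_1 mat \<Rightarrow> 'r \<Rightarrow> bool" where
  "annihilates_coker A f \<longleftrightarrow> (\<exists>B \<in> carrier_mat (dim_col A) (dim_row A). A * B = f \<cdot>\<^sub>m 1\<^sub>m (dim_row A))"

text \<open>The ring elements that carry \<open>e\<close> into the image of \<open>M\<close> form an
  ideal.\<close>

lemma image_of_combination:
  fixes M :: "'r::comm_ring_1 mat"
  assumes M: "M \<in> carrier_mat m k" and e: "e \<in> carrier_vec m" and "finite S"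
    and ex: "\<And>s. s \<in> S \<Longrightarrow> \<exists>u \<in> carrier_vec k. p s \<cdot>\<^sub>v e = M *\<^sub>v u"
  shows "\<exists>u \<in> carrier_vec k. (\<Sum>s\<in>S. p s * c s) \<cdot>\<^sub>v e = M *\<^sub>v u"
  using \<open>finite S\<close> ex
proof (induction S rule: finite_induct)
  case empty
  have "0 \<cdot>\<^sub>v e = M *\<^sub>v 0\<^sub>v k" using M e by (intro eq_vecI) auto
  then show ?case by (auto intro!: bexI[of _ "0\<^sub>v k"])
next
  case (insert s S)
  obtain u where u: "u \<in> carrier_vec k" "(\<Sum>s\<in>S. p s * c s) \<cdot>\<^sub>v e = M *\<^sub>v u"
    using insert by auto
  obtain v where v: "v \<in> carrier_vec k" "p s \<cdot>\<^sub>v e = M *\<^sub>v v" using insert.prems by auto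
  have "(\<Sum>s\<in>insert s S. p s * c s) \<cdot>\<^sub>v e = c s \<cdot>\<^sub>v (p s \<cdot>\<^sub>v e) + (\<Sum>s\<in>S. p s * c s) \<cdot>\<^sub>v e"
    using insert.hyps e by (intro eq_vecI) (auto simp: algebra_simps)
  also have "\<dots> = M *\<^sub>v (c s \<cdot>\<^sub>v v + u)"
    unfolding u(2) v(2) using M u(1) v(1)
    by (simp add: mult_add_distrib_mat_vec[of _ m k] mult_mat_smult_vec)
  finally show ?case using u(1) v(1) by (intro bexI[of _ "c s \<cdot>\<^sub>v v + u"]) auto
qed

text \<open>By \<open>br_map_combination\<close>, \<open>2 * f ^ (n + 2)\<close> lies in the ideal
  of the entries of \<open>br_map A\<close>, and 2 is a unit. This is where the characteristic
  matters.\<close>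

lemma image_of_power:
  fixes A M :: "'r::idom mat"
  assumes A: "A \<in> carrier_mat n (n + 2)" and ann: "annihilates_coker A f" and two: "(2::'r) dvd 1"
    and M: "M \<in> carrier_mat m k" and e: "e \<in> carrier_vec m"
    and ex: "\<And>i j. i < n + 2 \<Longrightarrow> j < n + 2 \<Longrightarrow> \<exists>u \<in> carrier_vec k. br_map A $$ (i, j) \<cdot>\<^sub>v e = M *\<^sub>v u"
  shows "\<exists>u \<in> carrier_vec k. f ^ (n + 2) \<cdot>\<^sub>v e = M *\<^sub>v u"
proof -
  obtain c where "2 * f ^ (n + 2) = (\<Sum>k<n + 2. \<Sum>l<n + 2. br_map A $$ (k, l) * c k l)"
    using br_map_combination[OF A] ann A unfolding annihilates_coker_def by force
  moreover obtain t :: 'r where "1 = 2 * t" using two by (auto simp: dvd_def)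
  moreover have "f ^ (n + 2) = 2 * f ^ (n + 2) * t" if "1 = 2 * t" for t
    using that by (metis mult.assoc mult.commute mult.right_neutral)
  ultimately have "f ^ (n + 2) = (\<Sum>k<n + 2. \<Sum>l<n + 2. br_map A $$ (k, l) * c k l) * t"
    by presburger
  also have "\<dots> = (\<Sum>(k, l)\<in>{..<n + 2} \<times> {..<n + 2}. br_map A $$ (k, l) * (c k l * t))"
    by (simp only: sum.cartesian_product sum_distrib_right mult.assoc case_prod_unfold)
  finally have *: "f ^ (n + 2) =
      (\<Sum>s\<in>{..<n + 2} \<times> {..<n + 2}. br_map A $$ s * (c (fst s) (snd s) * t))"
    by (simp only: case_prod_unfold prod.collapse)
  show ?thesis unfolding * by (rule image_of_combination[OF M e]) (use ex in auto)
qed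

text \<open>Exactness is obtained from the injective end onwards. There \<open>A B = f\<close>
  transposes to a left inverse of the transposed \<open>A\<close> up to the factor \<open>f\<close>;
  the other two spots use the two lifting lemmas with the powers supplied by
  \<open>image_of_power\<close>.\<close>

theorem buchsbaum_rim_exact:
  fixes A :: "'r::idom mat"
  assumes A: "A \<in> carrier_mat n (n + 2)" and two: "(2::'r) dvd 1"
    and f: "annihilates_coker A f" and g: "annihilates_coker A g" and h: "annihilates_coker A h"
    and reg: "regular3 (f ^ (n + 2)) (g ^ (n + 2)) (h ^ (n + 2))"
  shows "\<And>v. v \<in> carrier_vec n \<Longrightarrow> transpose_mat A *\<^sub>v v = 0\<^sub>v (n + 2) \<Longrightarrow> v = 0\<^sub>v n"
    and "\<And>u. u \<in> carrier_vec (n + 2) \<Longrightarrow> br_map A *\<^sub>v u = 0\<^sub>v (n + 2) \<Longrightarrow>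
      \<exists>v \<in> carrier_vec n. u = transpose_mat A *\<^sub>v v"
    and "\<And>e. e \<in> carrier_vec (n + 2) \<Longrightarrow> A *\<^sub>v e = 0\<^sub>v n \<Longrightarrow>
      \<exists>u \<in> carrier_vec (n + 2). e = br_map A *\<^sub>v u"
proof -
  have At: "transpose_mat A \<in> carrier_mat (n + 2) n" using A by simp
  note D = br_map_carrier[OF A]
  show inj: "v = 0\<^sub>v n" if v: "v \<in> carrier_vec n" "transpose_mat A *\<^sub>v v = 0\<^sub>v (n + 2)" for v
  proof -
    obtain B where B: "B \<in> carrier_mat (n + 2) n" "A * B = f \<cdot>\<^sub>m 1\<^sub>m n"
      using f A by (auto simp: annihilates_coker_def)
    have "f \<cdot>\<^sub>v v = transpose_mat (A * B) *\<^sub>v v"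
      using v(1) unfolding B(2) by (auto simp: transpose_smult_one)
    also have "\<dots> = transpose_mat B *\<^sub>v (transpose_mat A *\<^sub>v v)"
      using A B(1) v(1) by (simp add: transpose_mult assoc_mult_mat_vec[of _ n "n+2" _ n])
    also have "\<dots> = 0\<^sub>v n" using B(1) v(2) by (intro eq_vecI) auto
    finally have "f \<cdot>\<^sub>v v = 0\<^sub>v n" .
    then have "f * v $ i = 0" if "i < n" for i
      using v(1) that by (metis carrier_vecD index_smult_vec(1) index_zero_vec(1))
    \<comment> \<open>Otherwise the positive power of \<open>f\<close> would be 0, which is a zero
      divisor because 1 differs from 0.\<close>
    moreover have "f \<noteq> 0" using reg unfolding regular3_def by (metis one_neq_zero mult_zero_left power_0_left add_is_0 zero_neq_numeral)
    ultimately show ?thesis using v(1) by (intro eq_vecI) auto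
  qed
  show ex: "\<exists>v \<in> carrier_vec n. u = transpose_mat A *\<^sub>v v"
    if u: "u \<in> carrier_vec (n + 2)" "br_map A *\<^sub>v u = 0\<^sub>v (n + 2)" for u
  proof -
    note pow = image_of_power[OF A _ two At u(1) br_map_smult_image[OF A u]]
    obtain w where "w \<in> carrier_vec n" "f ^ (n + 2) \<cdot>\<^sub>v u = transpose_mat A *\<^sub>v w" using pow[OF f] by auto
    moreover obtain w' where "w' \<in> carrier_vec n" "g ^ (n + 2) \<cdot>\<^sub>v u = transpose_mat A *\<^sub>v w'"
      using pow[OF g] by auto
    ultimately show ?thesis by (intro mem_image_of_two_multiples[OF reg At inj u(1)])
  qed
  show "\<exists>u \<in> carrier_vec (n + 2). e = br_map A *\<^sub>v u"
    if e: "e \<in> carrier_vec (n + 2)" "A *\<^sub>v e = 0\<^sub>v n" for e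
  proof -
    note pow = image_of_power[OF A _ two D e(1) br_map_smult_kernel[OF A e]]
    obtain u1 where "u1 \<in> carrier_vec (n + 2)" "f ^ (n + 2) \<cdot>\<^sub>v e = br_map A *\<^sub>v u1" using pow[OF f] by auto
    moreover obtain u2 where "u2 \<in> carrier_vec (n + 2)" "g ^ (n + 2) \<cdot>\<^sub>v e = br_map A *\<^sub>v u2"
      using pow[OF g] by auto
    moreover obtain u3 where "u3 \<in> carrier_vec (n + 2)" "h ^ (n + 2) \<cdot>\<^sub>v e = br_map A *\<^sub>v u3"
      using pow[OF h] by auto
    ultimately show ?thesis
      by (intro mem_image_of_three_multiples[OF reg At D inj br_map_mult_transpose[OF A] ex e(1)])
  qed
qed

section \<open>Graded pieces of the polynomial ring\<close>

abbreviation lookup :: "('a \<Rightarrow>\<^sub>0 'b::zero) \<Rightarrow> 'a \<Rightarrow> 'b" where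
  "lookup \<equiv> Poly_Mapping.lookup"

definition mdeg :: "(3 \<Rightarrow>\<^sub>0 nat) \<Rightarrow> nat" where
  "mdeg m = (\<Sum>i\<in>UNIV. Poly_Mapping.lookup m i)"

lemma mdeg_add [simp]: "mdeg (m + m') = mdeg m + mdeg m'"
  by (simp add: mdeg_def lookup_add sum.distrib)

lemma mdeg_zero [simp]: "mdeg 0 = 0"
  by (simp add: mdeg_def)

lemma mdeg_single [simp]: "mdeg (Poly_Mapping.single i k) = k"
  by (simp add: mdeg_def lookup_single when_def)

lemma mdeg_eq_0 [simp]: "mdeg m = 0 \<longleftrightarrow> m = 0"
  by (auto simp: mdeg_def intro: poly_mapping_eqI)

lemma homogeneous_iff: "homogeneous d p \<longleftrightarrow> (\<forall>m. lookup p m \<noteq> 0 \<longrightarrow> int (mdeg m) = d)"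
  by (auto simp: homogeneous_def mdeg_def in_keys_iff)

lemma homogeneous_zero [simp]: "homogeneous d 0"
  by (simp add: homogeneous_iff)

lemma homogeneous_one: "homogeneous 0 (1 :: 'k::comm_ring_1 poly3)"
  by (auto simp: homogeneous_iff lookup_one when_def)

lemma homogeneous_add:
  "homogeneous d p \<Longrightarrow> homogeneous d q \<Longrightarrow> homogeneous d (p + q :: 'k::comm_ring_1 poly3)"
  unfolding homogeneous_iff by (metis lookup_add add.right_neutral)

lemma homogeneous_uminus: "homogeneous d p \<Longrightarrow> homogeneous d (- p :: 'k::comm_ring_1 poly3)"
  by (auto simp: homogeneous_iff)

lemma homogeneous_sum:
  "(\<And>x. x \<in> S \<Longrightarrow> homogeneous d (f x)) \<Longrightarrow> homogeneous d (\<Sum>x\<in>S. f x :: 'k::comm_ring_1 poly3)"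
  by (induction S rule: infinite_finite_induct) (auto intro: homogeneous_add)

lemma lookup_mult_nonzeroE:
  assumes "lookup (p * q :: 'k::comm_ring_1 poly3) m \<noteq> 0"
  obtains m1 m2 where "m = m1 + m2" "lookup p m1 \<noteq> 0" "lookup q m2 \<noteq> 0"
  using assms keys_mult[of p q] by (auto simp: in_keys_iff)

lemma homogeneous_mult:
  "homogeneous d p \<Longrightarrow> homogeneous e q \<Longrightarrow> homogeneous (d + e) (p * q :: 'k::comm_ring_1 poly3)"
  unfolding homogeneous_iff by (metis lookup_mult_nonzeroE mdeg_add of_nat_add)

lemma homogeneous_prod:
  "(\<And>x. x \<in> S \<Longrightarrow> homogeneous (d x) (f x)) \<Longrightarrow>
    homogeneous (\<Sum>x\<in>S. d x) (\<Prod>x\<in>S. f x :: 'k::comm_ring_1 poly3)"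
  by (induction S rule: infinite_finite_induct) (auto intro: homogeneous_mult homogeneous_one)

text \<open>All terms of the Leibniz formula have the same degree, since a permutation leaves the
  sum of the \<open>b j\<close> unchanged.\<close>

lemma homogeneous_det:
  fixes A :: "'k::comm_ring_1 poly3 mat"
  assumes A: "A \<in> carrier_mat n n" and hom: "\<And>i j. i < n \<Longrightarrow> j < n \<Longrightarrow> homogeneous (b j - a i) (A $$ (i, j))"
  shows "homogeneous ((\<Sum>j<n. b j) - (\<Sum>i<n. a i)) (det A)"
proof -
  have "homogeneous ((\<Sum>j<n. b j) - (\<Sum>i<n. a i)) (signof p * (\<Prod>i = 0..<n. A $$ (i, p i)))"
    if p: "p permutes {0..<n}" for p
  proof -
    have pi: "p i < n" if "i < n" for i
      using permutes_in_image[OF p, of i] that by simp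
    have h: "homogeneous (\<Sum>i = 0..<n. b (p i) - a i) (\<Prod>i = 0..<n. A $$ (i, p i))"
      by (rule homogeneous_prod) (use pi in \<open>auto intro: hom\<close>)
    have "(\<Sum>i = 0..<n. b (p i)) = (\<Sum>j = 0..<n. b j)"
      using sum.permute[OF p, of b] by (simp add: o_def)
    then have "(\<Sum>i = 0..<n. b (p i) - a i) = (\<Sum>j<n. b j) - (\<Sum>i<n. a i)"
      by (simp add: sum_subtractf atLeast0LessThan)
    with h have h: "homogeneous ((\<Sum>j<n. b j) - (\<Sum>i<n. a i)) (\<Prod>i = 0..<n. A $$ (i, p i))" by simp
    show ?thesis using h homogeneous_uminus[OF h] by (cases "sign p = 1") (auto simp: sign_def)
  qed
  then show ?thesis unfolding det_def'[OF A] by (intro homogeneous_sum) auto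
qed

text \<open>Integer degrees let shifted degrees such as \<open>t - a i\<close> be used without a
  case distinction; in negative degrees the component is 0.\<close>

definition hcomp :: "int \<Rightarrow> 'k::zero poly3 \<Rightarrow> 'k poly3" where
  "hcomp d p = Poly_Mapping.mapp (\<lambda>m c. if int (mdeg m) = d then c else 0) p"

lemma lookup_hcomp: "lookup (hcomp d p) m = (if int (mdeg m) = d then lookup p m else 0)"
  by (auto simp: hcomp_def lookup_mapp when_def in_keys_iff)

lemma hcomp_zero [simp]: "hcomp d 0 = 0"
  by (rule poly_mapping_eqI) (simp add: lookup_hcomp)

lemma hcomp_add: "hcomp d (p + q) = hcomp d p + hcomp d (q :: 'k::comm_ring_1 poly3)"
  by (rule poly_mapping_eqI) (simp add: lookup_hcomp lookup_add)

lemma hcomp_sum: "hcomp d (\<Sum>x\<in>S. f x) = (\<Sum>x\<in>S. hcomp d (f x :: 'k::comm_ring_1 poly3))"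
  by (rule poly_mapping_eqI) (simp add: lookup_hcomp lookup_sum)

lemma homogeneous_hcomp: "homogeneous d (hcomp d p)"
  by (auto simp: homogeneous_iff lookup_hcomp)

lemma hcomp_homogeneous: "homogeneous d p \<Longrightarrow> hcomp e p = (if e = d then p else 0)"
  by (rule poly_mapping_eqI) (auto simp: homogeneous_iff lookup_hcomp)

text \<open>Multiplication by \<open>q\<close> shifts every degree by \<open>e\<close>, so the terms
  of \<open>p\<close> outside degree \<open>d\<close> stay out of degree
  \<open>e + d\<close>.\<close>

lemma hcomp_mult:
  fixes p q :: "'k::comm_ring_1 poly3"
  assumes q: "homogeneous e q"
  shows "hcomp (e + d) (q * p) = q * hcomp d p"
proof -
  have "hcomp (e + d) (q * (p - hcomp d p)) = 0"
  proof (rule poly_mapping_eqI)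
    fix m
    have False if "int (mdeg m) = e + d" "lookup (q * (p - hcomp d p)) m \<noteq> 0"
      using that(2)
    proof (rule lookup_mult_nonzeroE)
      fix m1 m2 assume "m = m1 + m2" "lookup q m1 \<noteq> 0" "lookup (p - hcomp d p) m2 \<noteq> 0"
      then show False using that(1) q
        by (auto simp: homogeneous_iff lookup_minus lookup_hcomp split: if_splits)
    qed
    then show "lookup (hcomp (e + d) (q * (p - hcomp d p))) m = lookup 0 m"
      by (auto simp: lookup_hcomp)
  qed
  moreover have "hcomp (e + d) (q * hcomp d p) = q * hcomp d p"
    using homogeneous_mult[OF q homogeneous_hcomp[of d p]] by (simp add: hcomp_homogeneous)
  moreover have "q * p = q * (p - hcomp d p) + q * hcomp d p" by (simp add: algebra_simps)
  ultimately show ?thesis by (metis add_0 hcomp_add)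
qed

lemma sum_hcomp:
  fixes p :: "'k::comm_ring_1 poly3"
  shows "(\<Sum>d\<in>(\<lambda>m. int (mdeg m)) ` Poly_Mapping.keys p. hcomp d p) = p"
  by (rule poly_mapping_eqI) (auto simp: lookup_sum lookup_hcomp in_keys_iff image_iff)

section \<open>Powers of the variables\<close>

definition var :: "3 \<Rightarrow> 'k::comm_ring_1 poly3" where
  "var i = Poly_Mapping.single (Poly_Mapping.single i 1) 1"

lemma var_power: "var i ^ N = Poly_Mapping.single (Poly_Mapping.single i N) 1"
  by (induction N) (simp_all add: var_def mult_single single_add[symmetric])

lemma lookup_single_mult:
  fixes p :: "'k::comm_ring_1 poly3"
  shows "lookup (Poly_Mapping.single s c * p) (s + m) = c * lookup p m"
  by (simp add: lookup_mult lookup_single mult_when when_mult)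

lemma lookup_var_power_mult:
  fixes p :: "'k::comm_ring_1 poly3"
  shows "lookup (var i ^ N * p) m =
    (if N \<le> lookup m i then lookup p (m - Poly_Mapping.single i N) else 0)"
proof (cases "N \<le> lookup m i")
  case True
  then have "m = Poly_Mapping.single i N + (m - Poly_Mapping.single i N)"
    by (intro poly_mapping_eqI) (auto simp: lookup_add lookup_minus lookup_single when_def)
  then show ?thesis using True lookup_single_mult by (metis mult_1 var_power)
next
  case False
  then show ?thesis
    by (metis lookup_mult_nonzeroE var_power lookup_single_not_eq lookup_single_eq lookup_add le_add1)
qed

text \<open>The quotient reads off the coefficients of \<open>p\<close> at exponents raised by
  \<open>N\<close> in variable \<open>i\<close>; nothing is lost because every exponent of
  \<open>p\<close> has this form.\<close>

lemma var_power_dvd: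
  fixes p :: "'k::comm_ring_1 poly3"
  assumes "\<And>m. lookup p m \<noteq> 0 \<Longrightarrow> N \<le> lookup m i"
  shows "\<exists>r. p = var i ^ N * r"
proof -
  let ?f = "\<lambda>m. Poly_Mapping.single i N + m :: 3 \<Rightarrow>\<^sub>0 nat"
  have lk: "lookup (Poly_Mapping.map_key ?f p) m = lookup p (?f m)" for m
    by (simp add: Poly_Mapping.map_key.rep_eq inj_def)
  have "p = var i ^ N * Poly_Mapping.map_key ?f p"
  proof (rule poly_mapping_eqI)
    fix m
    show "lookup p m = lookup (var i ^ N * Poly_Mapping.map_key ?f p) m"
    proof (cases "N \<le> lookup m i")
      case True
      then have "m = ?f (m - Poly_Mapping.single i N)"
        by (intro poly_mapping_eqI) (auto simp: lookup_add lookup_minus lookup_single when_def)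
      then show ?thesis using True by (simp add: lookup_var_power_mult lk)
    next
      case False
      then show ?thesis using assms[of m] by (auto simp: lookup_var_power_mult)
    qed
  qed
  then show ?thesis ..
qed

text \<open>Membership in an ideal generated by powers of variables is tested on each exponent
  separately, and multiplication by a power of another variable does not change the tested
  entries.\<close>

lemma regular3_vars:
  "regular3 (var 0 ^ k) (var 1 ^ l) (var 2 ^ m :: 'k::field poly3)"
proof -
  have shift: "lookup (Poly_Mapping.single i N + v) j = (if j = i then N else 0) + lookup v j"
    for i j :: 3 and N and v :: "3 \<Rightarrow>\<^sub>0 nat"
    by (simp add: lookup_add lookup_single when_def)
  have lk: "lookup (var i ^ N * p) (Poly_Mapping.single i N + v) = lookup p v"
    for i N and v :: "3 \<Rightarrow>\<^sub>0 nat" and p :: "'k poly3"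
    by (simp add: var_power lookup_single_mult)
  have ne: "(0::3) \<noteq> 1" "(0::3) \<noteq> 2" "(1::3) \<noteq> 2" by simp_all
  show ?thesis unfolding regular3_def
  proof (intro conjI allI impI)
    fix p :: "'k poly3" assume "var 0 ^ k * p = 0"
    then have "lookup p v = 0" for v using lk[of 0 k p v] by (simp only: lookup_zero)
    then show "p = 0" by (intro poly_mapping_eqI) simp
  next
    fix p q :: "'k poly3" assume eq: "var 1 ^ l * p = var 0 ^ k * q"
    show "\<exists>r. p = var 0 ^ k * r"
    proof (rule var_power_dvd)
      fix v assume "lookup p v \<noteq> 0"
      then have "lookup (var 0 ^ k * q) (Poly_Mapping.single 1 l + v) \<noteq> 0"
        using lk[of 1 l p v] eq by simp
      then show "k \<le> lookup v 0" using ne by (auto simp: lookup_var_power_mult shift split: if_splits)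
    qed
  next
    fix p q r :: "'k poly3" assume eq: "var 2 ^ m * p = var 0 ^ k * q + var 1 ^ l * r"
    \<comment> \<open>\<open>p1\<close> collects the terms divisible by \<open>var 0 ^ k\<close>. A
      remaining term, multiplied by \<open>var 2 ^ m\<close>, can only occur in the summand with
      \<open>r\<close>, so it is divisible by \<open>var 1 ^ l\<close>.\<close>
    define p1 where "p1 = Poly_Mapping.mapp (\<lambda>v c. if k \<le> lookup v 0 then c else 0) p"
    have p1: "lookup p1 v = (if k \<le> lookup v 0 then lookup p v else 0)" for v
      by (auto simp: p1_def lookup_mapp when_def in_keys_iff)
    have "\<exists>s. p1 = var 0 ^ k * s" by (rule var_power_dvd) (auto simp: p1 split: if_splits)
    moreover have "\<exists>t. p - p1 = var 1 ^ l * t"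
    proof (rule var_power_dvd)
      fix v assume "lookup (p - p1) v \<noteq> 0"
      then have v: "\<not> k \<le> lookup v 0" "lookup p v \<noteq> 0" by (auto simp: lookup_minus p1 split: if_splits)
      have "lookup (var 0 ^ k * q + var 1 ^ l * r) (Poly_Mapping.single 2 m + v) \<noteq> 0"
        using lk[of 2 m p v] eq v by simp
      then show "l \<le> lookup v 1" using v(1) ne
        by (auto simp: lookup_add[of "_ * _"] lookup_var_power_mult shift split: if_splits)
    qed
    ultimately show "\<exists>s t. p = var 0 ^ k * s + var 1 ^ l * t" by (metis add.commute diff_add_cancel)
  qed
qed

section \<open>Prime ideals\<close>

lemma cring_class_ring: "cring (class_ring :: 'r::comm_ring_1 ring)" ..

lemma ideal_class_ringI:
  fixes I :: "'r::comm_ring_1 set"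
  assumes "0 \<in> I" "\<And>a b. a \<in> I \<Longrightarrow> b \<in> I \<Longrightarrow> a + b \<in> I" "\<And>r a. a \<in> I \<Longrightarrow> r * a \<in> I"
  shows "ideal I class_ring"
proof (rule idealI)
  show "ring (class_ring :: 'r ring)" by (rule cring.axioms(1)[OF cring_class_ring])
  have neg: "- a \<in> I" if "a \<in> I" for a using assms(3)[OF that, of "-1"] by simp
  show "subgroup I (add_monoid class_ring)"
  proof (rule group.subgroupI)
    show "Group.group (add_monoid (class_ring :: 'r ring))" by (rule abelian_group.a_group[OF ring.axioms(1)[OF cring.axioms(1)[OF cring_class_ring]]])
    fix a assume a: "a \<in> I"
    have "a_inv (class_ring :: 'r ring) = uminus" by (simp add: class_ring_simps)
    then have "inv\<^bsub>add_monoid class_ring\<^esub> a = - a" by (metis a_inv_def)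
    then show "inv\<^bsub>add_monoid class_ring\<^esub> a \<in> I" using neg[OF a] by simp
  qed (use assms in \<open>auto simp: class_ring_simps\<close>)
qed (use assms(3) in \<open>auto simp: class_ring_simps mult.commute\<close>)

lemma
  fixes I :: "'r::comm_ring_1 set"
  assumes "ideal I class_ring"
  shows ideal_zero: "0 \<in> I"
    and ideal_add: "a \<in> I \<Longrightarrow> b \<in> I \<Longrightarrow> a + b \<in> I"
    and ideal_mult: "a \<in> I \<Longrightarrow> r * a \<in> I"
proof -
  interpret ideal I class_ring by (rule assms)
  show "0 \<in> I" using zero_closed by (simp add: class_ring_simps)
  show "a \<in> I \<Longrightarrow> b \<in> I \<Longrightarrow> a + b \<in> I" using a_closed by (simp add: class_ring_simps)
  show "a \<in> I \<Longrightarrow> r * a \<in> I" using I_l_closed by (simp add: class_ring_simps)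
qed

lemma ideal_diff:
  fixes I :: "'r::comm_ring_1 set"
  assumes "ideal I class_ring" "a \<in> I" "b \<in> I"
  shows "a - b \<in> I"
  using ideal_add[OF assms(1,2) ideal_mult[OF assms(1,3), of "-1"]] by simp

lemma ideal_sum:
  fixes I :: "'r::comm_ring_1 set"
  assumes "ideal I class_ring" "\<And>x. x \<in> S \<Longrightarrow> f x \<in> I"
  shows "sum f S \<in> I"
  using assms(2) by (induction S rule: infinite_finite_induct)
    (auto intro: ideal_zero[OF assms(1)] ideal_add[OF assms(1)])

lemma primeideal_class_ringI:
  fixes I :: "'r::comm_ring_1 set"
  assumes "ideal I class_ring" "1 \<notin> I" "\<And>a b. a * b \<in> I \<Longrightarrow> a \<in> I \<or> b \<in> I"
  shows "primeideal I class_ring"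
  using assms by (intro primeidealI cring_class_ring) (auto simp: class_ring_simps)

lemma
  fixes I :: "'r::comm_ring_1 set"
  assumes "primeideal I class_ring"
  shows prime_ideal: "ideal I class_ring"
    and prime_one: "1 \<notin> I"
    and prime_mult: "a * b \<in> I \<Longrightarrow> a \<in> I \<or> b \<in> I"
proof -
  interpret primeideal I class_ring by (rule assms)
  show I: "ideal I class_ring" by (rule is_ideal)
  show "1 \<notin> I" using I_notcarr ideal_mult[OF I, of 1] by (auto simp: class_ring_simps)
  show "a * b \<in> I \<Longrightarrow> a \<in> I \<or> b \<in> I" using I_prime by (simp add: class_ring_simps)
qed

lemma prime_unit:
  assumes "primeideal I class_ring" "u dvd (1 :: 'r::comm_ring_1)"
  shows "u \<notin> I"
  using assms(2) prime_one[OF assms(1)] ideal_mult[OF prime_ideal[OF assms(1)], of u]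
  unfolding dvd_def by (metis mult.commute)

lemma prime_power:
  assumes "primeideal I class_ring" "(x :: 'r::comm_ring_1) ^ n \<in> I"
  shows "x \<in> I"
  using assms(2) by (induction n) (use prime_one[OF assms(1)] prime_mult[OF assms(1)] in auto)

text \<open>By Zorn's lemma some ideal is maximal among those that contain \<open>I\<close> and no
  power of \<open>x\<close>; such an ideal is prime.\<close>

lemma prime_avoiding_powers:
  fixes I :: "'r::comm_ring_1 set"
  assumes I: "ideal I class_ring" and x: "\<And>N. x ^ N \<notin> I"
  shows "\<exists>P. primeideal P class_ring \<and> I \<subseteq> P \<and> x \<notin> P"
proof -
  define S where "S = {J. ideal J class_ring \<and> I \<subseteq> J \<and> (\<forall>N. x ^ N \<notin> J)}"
  have "\<exists>M\<in>S. \<forall>X\<in>S. M \<subseteq> X \<longrightarrow> X = M"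
  proof (rule subset_Zorn_nonempty)
    show "S \<noteq> {}" using I x by (auto simp: S_def)
    fix C assume C: "C \<noteq> {}" "subset.chain S C"
    have S: "J \<in> S" if "J \<in> C" for J using C(2) that by (auto simp: subset.chain_def)
    have "ideal (\<Union>C) class_ring"
    proof (rule ideal_class_ringI)
      show "0 \<in> \<Union>C" using C(1) S ideal_zero unfolding S_def by blast
      show "r * a \<in> \<Union>C" if "a \<in> \<Union>C" for r a
        using that S by (auto simp: S_def intro: ideal_mult)
      fix a b assume "a \<in> \<Union>C" "b \<in> \<Union>C"
      then obtain J K where JK: "J \<in> C" "a \<in> J" "K \<in> C" "b \<in> K" by auto
      then have "J \<subseteq> K \<or> K \<subseteq> J" using C(2) by (auto simp: subset.chain_def)
      then show "a + b \<in> \<Union>C"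
        using JK S ideal_add[of J a b] ideal_add[of K a b] by (auto simp: S_def)
    qed
    then show "\<Union>C \<in> S" using C(1) S by (auto simp: S_def)
  qed
  then obtain P where P: "P \<in> S" "\<And>X. X \<in> S \<Longrightarrow> P \<subseteq> X \<Longrightarrow> X = P" by auto
  have idP: "ideal P class_ring" and xP: "x ^ N \<notin> P" for N using P(1) by (auto simp: S_def)
  \<comment> \<open>Maximality: adjoining a new element \<open>a\<close> must bring in a power of
    \<open>x\<close>.\<close>
  have power: "\<exists>N r p. p \<in> P \<and> x ^ N = p + r * a" if a: "a \<notin> P" for a
  proof -
    define J where "J = {p + r * a | p r. p \<in> P}"
    have J: "p + r * a \<in> J" if "p \<in> P" for p r using that by (auto simp: J_def)
    have "ideal J class_ring"
    proof (rule ideal_class_ringI)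
      show "0 \<in> J" using J[OF ideal_zero[OF idP], of 0] by simp
      show "u + v \<in> J" if "u \<in> J" "v \<in> J" for u v
      proof -
        from that obtain p r q s where "u = p + r * a" "v = q + s * a" "p \<in> P" "q \<in> P"
          by (auto simp: J_def)
        then show ?thesis
          using J[OF ideal_add[OF idP, of p q], of "r + s"] by (simp add: algebra_simps)
      qed
      show "s * u \<in> J" if "u \<in> J" for s u
      proof -
        from that obtain p r where "u = p + r * a" "p \<in> P" by (auto simp: J_def)
        then show ?thesis
          using J[OF ideal_mult[OF idP, of p s], of "s * r"] by (simp add: algebra_simps)
      qed
    qed
    moreover have "P \<subseteq> J"
    proof
      fix p assume "p \<in> P"
      then show "p \<in> J" using J[of p 0] by simp
    qed
    moreover have "a \<in> J" using J[OF ideal_zero[OF idP], of 1] by simp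
    ultimately have "J \<notin> S" using P(2)[of J] a by auto
    then obtain N where "x ^ N \<in> J"
      using \<open>ideal J class_ring\<close> \<open>P \<subseteq> J\<close> P(1) by (auto simp: S_def)
    then show ?thesis by (auto simp: J_def)
  qed
  have "primeideal P class_ring"
  proof (rule primeideal_class_ringI[OF idP])
    show "1 \<notin> P" using xP[of 0] by simp
    fix a b assume ab: "a * b \<in> P"
    show "a \<in> P \<or> b \<in> P"
    proof (rule ccontr)
      assume "\<not> (a \<in> P \<or> b \<in> P)"
      then obtain N r p M s q where *: "p \<in> P" "x ^ N = p + r * a" "q \<in> P" "x ^ M = q + s * b"
        using power[of a] power[of b] by metis
      \<comment> \<open>Every term of \<open>(p + r a) (q + s b)\<close> lies in \<open>P\<close> as
        soon as \<open>a b\<close> does.\<close>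
      have "x ^ (N + M) = (q + s * b) * p + (r * a) * q + (r * s) * (a * b)"
        unfolding power_add * by (simp add: algebra_simps)
      also have "\<dots> \<in> P" by (intro ideal_add[OF idP] ideal_mult[OF idP] * ab)
      finally show False using xP by blast
    qed
  qed
  moreover have "I \<subseteq> P" "x \<notin> P" using P(1) xP[of 1] by (auto simp: S_def)
  ultimately show ?thesis by blast
qed

section \<open>Dimension of the polynomial ring\<close>

fun monomial_value :: "'r::comm_ring_1 list \<Rightarrow> nat list \<Rightarrow> 'r" where
  "monomial_value (f # fs) (a # as) = f ^ a * monomial_value fs as"
| "monomial_value _ _ = 1"

text \<open>Coquand and Lombardi: along a chain of primes \<open>C 0 < C 1 < \<dots>\<close> with \<open>f\<^sub>i\<close> in
  \<open>C (i + 1) - C i\<close>, no polynomial in the \<open>f\<^sub>i\<close> with unit coefficients lies in \<open>C 0\<close>: look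
  at its lexicographically least monomial.\<close>

lemma prime_chain_independent:
  fixes C :: "nat \<Rightarrow> 'r::comm_ring_1 set"
  assumes "\<And>i. i \<le> length fs \<Longrightarrow> primeideal (C i) class_ring"
    and "\<And>i. i < length fs \<Longrightarrow> C i \<subseteq> C (Suc i)"
    and "\<And>i. i < length fs \<Longrightarrow> fs ! i \<in> C (Suc i) - C i"
    and "finite S" "S \<noteq> {}" "\<And>\<alpha>. \<alpha> \<in> S \<Longrightarrow> length \<alpha> = length fs"
    and "\<And>\<alpha>. \<alpha> \<in> S \<Longrightarrow> c \<alpha> dvd 1"
  shows "(\<Sum>\<alpha>\<in>S. c \<alpha> * monomial_value fs \<alpha>) \<notin> C 0"
  using assms
proof (induction fs arbitrary: C S c)
  case Nil
  then have "S \<subseteq> {[]}" by auto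
  with Nil.prems have "S = {[]}" by auto
  then show ?case using Nil.prems(1)[of 0] Nil.prems(7)[of "[]"] by (simp add: prime_unit)
next
  case (Cons f fs)
  have P0: "primeideal (C 0) class_ring" and P1: "primeideal (C 1) class_ring"
    using Cons.prems(1)[of 0] Cons.prems(1)[of 1] by auto
  have f: "f \<in> C 1" "f \<notin> C 0" using Cons.prems(3)[of 0] by auto
  \<comment> \<open>The least exponent of \<open>f\<close>: the first entry of the lexicographically
    least monomial.\<close>
  define a where "a = Min (hd ` S)"
  have a_le: "a \<le> hd \<alpha>" if "\<alpha> \<in> S" for \<alpha> using Cons.prems(4) that by (simp add: a_def)
  have "a \<in> hd ` S" unfolding a_def using Cons.prems(4,5) by (intro Min_in) auto
  then obtain \<alpha>0 where \<alpha>0: "\<alpha>0 \<in> S" "hd \<alpha>0 = a" by auto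
  define S1 where "S1 = {\<alpha> \<in> S. hd \<alpha> = a}"
  define T where "T = tl ` S1"
  have len: "\<alpha> = hd \<alpha> # tl \<alpha>" if "\<alpha> \<in> S" for \<alpha> using Cons.prems(6)[OF that] by (cases \<alpha>) auto
  show ?case
  proof
    assume *: "(\<Sum>\<alpha>\<in>S. c \<alpha> * monomial_value (f # fs) \<alpha>) \<in> C 0"
    define g where "g \<alpha> = c \<alpha> * (f ^ (hd \<alpha> - a) * monomial_value fs (tl \<alpha>))" for \<alpha>
    have "c \<alpha> * monomial_value (f # fs) \<alpha> = f ^ a * g \<alpha>" if "\<alpha> \<in> S" for \<alpha>
    proof -
      have "f ^ hd \<alpha> = f ^ a * f ^ (hd \<alpha> - a)" using a_le[OF that] by (simp add: power_add[symmetric])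
      then show ?thesis by (subst len[OF that]) (simp add: g_def ac_simps)
    qed
    then have "f ^ a * (\<Sum>\<alpha>\<in>S. g \<alpha>) \<in> C 0" using * by (simp add: sum_distrib_left)
    \<comment> \<open>\<open>f ^ a\<close> cancels since the prime \<open>C 0\<close> does not
      contain \<open>f\<close>. The rest is read modulo \<open>C 1\<close>, where terms with a
      further factor \<open>f\<close> vanish; what survives is a relation in \<open>fs\<close> for
      the chain starting at \<open>C 1\<close>.\<close>
    then have "(\<Sum>\<alpha>\<in>S. g \<alpha>) \<in> C 0" using prime_mult[OF P0] prime_power[OF P0] f(2) by blast
    then have "(\<Sum>\<alpha>\<in>S. g \<alpha>) \<in> C 1" using Cons.prems(2)[of 0] by auto
    moreover have "g \<alpha> \<in> C 1" if "\<alpha> \<in> S - S1" for \<alpha>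
    proof -
      have "hd \<alpha> - a = Suc (hd \<alpha> - a - 1)" using a_le[of \<alpha>] that by (auto simp: S1_def)
      then have "g \<alpha> = (c \<alpha> * f ^ (hd \<alpha> - a - 1) * monomial_value fs (tl \<alpha>)) * f"
        unfolding g_def by (metis (no_types, lifting) mult.assoc mult.commute power_Suc)
      then show ?thesis using ideal_mult[OF prime_ideal[OF P1] f(1)] by simp
    qed
    then have "(\<Sum>\<alpha>\<in>S - S1. g \<alpha>) \<in> C 1" by (intro ideal_sum[OF prime_ideal[OF P1]])
    moreover have "(\<Sum>\<alpha>\<in>S. g \<alpha>) = (\<Sum>\<alpha>\<in>S - S1. g \<alpha>) + (\<Sum>\<alpha>\<in>S1. g \<alpha>)"
      by (rule sum.subset_diff) (use Cons.prems(4) in \<open>auto simp: S1_def\<close>)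
    ultimately have "(\<Sum>\<alpha>\<in>S1. g \<alpha>) \<in> C 1"
      using ideal_diff[OF prime_ideal[OF P1]] by (metis add_diff_cancel_left')
    also have "(\<Sum>\<alpha>\<in>S1. g \<alpha>) = (\<Sum>\<beta>\<in>T. c (a # \<beta>) * monomial_value fs \<beta>)"
      unfolding T_def
    proof (subst sum.reindex)
      show "inj_on tl S1" using len by (intro inj_onI) (metis (mono_tags, lifting) S1_def mem_Collect_eq)
      show "(\<Sum>\<alpha>\<in>S1. g \<alpha>) = (\<Sum>\<alpha>\<in>S1. ((\<lambda>\<beta>. c (a # \<beta>) * monomial_value fs \<beta>) \<circ> tl) \<alpha>)"
        by (intro sum.cong) (use len in \<open>auto simp: g_def S1_def\<close>)
    qed
    finally have "(\<Sum>\<beta>\<in>T. c (a # \<beta>) * monomial_value fs \<beta>) \<in> C 1" .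
    moreover have "(\<Sum>\<beta>\<in>T. c (a # \<beta>) * monomial_value fs \<beta>) \<notin> (\<lambda>i. C (Suc i)) 0"
    proof (rule Cons.IH)
      have "a # \<beta> \<in> S" if "\<beta> \<in> T" for \<beta> using that len by (force simp: T_def S1_def)
      then show "\<And>\<beta>. \<beta> \<in> T \<Longrightarrow> length \<beta> = length fs" "\<And>\<beta>. \<beta> \<in> T \<Longrightarrow> c (a # \<beta>) dvd 1"
        using Cons.prems(6,7) by force+
      show "finite T" "T \<noteq> {}" using Cons.prems(4) \<alpha>0 by (auto simp: T_def S1_def)
      show "\<And>i. i < length fs \<Longrightarrow> C (Suc i) \<subseteq> C (Suc (Suc i))" using Cons.prems(2) by simp
      show "\<And>i. i < length fs \<Longrightarrow> fs ! i \<in> C (Suc (Suc i)) - C (Suc i)"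
        using Cons.prems(3)[of "Suc _"] by simp
      show "\<And>i. i \<le> length fs \<Longrightarrow> primeideal (C (Suc i)) class_ring" using Cons.prems(1) by simp
    qed
    ultimately show False by simp
  qed
qed

section \<open>Algebraic dependence of four polynomials\<close>

lemma finite_bounded_exponents: "finite {m :: 3 \<Rightarrow>\<^sub>0 nat. \<forall>i. lookup m i \<le> B}"
  and card_bounded_exponents: "card {m :: 3 \<Rightarrow>\<^sub>0 nat. \<forall>i. lookup m i \<le> B} \<le> (B + 1) ^ 3"
proof -
  let ?M = "{m :: 3 \<Rightarrow>\<^sub>0 nat. \<forall>i. lookup m i \<le> B}"
  let ?F = "PiE (UNIV :: 3 set) (\<lambda>_. {..B})"
  have "finite ?F" by (intro finite_PiE) auto
  moreover have inj: "inj_on lookup ?M" by (auto intro!: inj_onI poly_mapping_eqI)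
  moreover have sub: "lookup ` ?M \<subseteq> ?F" by auto
  ultimately show "finite ?M" by (metis finite_imageD finite_subset)
  have "card ?M = card (lookup ` ?M)" using inj by (simp add: card_image)
  also have "\<dots> \<le> card ?F" by (rule card_mono[OF \<open>finite ?F\<close> sub])
  also have "\<dots> = (B + 1) ^ 3" by (simp add: card_PiE)
  finally show "card ?M \<le> (B + 1) ^ 3" .
qed

definition deg_le :: "nat \<Rightarrow> 'k::zero poly3 \<Rightarrow> bool" where
  "deg_le D p \<longleftrightarrow> (\<forall>m. lookup p m \<noteq> 0 \<longrightarrow> mdeg m \<le> D)"

lemma deg_le_mult: "deg_le D p \<Longrightarrow> deg_le E q \<Longrightarrow> deg_le (D + E) (p * q :: 'k::comm_ring_1 poly3)"
  unfolding deg_le_def by (metis lookup_mult_nonzeroE mdeg_add add_mono)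

lemma deg_le_one: "deg_le 0 (1 :: 'k::comm_ring_1 poly3)"
  by (auto simp: deg_le_def lookup_one when_def)

lemma deg_le_power: "deg_le D p \<Longrightarrow> deg_le (k * D) (p ^ k :: 'k::comm_ring_1 poly3)"
  by (induction k) (auto intro: deg_le_mult deg_le_one)

lemma deg_le_mono: "deg_le D p \<Longrightarrow> D \<le> E \<Longrightarrow> deg_le E p"
  by (auto simp: deg_le_def)

lemma ex_deg_le: "\<exists>D. deg_le D p"
  by (rule exI[of _ "\<Sum>m\<in>Poly_Mapping.keys p. mdeg m"])
    (auto simp: deg_le_def in_keys_iff intro!: member_le_sum)

lemma deg_le_monomial_value:
  fixes fs :: "'k::comm_ring_1 poly3 list"
  assumes "\<And>f. f \<in> set fs \<Longrightarrow> deg_le D f" "set as \<subseteq> {..<k}"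
  shows "deg_le (length fs * (k * D)) (monomial_value fs as)"
  using assms
proof (induction fs as rule: monomial_value.induct)
  case (1 f fs a as)
  have "deg_le (a * D) (f ^ a)" using 1 by (intro deg_le_power) auto
  then have "deg_le (k * D) (f ^ a)" by (rule deg_le_mono) (use 1 in \<open>auto intro: mult_right_mono\<close>)
  then have "deg_le (k * D + length fs * (k * D)) (f ^ a * monomial_value fs as)"
    by (rule deg_le_mult) (use 1 in auto)
  then show ?case by simp
qed (auto intro: deg_le_mono[OF deg_le_one])

lemma const3_mult: "lookup (const3 c * p) m = c * lookup (p :: 'k::comm_ring_1 poly3) m"
  using lookup_single_mult[of 0 c p m] by (simp add: const3_def)

lemma const3_unit: "c \<noteq> 0 \<Longrightarrow> const3 (c :: 'k::field) dvd 1"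
proof -
  assume "c \<noteq> 0"
  then have "1 = const3 c * const3 (inverse c)" by (simp add: const3_def mult_single)
  then show ?thesis by (rule dvdI)
qed

lemma const3_simps:
  "const3 (a + b) = const3 a + (const3 b :: 'k::comm_ring_1 poly3)"
  "const3 (a * b) = const3 a * (const3 b :: 'k::comm_ring_1 poly3)"
  "const3 1 = (1 :: 'k::comm_ring_1 poly3)"
  "const3 0 = (0 :: 'k::comm_ring_1 poly3)"
  by (simp_all add: const3_def single_add mult_single)

lemma poly3_vector_space: "vector_space (\<lambda>(c :: 'k::field) (p :: 'k poly3). const3 c * p)"
  by unfold_locales (auto simp: const3_simps algebra_simps)

interpretation poly3: vector_space "\<lambda>(c :: 'k::field) (p :: 'k poly3). const3 c * p"
  by (rule poly3_vector_space)

text \<open>Bounding the exponents one by one gives a cube, whose size is trivially at most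
  \<open>(B + 1) ^ 3\<close>; this cubic growth is what the dimension count uses.\<close>

lemma deg_le_span:
  fixes p :: "'k::field poly3"
  assumes "deg_le B p"
  shows "p \<in> poly3.span ((\<lambda>m. Poly_Mapping.single m 1) ` {m. \<forall>i. lookup m i \<le> B})"
proof -
  have "p = (\<Sum>m\<in>Poly_Mapping.keys p. const3 (lookup p m) * Poly_Mapping.single m 1)"
    by (rule poly_mapping_eqI)
      (auto simp: const3_def mult_single lookup_sum lookup_single when_def in_keys_iff)
  also have "\<dots> \<in> poly3.span ((\<lambda>m. Poly_Mapping.single m 1) ` {m. \<forall>i. lookup m i \<le> B})"
  proof (intro poly3.span_sum poly3.span_scale poly3.span_base imageI CollectI allI)
    fix m i assume "m \<in> Poly_Mapping.keys p"
    then have "mdeg m \<le> B" using assms by (auto simp: deg_le_def in_keys_iff)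
    moreover have "lookup m i \<le> mdeg m" unfolding mdeg_def by (rule member_le_sum) auto
    ultimately show "lookup m i \<le> B" by simp
  qed
  finally show ?thesis .
qed

text \<open>There are \<open>k ^ 4\<close> exponent lists with entries below \<open>k\<close>, but
  the corresponding products lie in a space whose dimension grows like \<open>k ^ 3\<close>. The
  coefficients are to be units, as \<open>prime_chain_independent\<close> demands.\<close>

lemma algebraically_dependent:
  fixes fs :: "'k::field poly3 list"
  assumes len: "length fs = 4"
  shows "\<exists>S c. finite S \<and> S \<noteq> {} \<and> (\<forall>\<alpha>\<in>S. length \<alpha> = length fs) \<and> (\<forall>\<alpha>\<in>S. c \<alpha> dvd 1) \<and>
    (\<Sum>\<alpha>\<in>S. c \<alpha> * monomial_value fs \<alpha>) = 0"
proof -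
  obtain D where D: "\<And>f. f \<in> set fs \<Longrightarrow> deg_le D f"
  proof -
    obtain E where E: "deg_le (E p) p" for p :: "'k poly3" using ex_deg_le by metis
    have "deg_le (\<Sum>f\<in>set fs. E f) f" if "f \<in> set fs" for f
      using that by (intro deg_le_mono[OF E[of f]] member_le_sum) auto
    then show ?thesis using that by blast
  qed
  \<comment> \<open>\<open>k\<close> exceeds \<open>(4 * D + 1) ^ 3\<close>, so that
    \<open>(B + 1) ^ 3\<close> is at most \<open>k ^ 3 * (4 * D + 1) ^ 3\<close>, hence below
    \<open>k ^ 4\<close>. \<open>B\<close> bounds the degree of a product of four powers with
    exponents below \<open>k\<close>.\<close>
  define k where "k = (4 * D + 1) ^ 3 + 1"
  define B where "B = 4 * (k * D)"
  define T where "T = {\<alpha> :: nat list. set \<alpha> \<subseteq> {..<k} \<and> length \<alpha> = 4}"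
  let ?M = "{m :: 3 \<Rightarrow>\<^sub>0 nat. \<forall>i. lookup m i \<le> B}"
  let ?N = "(\<lambda>m. Poly_Mapping.single m (1::'k)) ` ?M"
  have T: "finite T" "card T = k ^ 4"
    unfolding T_def using finite_lists_length_eq[of "{..<k}" 4] card_lists_length_eq[of "{..<k}" 4] by auto
  have "card ?N \<le> card ?M" by (rule card_image_le[OF finite_bounded_exponents])
  also have "\<dots> \<le> (B + 1) ^ 3" by (rule card_bounded_exponents)
  also have "\<dots> \<le> (k * (4 * D + 1)) ^ 3"
    unfolding B_def by (intro power_mono) (auto simp: k_def)
  also have "\<dots> = k ^ 3 * (4 * D + 1) ^ 3" by (rule power_mult_distrib)
  also have "\<dots> < k ^ 3 * k" by (intro mult_strict_left_mono) (simp_all add: k_def)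
  also have "\<dots> = card T" using T by (simp add: power_Suc2[symmetric] del: power_Suc2)
  finally have card: "card ?N < card T" .
  show ?thesis
  proof (cases "inj_on (monomial_value fs) T")
    \<comment> \<open>Two equal products already form a relation, with coefficients 1 and
      -1.\<close>
    case False
    then obtain \<alpha> \<beta> where ab: "\<alpha> \<in> T" "\<beta> \<in> T" "\<alpha> \<noteq> \<beta>" "monomial_value fs \<alpha> = monomial_value fs \<beta>"
      by (auto simp: inj_on_def)
    then have "(\<Sum>\<gamma>\<in>{\<alpha>, \<beta>}. (if \<gamma> = \<alpha> then 1 else -1) * monomial_value fs \<gamma>) = 0" by simp
    then show ?thesis using ab len
      by (intro exI[of _ "{\<alpha>, \<beta>}"] exI[of _ "\<lambda>\<gamma>. if \<gamma> = \<alpha> then 1 else -1"]) (auto simp: T_def)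
  next
    case True
    have "poly3.dependent (monomial_value fs ` T)"
    proof (rule ccontr)
      assume "\<not> poly3.dependent (monomial_value fs ` T)"
      moreover have "monomial_value fs ` T \<subseteq> poly3.span ?N"
        using deg_le_monomial_value[of fs D, OF D] len by (auto simp: T_def B_def intro!: deg_le_span)
      ultimately have "card (monomial_value fs ` T) \<le> card ?N"
        using poly3.independent_span_bound[of ?N] finite_bounded_exponents by blast
      then show False using card card_image[OF True] by simp
    qed
    then obtain t u v where t: "finite t" "t \<subseteq> monomial_value fs ` T"
      "(\<Sum>v\<in>t. const3 (u v) * v) = 0" "v \<in> t" "u v \<noteq> 0"
      unfolding poly3.dependent_explicit by blast
    \<comment> \<open>Dropping the zero coefficients leaves nonzero constants, which are
      units.\<close>
    define S where "S = {\<alpha> \<in> T. monomial_value fs \<alpha> \<in> t \<and> u (monomial_value fs \<alpha>) \<noteq> 0}"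
    have "(\<Sum>v\<in>t. const3 (u v) * v) = (\<Sum>v\<in>monomial_value fs ` S. const3 (u v) * v)"
    proof (rule sum.mono_neutral_right)
      show "monomial_value fs ` S \<subseteq> t" by (auto simp: S_def)
      show "\<forall>v\<in>t - monomial_value fs ` S. const3 (u v) * v = 0"
      proof
        fix v assume v: "v \<in> t - monomial_value fs ` S"
        then obtain \<alpha> where "\<alpha> \<in> T" "v = monomial_value fs \<alpha>" using t(2) by auto
        then have "u v = 0" using v by (auto simp: S_def)
        then show "const3 (u v) * v = 0" by (simp add: const3_simps)
      qed
    qed (rule t(1))
    also have "\<dots> = (\<Sum>\<alpha>\<in>S. const3 (u (monomial_value fs \<alpha>)) * monomial_value fs \<alpha>)"
      by (subst sum.reindex) (use True in \<open>auto simp: S_def inj_on_def\<close>)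
    finally have "(\<Sum>\<alpha>\<in>S. const3 (u (monomial_value fs \<alpha>)) * monomial_value fs \<alpha>) = 0" using t(3) by simp
    moreover have "S \<noteq> {}" using t(2,4,5) by (auto simp: S_def)
    moreover have "finite S" using T by (simp add: S_def)
    ultimately show ?thesis using len
      by (intro exI[of _ S] exI[of _ "\<lambda>\<alpha>. const3 (u (monomial_value fs \<alpha>))"])
        (auto simp: S_def T_def const3_unit)
  qed
qed

text \<open>Four elements chosen from the successive differences of the chain are algebraically
  dependent; the value 0 of the relation lies in \<open>C 0\<close>, against
  \<open>prime_chain_independent\<close>. So \<open>K[x, y, z]\<close> has dimension at most
  3.\<close>

lemma no_prime_chain_of_length_4:
  fixes C :: "nat \<Rightarrow> 'k::field poly3 set"
  assumes prime: "\<And>i. i \<le> 4 \<Longrightarrow> primeideal (C i) class_ring" and chain: "\<And>i. i < 4 \<Longrightarrow> C i \<subset> C (Suc i)"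
  shows False
proof -
  have "\<exists>f. f \<in> C (Suc i) - C i" if "i < 4" for i using chain[OF that] by auto
  then obtain f where f: "\<And>i. i < 4 \<Longrightarrow> f i \<in> C (Suc i) - C i" by metis
  let ?fs = "map f [0..<4]"
  have "length ?fs = 4" by simp
  obtain S c where S: "finite S" "S \<noteq> {}" "\<And>\<alpha>. \<alpha> \<in> S \<Longrightarrow> length \<alpha> = length ?fs"
    "\<And>\<alpha>. \<alpha> \<in> S \<Longrightarrow> c \<alpha> dvd 1" "(\<Sum>\<alpha>\<in>S. c \<alpha> * monomial_value ?fs \<alpha>) = 0"
    using algebraically_dependent[OF \<open>length ?fs = 4\<close>] by blast
  have "(\<Sum>\<alpha>\<in>S. c \<alpha> * monomial_value ?fs \<alpha>) \<notin> C 0"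
    by (rule prime_chain_independent) (use prime chain f S in auto)
  then show False using S(5) ideal_zero[OF prime_ideal[OF prime[of 0]]] by simp
qed

section \<open>Homogeneous ideals of codimension three\<close>

text \<open>For an ideal \<open>P\<close> this is the largest homogeneous ideal inside
  \<open>P\<close>.\<close>

definition homogeneous_core :: "'k::comm_ring_1 poly3 set \<Rightarrow> 'k poly3 set" where
  "homogeneous_core P = {p. \<forall>d. hcomp d p \<in> P}"

lemma hcomp_product:
  fixes p q :: "'k::comm_ring_1 poly3"
  shows "hcomp d (p * q) = (\<Sum>e\<in>(\<lambda>m. int (mdeg m)) ` Poly_Mapping.keys p. hcomp e p * hcomp (d - e) q)"
proof -
  have "hcomp d (p * q) = hcomp d ((\<Sum>e\<in>(\<lambda>m. int (mdeg m)) ` Poly_Mapping.keys p. hcomp e p) * q)"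
    by (simp add: sum_hcomp)
  also have "\<dots> = (\<Sum>e\<in>(\<lambda>m. int (mdeg m)) ` Poly_Mapping.keys p. hcomp d (hcomp e p * q))"
    by (simp add: sum_distrib_right hcomp_sum)
  also have "\<dots> = (\<Sum>e\<in>(\<lambda>m. int (mdeg m)) ` Poly_Mapping.keys p. hcomp e p * hcomp (d - e) q)"
  proof (rule sum.cong)
    fix e
    show "hcomp d (hcomp e p * q) = hcomp e p * hcomp (d - e) q"
      using hcomp_mult[OF homogeneous_hcomp[of e p], of "d - e" q] by simp
  qed simp
  finally show ?thesis .
qed

lemma homogeneous_core_ideal:
  assumes P: "ideal P class_ring"
  shows "ideal (homogeneous_core P) class_ring"
  by (rule ideal_class_ringI)
    (auto simp: homogeneous_core_def hcomp_add hcomp_product ideal_zero[OF P]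
      intro!: ideal_add[OF P] ideal_sum[OF P] ideal_mult[OF P])

lemma homogeneous_core_subset:
  assumes "ideal P class_ring" shows "homogeneous_core P \<subseteq> P"
proof
  fix p assume "p \<in> homogeneous_core P"
  then have "(\<Sum>d\<in>(\<lambda>m. int (mdeg m)) ` Poly_Mapping.keys p. hcomp d p) \<in> P"
    by (intro ideal_sum[OF assms]) (auto simp: homogeneous_core_def)
  then show "p \<in> P" by (simp add: sum_hcomp)
qed

lemma homogeneous_in_core:
  assumes "ideal P class_ring" "homogeneous d p" "p \<in> P" shows "p \<in> homogeneous_core P"
  using assms ideal_zero[OF assms(1)] by (simp add: homogeneous_core_def hcomp_homogeneous)

lemma top_component:
  fixes p :: "'k::comm_ring_1 poly3"
  assumes P: "ideal P class_ring" and p: "p \<notin> homogeneous_core P"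
  shows "\<exists>D. hcomp D p \<notin> P \<and> (\<forall>d>D. hcomp d p \<in> P)"
proof -
  define S where "S = {d. hcomp d p \<notin> P}"
  have "S \<subseteq> (\<lambda>m. int (mdeg m)) ` Poly_Mapping.keys p"
  proof
    fix d assume "d \<in> S"
    then have "hcomp d p \<noteq> 0" using ideal_zero[OF P] by (auto simp: S_def)
    then obtain m where "lookup (hcomp d p) m \<noteq> 0" by (metis lookup_zero poly_mapping_eqI)
    then show "d \<in> (\<lambda>m. int (mdeg m)) ` Poly_Mapping.keys p"
      by (auto simp: lookup_hcomp in_keys_iff split: if_splits)
  qed
  then have "finite S" by (rule finite_subset) auto
  moreover have "S \<noteq> {}" using p by (auto simp: S_def homogeneous_core_def)
  ultimately show ?thesis
    using Max_in[of S] Max_ge[of S] by (intro exI[of _ "Max S"]) (auto simp: S_def not_less[symmetric])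
qed

text \<open>For \<open>p\<close> and \<open>q\<close> outside the core, take the highest components
  outside \<open>P\<close>, in degrees \<open>D\<close> and \<open>E\<close>. In the component of
  \<open>p * q\<close> of degree \<open>D + E\<close> every other product has a factor in
  \<open>P\<close>, so the product of these two would lie in \<open>P\<close>.\<close>

lemma homogeneous_core_prime:
  fixes P :: "'k::comm_ring_1 poly3 set"
  assumes P: "primeideal P class_ring"
  shows "primeideal (homogeneous_core P) class_ring"
proof (rule primeideal_class_ringI)
  note idP = prime_ideal[OF P]
  show "ideal (homogeneous_core P) class_ring" by (rule homogeneous_core_ideal[OF idP])
  show "1 \<notin> homogeneous_core P" using homogeneous_core_subset[OF idP] prime_one[OF P] by auto
  fix p q assume pq: "p * q \<in> homogeneous_core P"
  show "p \<in> homogeneous_core P \<or> q \<in> homogeneous_core P"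
  proof (rule ccontr)
    assume "\<not> ?thesis"
    then obtain D E where D: "hcomp D p \<notin> P" "\<And>d. d > D \<Longrightarrow> hcomp d p \<in> P"
      and E: "hcomp E q \<notin> P" "\<And>d. d > E \<Longrightarrow> hcomp d q \<in> P"
      using top_component[OF idP] by metis
    let ?K = "(\<lambda>m. int (mdeg m)) ` Poly_Mapping.keys p"
    have "D \<in> ?K"
    proof (rule ccontr)
      assume "D \<notin> ?K"
      then have "hcomp D p = 0"
        by (intro poly_mapping_eqI) (auto simp: lookup_hcomp in_keys_iff)
      then show False using D(1) ideal_zero[OF idP] by simp
    qed
    then have "hcomp (D + E) (p * q) =
        hcomp D p * hcomp E q + (\<Sum>e\<in>?K - {D}. hcomp e p * hcomp (D + E - e) q)"
      unfolding hcomp_product by (subst sum.remove[of _ D]) auto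
    moreover have "(\<Sum>e\<in>?K - {D}. hcomp e p * hcomp (D + E - e) q) \<in> P"
    proof (rule ideal_sum[OF idP])
      fix e assume "e \<in> ?K - {D}"
      then have "e > D \<or> D + E - e > E" by auto
      then show "hcomp e p * hcomp (D + E - e) q \<in> P"
        using D(2) E(2) ideal_mult[OF idP] by (metis mult.commute)
    qed
    moreover have "hcomp (D + E) (p * q) \<in> P" using pq by (simp add: homogeneous_core_def)
    ultimately have "hcomp D p * hcomp E q \<in> P" using ideal_diff[OF idP] by fastforce
    then show False using prime_mult[OF P] D(1) E(1) by blast
  qed
qed

lemma lookup_0_mult: "lookup (p * q :: 'k::comm_ring_1 poly3) 0 = lookup p 0 * lookup q 0"
proof -
  have "lookup ((p - const3 (lookup p 0)) * q) 0 = 0"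
  proof (rule ccontr)
    assume "lookup ((p - const3 (lookup p 0)) * q) 0 \<noteq> 0"
    then obtain m1 m2 where "0 = m1 + m2" "lookup (p - const3 (lookup p 0)) m1 \<noteq> 0"
      by (rule lookup_mult_nonzeroE)
    moreover from this have "mdeg m1 = 0" by (metis mdeg_add mdeg_zero add_is_0)
    ultimately show False by (simp add: lookup_minus const3_def)
  qed
  then show ?thesis by (simp add: left_diff_distrib lookup_minus const3_mult)
qed

lemma maximal_ideal_prime: "primeideal {p :: 'k::field poly3. lookup p 0 = 0} class_ring"
  by (rule primeideal_class_ringI, rule ideal_class_ringI) (auto simp: lookup_add lookup_0_mult)

text \<open>A prime over \<open>I\<close> that avoids \<open>var i\<close> need not lie below the
  irrelevant ideal, but its homogeneous core does, properly so because \<open>var i\<close> is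
  missing. The core still contains \<open>I\<close>, since the generators are homogeneous, and so
  has height at least 3.\<close>

lemma power_var_in_ideal:
  fixes I :: "'k::field poly3 set"
  assumes codim: "codimension class_ring I = 3" and I: "I = Idl\<^bsub>class_ring\<^esub> G"
    and hom: "\<And>p. p \<in> G \<Longrightarrow> \<exists>d. homogeneous d p"
  shows "\<exists>N. var i ^ N \<in> I"
proof (rule ccontr)
  assume no: "\<not> (\<exists>N. var i ^ N \<in> I)"
  have ring: "ring (class_ring :: 'k poly3 ring)" by (rule cring.axioms(1)[OF cring_class_ring])
  have idI: "ideal I class_ring" unfolding I by (rule ring.genideal_ideal[OF ring]) simp
  obtain P where P: "primeideal P class_ring" "I \<subseteq> P" "var i \<notin> P"
    using prime_avoiding_powers[OF idI] no by blast
  note idP = prime_ideal[OF P(1)]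
  let ?Q = "homogeneous_core P"
  have Q: "primeideal ?Q class_ring" by (rule homogeneous_core_prime[OF P(1)])
  have "G \<subseteq> I" unfolding I by (rule ring.genideal_self[OF ring]) simp
  then have "G \<subseteq> ?Q" using hom homogeneous_in_core[OF idP] P(2) by blast
  then have IQ: "I \<subseteq> ?Q" unfolding I by (rule ring.genideal_minimal[OF ring prime_ideal[OF Q]])
  have "3 \<le> prime_height class_ring ?Q"
    using codim unfolding codimension_def by (metis (mono_tags, lifting) INF_lower IQ Q mem_Collect_eq)
  \<comment> \<open>The height is a supremum, so a long chain is found by refuting the bound 2; its
    length may exceed 3.\<close>
  have "\<exists>l\<ge>3. \<exists>C. (\<forall>i\<le>l. primeideal (C i) class_ring) \<and> (\<forall>i<l. C i \<subset> C (Suc i)) \<and> C l = ?Q"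
  proof (rule ccontr)
    assume *: "\<not> ?thesis"
    have "prime_height class_ring ?Q \<le> enat 2"
      unfolding prime_height_def
    proof (rule SUP_least, clarify)
      fix l C assume "\<forall>i\<le>l. primeideal (C i) class_ring" "\<forall>i<l. C i \<subset> C (Suc i)" "C l = ?Q"
      with * have "\<not> 3 \<le> l" by blast
      then show "enat l \<le> enat 2" by simp
    qed
    with \<open>3 \<le> _\<close> have "(3::enat) \<le> enat 2" by (rule order_trans)
    then show False by (simp add: numeral_eq_enat)
  qed
  then obtain l C where C: "l \<ge> 3" "\<And>i. i \<le> l \<Longrightarrow> primeideal (C i) class_ring"
    "\<And>i. i < l \<Longrightarrow> C i \<subset> C (Suc i)" "C l = ?Q" by blast
  let ?m = "{p :: 'k poly3. lookup p 0 = 0}"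
  have "?Q \<subseteq> ?m"
  proof
    fix p assume "p \<in> ?Q"
    then have "hcomp 0 p \<in> P" by (simp add: homogeneous_core_def)
    moreover have "hcomp 0 p = const3 (lookup p 0)"
      by (rule poly_mapping_eqI) (auto simp: lookup_hcomp const3_def lookup_single when_def)
    ultimately show "p \<in> ?m" using prime_unit[OF P(1)] const3_unit by force
  qed
  moreover have "Poly_Mapping.single i (1::nat) \<noteq> 0" by (metis lookup_single_eq lookup_zero one_neq_zero)
  then have "var i \<in> ?m" by (simp add: var_def lookup_single when_def)
  moreover have "var i \<notin> ?Q" using P(3) homogeneous_core_subset[OF idP] by auto
  ultimately have Qm: "?Q \<subset> ?m" by blast
  \<comment> \<open>The last three steps of the chain with the irrelevant ideal on top: five primes
    in all.\<close>
  define C' where "C' j = (if j \<le> 3 then C (l - 3 + j) else ?m)" for j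
  show False
  proof (rule no_prime_chain_of_length_4)
    fix j :: nat assume "j \<le> 4"
    show "primeideal (C' j) class_ring" using C maximal_ideal_prime by (auto simp: C'_def)
  next
    fix j :: nat assume "j < 4"
    then have "j < 3 \<or> j = 3" by auto
    then show "C' j \<subset> C' (Suc j)"
      using C(1,4) C(3)[of "l - 3 + j"] Qm by (auto simp: C'_def)
  qed
qed

section \<open>Annihilators of the cokernel\<close>

lemma annihilates_cokerI:
  "A \<in> carrier_mat n m \<Longrightarrow> B \<in> carrier_mat m n \<Longrightarrow> A * B = f \<cdot>\<^sub>m 1\<^sub>m n \<Longrightarrow> annihilates_coker A f"
  by (auto simp: annihilates_coker_def)

lemma annihilates_cokerE:
  assumes "annihilates_coker A f" "A \<in> carrier_mat n m"
  obtains B where "B \<in> carrier_mat m n" "A * B = f \<cdot>\<^sub>m 1\<^sub>m n"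
  using assms by (auto simp: annihilates_coker_def)

lemma annihilator_ideal:
  fixes A :: "'r::comm_ring_1 mat"
  shows "ideal {f. annihilates_coker A f} class_ring"
proof (rule ideal_class_ringI)
  define n m where "n = dim_row A" and "m = dim_col A"
  have A: "A \<in> carrier_mat n m" by (simp add: n_def m_def)
  show "0 \<in> {f. annihilates_coker A f}"
    using A by (auto intro!: annihilates_cokerI[OF A, of "0\<^sub>m m n"])
  show "f + g \<in> {f. annihilates_coker A f}"
    if fg: "f \<in> {f. annihilates_coker A f}" "g \<in> {f. annihilates_coker A f}" for f g
  proof -
    obtain B C where B: "B \<in> carrier_mat m n" "A * B = f \<cdot>\<^sub>m 1\<^sub>m n"
      and C: "C \<in> carrier_mat m n" "A * C = g \<cdot>\<^sub>m 1\<^sub>m n"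
      using fg annihilates_cokerE[OF _ A] by (metis mem_Collect_eq)
    have "A * (B + C) = f \<cdot>\<^sub>m 1\<^sub>m n + g \<cdot>\<^sub>m 1\<^sub>m n"
      using A B C by (simp add: mult_add_distrib_mat)
    also have "\<dots> = (f + g) \<cdot>\<^sub>m 1\<^sub>m n" by (intro eq_matI) auto
    finally show ?thesis using B C annihilates_cokerI[OF A, of "B + C" "f + g"] by simp
  qed
  show "r * f \<in> {f. annihilates_coker A f}" if f: "f \<in> {f. annihilates_coker A f}" for r f
  proof -
    obtain B where B: "B \<in> carrier_mat m n" "A * B = f \<cdot>\<^sub>m 1\<^sub>m n"
      using f annihilates_cokerE[OF _ A] by (metis mem_Collect_eq)
    have "A * (r \<cdot>\<^sub>m B) = r \<cdot>\<^sub>m (f \<cdot>\<^sub>m 1\<^sub>m n)" using A B by (simp add: mult_smult_distrib)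
    also have "\<dots> = (r * f) \<cdot>\<^sub>m 1\<^sub>m n" by (intro eq_matI) auto
    finally show ?thesis using B annihilates_cokerI[OF A, of "r \<cdot>\<^sub>m B" "r * f"] by simp
  qed
qed

lemma
  assumes A: "A \<in> carrier_mat n m" and J: "J \<subseteq> {..<m}" "card J = n"
  shows submatrix_columns_carrier: "submatrix A UNIV J \<in> carrier_mat n n"
    and submatrix_columns_index: "r < n \<Longrightarrow> q < n \<Longrightarrow> submatrix A UNIV J $$ (r, q) = A $$ (r, pick J q)"
    and pick_column_less: "q < n \<Longrightarrow> pick J q < m"
proof -
  have eq: "{i. i < m \<and> i \<in> J} = J" using J by auto
  show "submatrix A UNIV J \<in> carrier_mat n n" using A J by (auto simp: submatrix_def eq)
  show "submatrix A UNIV J $$ (r, q) = A $$ (r, pick J q)" if "r < n" "q < n"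
    using A J that by (simp add: submatrix_def eq pick_UNIV)
  show "pick J q < m" if "q < n" using pick_in_set[of q J] J that by auto
qed

text \<open>Cramer's rule: the adjugate of the chosen square submatrix, its rows moved to the
  positions of the chosen columns and filled up with zero rows, serves as \<open>B\<close>.\<close>

lemma annihilates_coker_minor:
  fixes A :: "'r::comm_ring_1 mat"
  assumes f: "f \<in> maximal_minors A"
  shows "annihilates_coker A f"
proof -
  define n m where "n = dim_row A" and "m = dim_col A"
  have A: "A \<in> carrier_mat n m" by (simp add: n_def m_def)
  obtain J where J: "J \<subseteq> {..<m}" "card J = n" "f = det (submatrix A UNIV J)"
    using f by (auto simp: maximal_minors_def n_def m_def)
  let ?S = "submatrix A UNIV J"
  have S: "?S \<in> carrier_mat n n" by (rule submatrix_columns_carrier[OF A J(1,2)])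
  define B where "B = mat m n (\<lambda>(j, s). \<Sum>q<n. if pick J q = j then adj_mat ?S $$ (q, s) else 0)"
  have "A * B = ?S * adj_mat ?S"
  proof (rule eq_matI)
    fix r s assume "r < dim_row (?S * adj_mat ?S)" "s < dim_col (?S * adj_mat ?S)"
    then have rs: "r < n" "s < n" using S adj_mat(1)[OF S] by auto
    have "(A * B) $$ (r, s) = (\<Sum>j<m. A $$ (r, j) * (\<Sum>q<n. if pick J q = j then adj_mat ?S $$ (q, s) else 0))"
      using A rs by (simp add: B_def scalar_prod_def atLeast0LessThan)
    also have "\<dots> = (\<Sum>q<n. \<Sum>j<m. if pick J q = j then A $$ (r, j) * adj_mat ?S $$ (q, s) else 0)"
      by (subst sum.swap) (auto simp: sum_distrib_left intro!: sum.cong)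
    also have "\<dots> = (\<Sum>q<n. ?S $$ (r, q) * adj_mat ?S $$ (q, s))"
      using rs pick_column_less[OF A J(1,2)] submatrix_columns_index[OF A J(1,2)]
      by (intro sum.cong) auto
    also have "\<dots> = (?S * adj_mat ?S) $$ (r, s)"
      using rs S adj_mat(1)[OF S] by (simp add: scalar_prod_def atLeast0LessThan)
    finally show "(A * B) $$ (r, s) = (?S * adj_mat ?S) $$ (r, s)" .
  qed (use A S adj_mat(1)[OF S] in \<open>auto simp: B_def\<close>)
  then show ?thesis using adj_mat(2)[OF S] J(3)
    by (intro annihilates_cokerI[OF A, of B]) (auto simp: B_def)
qed

lemma minor_ideal_annihilates:
  fixes A :: "'r::comm_ring_1 mat"
  assumes "f \<in> minor_ideal A"
  shows "annihilates_coker A f"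
proof -
  have ring: "ring (class_ring :: 'r ring)" by (rule cring.axioms(1)[OF cring_class_ring])
  have "minor_ideal A \<subseteq> {f. annihilates_coker A f}" unfolding minor_ideal_def
    by (rule ring.genideal_minimal[OF ring annihilator_ideal]) (auto intro: annihilates_coker_minor)
  then show ?thesis using assms by auto
qed

lemma homogeneous_minor:
  fixes A :: "'k::comm_ring_1 poly3 mat"
  assumes A: "A \<in> carrier_mat n m" and p: "p \<in> maximal_minors A"
    and hom: "\<And>i j. i < n \<Longrightarrow> j < m \<Longrightarrow> homogeneous (b j - a i) (A $$ (i, j))"
  shows "\<exists>d. homogeneous d p"
proof -
  obtain J where J: "J \<subseteq> {..<m}" "card J = n" "p = det (submatrix A UNIV J)"
    using p A by (auto simp: maximal_minors_def)
  have "homogeneous ((\<Sum>j<n. b (pick J j)) - (\<Sum>i<n. a i)) p"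
    unfolding J(3)
    by (rule homogeneous_det[OF submatrix_columns_carrier[OF A J(1,2)], where b = "\<lambda>j. b (pick J j)"])
      (use submatrix_columns_index[OF A J(1,2)] pick_column_less[OF A J(1,2)] hom in auto)
  then show ?thesis ..
qed

lemma annihilates_coker_var_power:
  fixes A :: "'k::field poly3 mat"
  assumes A: "A \<in> carrier_mat n m"
    and hom: "\<And>i j. i < n \<Longrightarrow> j < m \<Longrightarrow> homogeneous (b j - a i) (A $$ (i, j))"
    and codim: "codimension class_ring (minor_ideal A) = 3"
  shows "\<exists>N. annihilates_coker A (var i ^ N)"
proof -
  have "\<exists>N. var i ^ N \<in> minor_ideal A"
    by (rule power_var_in_ideal[OF codim minor_ideal_def homogeneous_minor[OF A]]) (use hom in auto)
  then show ?thesis using minor_ideal_annihilates by auto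
qed

text \<open>Every variable acts nilpotently on the cokernel; for a graded cokernel this amounts to
  finite length. Unlike a condition on minors, it is visibly inherited by the block in
  \<open>degree_gap\<close>.\<close>

definition cofinite_coker :: "'k::comm_ring_1 poly3 mat \<Rightarrow> bool" where
  "cofinite_coker A \<longleftrightarrow> (\<forall>i. \<exists>N. annihilates_coker A (var i ^ N))"

lemma two_dvd_one:
  assumes "CHAR('k::field) \<noteq> 2" shows "(2 :: 'k poly3) dvd 1"
proof -
  have "(2::'k) \<noteq> 0"
  proof
    assume "(2::'k) = 0"
    then have "of_nat 2 = (0::'k)" by simp
    then have "CHAR('k) dvd 2" by (simp only: of_nat_eq_0_iff_char_dvd)
    then have "CHAR('k) = 1" using assms by (metis dvd_def nat_dvd_1_iff_1 prime_nat_iff two_is_prime_nat)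
    then show False by (metis of_nat_1 of_nat_CHAR one_neq_zero)
  qed
  moreover have "const3 (2::'k) = 2" by (simp add: const3_def)
  ultimately show ?thesis using const3_unit[of "2::'k"] by simp
qed

lemma buchsbaum_rim_poly3:
  fixes A :: "'k::field poly3 mat"
  assumes A: "A \<in> carrier_mat n (n + 2)" and char: "CHAR('k) \<noteq> 2" and fin: "cofinite_coker A"
  shows "\<And>v. v \<in> carrier_vec n \<Longrightarrow> transpose_mat A *\<^sub>v v = 0\<^sub>v (n + 2) \<Longrightarrow> v = 0\<^sub>v n"
    and "\<And>u. u \<in> carrier_vec (n + 2) \<Longrightarrow> br_map A *\<^sub>v u = 0\<^sub>v (n + 2) \<Longrightarrow>
      \<exists>v \<in> carrier_vec n. u = transpose_mat A *\<^sub>v v"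
    and "\<And>e. e \<in> carrier_vec (n + 2) \<Longrightarrow> A *\<^sub>v e = 0\<^sub>v n \<Longrightarrow>
      \<exists>u \<in> carrier_vec (n + 2). e = br_map A *\<^sub>v u"
proof -
  obtain N where N: "\<And>i. annihilates_coker A (var i ^ N i)"
    using fin unfolding cofinite_coker_def by metis
  have reg: "regular3 ((var 0 ^ N 0) ^ (n + 2)) ((var 1 ^ N 1) ^ (n + 2)) ((var 2 ^ N 2) ^ (n + 2) :: 'k poly3)"
    unfolding power_mult[symmetric] by (rule regular3_vars)
  note exact = buchsbaum_rim_exact[OF A two_dvd_one[OF char] N N N reg]
  show "\<And>v. v \<in> carrier_vec n \<Longrightarrow> transpose_mat A *\<^sub>v v = 0\<^sub>v (n + 2) \<Longrightarrow> v = 0\<^sub>v n"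
    by (rule exact(1))
  show "\<And>u. u \<in> carrier_vec (n + 2) \<Longrightarrow> br_map A *\<^sub>v u = 0\<^sub>v (n + 2) \<Longrightarrow>
      \<exists>v \<in> carrier_vec n. u = transpose_mat A *\<^sub>v v"
    by (rule exact(2))
  show "\<And>e. e \<in> carrier_vec (n + 2) \<Longrightarrow> A *\<^sub>v e = 0\<^sub>v n \<Longrightarrow>
      \<exists>u \<in> carrier_vec (n + 2). e = br_map A *\<^sub>v u"
    by (rule exact(3))
qed

text \<open>A zero last column puts the last unit vector into the kernel of \<open>A\<close>, hence
  into the image of \<open>br_map A\<close>. But expansion along row 0, a row of \<open>A\<close> as
  \<open>n > 0\<close>, shows that the entries of \<open>br_map A\<close> have no constant term, so
  the entry 1 is out of reach.\<close>

lemma cofinite_coker_no_zero_column: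
  fixes A :: "'k::field poly3 mat"
  assumes A: "A \<in> carrier_mat n (n + 2)" and char: "CHAR('k) \<noteq> 2" and fin: "cofinite_coker A"
    and "n > 0" and const: "\<And>j. j < n + 2 \<Longrightarrow> lookup (A $$ (0, j)) 0 = 0"
    and zero: "\<And>i. i < n \<Longrightarrow> A $$ (i, n + 1) = 0"
  shows False
proof -
  let ?e = "unit_vec (n + 2) (n + 1) :: 'k poly3 vec"
  have "A *\<^sub>v ?e = 0\<^sub>v n" using A zero by (intro eq_vecI) (auto simp: mult_mat_vec_def)
  then obtain u where u: "u \<in> carrier_vec (n + 2)" "?e = br_map A *\<^sub>v u"
    using buchsbaum_rim_poly3(3)[OF A char fin, of ?e] by auto
  have "lookup (br_map A $$ (k, l)) 0 = 0" if "k < n + 2" "l < n + 2" for k l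
  proof -
    let ?M = "bordered A (unit_row k) (unit_row l)"
    have "br_map A $$ (k, l) = (\<Sum>j<n + 2. ?M $$ (0, j) * cofactor ?M 0 j)"
      unfolding br_map_index[OF A that] by (rule laplace_expansion_row[OF bordered_carrier[OF A]]) simp
    moreover have "lookup (?M $$ (0, j)) 0 = 0" if "j < n + 2" for j
      using that const A \<open>n > 0\<close> by (simp add: bordered_def)
    ultimately show ?thesis by (simp add: lookup_sum lookup_0_mult del: sum.lessThan_Suc add_2_eq_Suc')
  qed
  then have "lookup (\<Sum>l<n + 2. br_map A $$ (n + 1, l) * u $ l) 0 = 0"
    by (simp add: lookup_sum lookup_0_mult del: sum.lessThan_Suc add_2_eq_Suc')
  moreover have "(\<Sum>l<n + 2. br_map A $$ (n + 1, l) * u $ l) = (br_map A *\<^sub>v u) $ (n + 1)"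
    using br_map_carrier[OF A] u(1) by (simp add: scalar_prod_def atLeast0LessThan)
  ultimately show False unfolding u(2)[symmetric] by simp
qed

text \<open>If \<open>b i \<le> a i\<close>, the rows from \<open>i\<close> on vanish in the first \<open>i + 1\<close> columns. The remaining block
  has only one column more than rows, and bordering it by a zero column contradicts exactness.\<close>

lemma degree_gap:
  fixes A :: "'k::field poly3 mat"
  assumes A: "A \<in> carrier_mat n (n + 2)" and char: "CHAR('k) \<noteq> 2" and fin: "cofinite_coker A"
    and a: "mono_on {..<n} a" and b: "mono_on {..<n + 2} b"
    and hom: "\<And>i j. i < n \<Longrightarrow> j < n + 2 \<Longrightarrow> homogeneous (b j - a i) (A $$ (i, j))"
    and pos: "\<And>i j. i < n \<Longrightarrow> j < n + 2 \<Longrightarrow> A $$ (i, j) \<noteq> 0 \<Longrightarrow> b j - a i > (0::int)"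
    and i: "i < n"
  shows "a i < b i"
proof (rule ccontr)
  assume "\<not> a i < b i"
  have zero: "A $$ (r, j) = 0" if "i \<le> r" "r < n" "j \<le> i" for r j
  proof (rule ccontr)
    assume "A $$ (r, j) \<noteq> 0"
    then have "b j > a r" using pos[of r j] that by simp
    moreover have "a i \<le> a r" using monotone_onD[OF a] that by auto
    moreover have "b j \<le> b i" using monotone_onD[OF b] that by auto
    ultimately show False using \<open>\<not> a i < b i\<close> by simp
  qed
  define p where "p = n - i"
  have p: "p > 0" "i + p = n" using i by (auto simp: p_def)
  \<comment> \<open>Rows from \<open>i\<close> on and columns after \<open>i\<close>:
    \<open>p\<close> rows and \<open>p + 1\<close> columns. The zero column restores the shape
    \<open>p\<close> by \<open>p + 2\<close>.\<close>
  define C where "C = mat p (p + 2) (\<lambda>(r, c). if c < p + 1 then A $$ (i + r, i + 1 + c) else 0)"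
  have C: "C \<in> carrier_mat p (p + 2)" by (simp add: C_def)
  have "annihilates_coker C f" if f: "annihilates_coker A f" for f
  proof -
    obtain B where B: "B \<in> carrier_mat (n + 2) n" "A * B = f \<cdot>\<^sub>m 1\<^sub>m n"
      by (rule annihilates_cokerE[OF f A])
    \<comment> \<open>The matching block of \<open>B\<close>: since the chosen rows of
      \<open>A\<close> vanish in columns up to \<open>i\<close>, the sums in \<open>A * B\<close>
      only run over the later columns.\<close>
    define B' where "B' = mat (p + 2) p (\<lambda>(c, s). if c < p + 1 then B $$ (i + 1 + c, i + s) else 0)"
    have "C * B' = f \<cdot>\<^sub>m 1\<^sub>m p"
    proof (rule eq_matI)
      fix r s assume "r < dim_row (f \<cdot>\<^sub>m 1\<^sub>m p)" "s < dim_col (f \<cdot>\<^sub>m 1\<^sub>m p)"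
      then have rs: "r < p" "s < p" by auto
      have "(C * B') $$ (r, s) = (\<Sum>c<Suc (p + 1). C $$ (r, c) * B' $$ (c, s))"
        using rs by (simp add: C_def B'_def scalar_prod_def atLeast0LessThan del: sum.lessThan_Suc)
      also have "\<dots> = (\<Sum>c<p + 1. C $$ (r, c) * B' $$ (c, s))"
        using rs by (subst sum.lessThan_Suc) (simp add: C_def)
      also have "\<dots> = (\<Sum>c = 0..<p + 1. A $$ (i + r, c + (i + 1)) * B $$ (c + (i + 1), i + s))"
        unfolding atLeast0LessThan using rs by (intro sum.cong) (auto simp: C_def B'_def ac_simps)
      also have "\<dots> = (\<Sum>j = 0 + (i + 1)..<p + 1 + (i + 1). A $$ (i + r, j) * B $$ (j, i + s))"
        by (rule sum.shift_bounds_nat_ivl[symmetric])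
      also have "\<dots> = (\<Sum>j<n + 2. A $$ (i + r, j) * B $$ (j, i + s))"
        using rs p zero by (intro sum.mono_neutral_left) auto
      also have "\<dots> = (A * B) $$ (i + r, i + s)"
        using A B(1) rs p by (simp add: scalar_prod_def atLeast0LessThan)
      also have "\<dots> = (f \<cdot>\<^sub>m 1\<^sub>m p) $$ (r, s)" unfolding B(2) using rs p by simp
      finally show "(C * B') $$ (r, s) = (f \<cdot>\<^sub>m 1\<^sub>m p) $$ (r, s)" .
    qed (simp_all add: C_def B'_def)
    then show ?thesis by (intro annihilates_cokerI[OF C, of B']) (simp_all add: B'_def)
  qed
  then have "cofinite_coker C" using fin unfolding cofinite_coker_def by blast
  \<comment> \<open>Nonzero entries have positive degree, hence no constant term.\<close>
  moreover have "lookup (C $$ (0, j)) 0 = 0" if "j < p + 2" for j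
  proof (cases "j < p + 1")
    case True
    then show ?thesis using hom[of i "i + 1 + j"] pos[of i "i + 1 + j"] p that
      by (cases "A $$ (i, i + 1 + j) = 0") (auto simp: C_def homogeneous_iff)
  qed (use p that in \<open>auto simp: C_def\<close>)
  moreover have "C $$ (r, p + 1) = 0" if "r < p" for r using that by (simp add: C_def)
  ultimately show False using cofinite_coker_no_zero_column[OF C char _ p(1)] by blast
qed

section \<open>Dimensions of graded pieces\<close>

text \<open>Graded pieces are closed under constants but not under \<open>R\<close>, so any set of
  vectors may be the carrier and scalars act through \<open>const3\<close>. The undefined fields are
  fillers, as in \<open>coker_part\<close>.\<close>

definition kspace :: "nat \<Rightarrow> 'k::field poly3 vec set \<Rightarrow> ('k, 'k poly3 vec) module" where
  "kspace n S = \<lparr> carrier = S, monoid.mult = undefined, one = undefined, zero = 0\<^sub>v n, add = (+),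
     smult = (\<lambda>c v. const3 c \<cdot>\<^sub>v v) \<rparr>"

lemma kspace_simps [simp]:
  "carrier (kspace n S) = S" "zero (kspace n S) = 0\<^sub>v n" "add (kspace n S) = (+)"
  "smult (kspace n S) = (\<lambda>c v. const3 c \<cdot>\<^sub>v v)" "(kspace n S)\<lparr>carrier := T\<rparr> = kspace n T"
  by (simp_all add: kspace_def)

definition ksubspace :: "nat \<Rightarrow> 'k::field poly3 vec set \<Rightarrow> bool" where
  "ksubspace n S \<longleftrightarrow> S \<subseteq> carrier_vec n \<and> 0\<^sub>v n \<in> S \<and> (\<forall>u\<in>S. \<forall>v\<in>S. u + v \<in> S) \<and>
     (\<forall>c. \<forall>v\<in>S. const3 c \<cdot>\<^sub>v v \<in> S)"

lemma kspace_vectorspace: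
  fixes S :: "'k::field poly3 vec set"
  assumes S: "ksubspace n S"
  shows "vectorspace class_ring (kspace n S)"
proof -
  have car: "v \<in> carrier_vec n" if "v \<in> S" for v using S that by (auto simp: ksubspace_def)
  have closed: "0\<^sub>v n \<in> S" "\<And>u v. u \<in> S \<Longrightarrow> v \<in> S \<Longrightarrow> u + v \<in> S"
    "\<And>c v. v \<in> S \<Longrightarrow> const3 c \<cdot>\<^sub>v v \<in> S"
    using S by (auto simp: ksubspace_def)
  have add: "u + v = v + u" "(u + v) + w = u + (v + w)" "v + 0\<^sub>v n = v"
    if "u \<in> S" "v \<in> S" "w \<in> S" for u v w
    using that[THEN car] by (auto simp: comm_add_vec assoc_add_vec[of _ n])
  have smult: "const3 (c * c') \<cdot>\<^sub>v v = const3 c \<cdot>\<^sub>v (const3 c' \<cdot>\<^sub>v v)"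
    "const3 1 \<cdot>\<^sub>v v = v"
    "const3 (c + c') \<cdot>\<^sub>v v = const3 c \<cdot>\<^sub>v v + const3 c' \<cdot>\<^sub>v v"
    "const3 c \<cdot>\<^sub>v (v + w) = const3 c \<cdot>\<^sub>v v + const3 c \<cdot>\<^sub>v w"
    if "v \<in> S" "w \<in> S" for c c' v w
    using that[THEN car]
    by (auto simp: const3_simps smult_smult_assoc add_smult_distrib_vec smult_add_distrib_vec[of _ n])
  show ?thesis
  proof (rule vs_criteria)
    show "field (class_ring :: 'k ring)" by (rule class_field)
    show "\<forall>v\<in>carrier (kspace n S). \<exists>w\<in>carrier (kspace n S). v \<oplus>\<^bsub>kspace n S\<^esub> w = \<zero>\<^bsub>kspace n S\<^esub>"
    proof
      fix v assume v: "v \<in> carrier (kspace n S)"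
      have "v + const3 (- 1) \<cdot>\<^sub>v v = 0\<^sub>v n"
        using car[of v] v by (intro eq_vecI) (auto simp: const3_def single_uminus)
      then show "\<exists>w\<in>carrier (kspace n S). v \<oplus>\<^bsub>kspace n S\<^esub> w = \<zero>\<^bsub>kspace n S\<^esub>"
        using S v by (auto simp: ksubspace_def)
    qed
  qed (use closed add smult in \<open>simp_all add: class_ring_simps\<close>)
qed

definition kdim :: "nat \<Rightarrow> 'k::field poly3 vec set \<Rightarrow> nat" where
  "kdim n S = vectorspace.dim (class_ring :: 'k ring) (kspace n S)"

definition kfinite :: "nat \<Rightarrow> 'k::field poly3 vec set \<Rightarrow> bool" where
  "kfinite n S \<longleftrightarrow> vectorspace.fin_dim (class_ring :: 'k ring) (kspace n S)"

lemma linear_mapI: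
  assumes "vectorspace K V" "vectorspace K W"
    and "\<And>v. v \<in> carrier V \<Longrightarrow> f v \<in> carrier W"
    and "\<And>u v. u \<in> carrier V \<Longrightarrow> v \<in> carrier V \<Longrightarrow> f (u \<oplus>\<^bsub>V\<^esub> v) = f u \<oplus>\<^bsub>W\<^esub> f v"
    and "\<And>c v. c \<in> carrier K \<Longrightarrow> v \<in> carrier V \<Longrightarrow> f (c \<odot>\<^bsub>V\<^esub> v) = c \<odot>\<^bsub>W\<^esub> f v"
  shows "linear_map K V W f"
proof -
  show ?thesis
  proof (intro linear_map.intro mod_hom.intro mod_hom_axioms.intro assms(1,2)
      vectorspace.axioms(1)[OF assms(1)] vectorspace.axioms(1)[OF assms(2)])
    show "f \<in> LinearCombinations.module_hom K V W" using assms(3-5) by (simp add: LinearCombinations.module_hom_def)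
  qed
qed

lemma kdim_rank_nullity:
  fixes S T :: "'k::field poly3 vec set"
  assumes A: "A \<in> carrier_mat m n" and S: "ksubspace n S" "kfinite n S" and T: "ksubspace m T"
    and img: "\<And>v. v \<in> S \<Longrightarrow> A *\<^sub>v v \<in> T"
  shows "kdim m ((\<lambda>v. A *\<^sub>v v) ` S) + kdim n {v \<in> S. A *\<^sub>v v = 0\<^sub>v m} = kdim n S"
proof -
  have car: "v \<in> carrier_vec n" if "v \<in> S" for v using S that by (auto simp: ksubspace_def)
  interpret L: linear_map class_ring "kspace n S" "kspace m T" "\<lambda>v. A *\<^sub>v v"
    by (rule linear_mapI[OF kspace_vectorspace[OF S(1)] kspace_vectorspace[OF T]])
      (use A car img in \<open>auto simp: mult_add_distrib_mat_vec mult_mat_smult_vec\<close>)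
  show ?thesis
    using L.rank_nullity S(2)
    by (simp add: kdim_def kfinite_def L.im_def L.ker_def)
qed

lemma kdim_zero: "kdim n {0\<^sub>v n :: 'k::field poly3 vec} = 0"
proof -
  have "ksubspace n {0\<^sub>v n :: 'k poly3 vec}" by (auto simp: ksubspace_def)
  then interpret vectorspace "class_ring :: 'k ring" "kspace n {0\<^sub>v n}" by (rule kspace_vectorspace)
  have "span {} = {0\<^sub>v n}" by (auto simp: span_def lincomb_def)
  moreover have "\<not> lin_dep {}" by (auto simp: lin_dep_def)
  ultimately have "basis {}" by (simp add: basis_def)
  then show ?thesis using dim_basis[of "{}"] by (simp add: kdim_def)
qed

lemma free_part_subspace: "ksubspace n (free_part n a t :: 'k::field poly3 vec set)"
proof -
  have "homogeneous s (const3 c * p)" if "homogeneous s p" for s c and p :: "'k poly3"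
    using that by (auto simp: homogeneous_iff const3_mult)
  then show ?thesis by (auto simp: ksubspace_def free_part_def homogeneous_add)
qed

lemma kspace_finsum_coeff:
  fixes f :: "'i \<Rightarrow> 'k::field poly3 vec"
  assumes S: "ksubspace n S" and B: "finite B" and f: "f \<in> B \<rightarrow> S" and i: "i < n"
  shows "lookup (finsum (kspace n S) f B $ i) m = (\<Sum>w\<in>B. lookup (f w $ i) m)"
proof -
  interpret vectorspace "class_ring :: 'k ring" "kspace n S" by (rule kspace_vectorspace[OF S])
  have car: "v \<in> carrier_vec n" if "v \<in> S" for v using S that by (auto simp: ksubspace_def)
  show ?thesis using B f
  proof (induction B rule: finite_induct)
    case empty
    then show ?case using i by simp
  next
    case (insert x F)
    have "finsum (kspace n S) f F \<in> carrier (kspace n S)"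
      by (rule M.finsum_closed) (use insert in auto)
    then have "finsum (kspace n S) f F \<in> carrier_vec n" using car by simp
    moreover have "finsum (kspace n S) f (insert x F) = f x + finsum (kspace n S) f F"
      using M.finsum_insert[of F x f] insert by auto
    ultimately show ?case using insert i car by (simp add: lookup_add)
  qed
qed

section \<open>Counting monomials in three variables\<close>

definition monomials :: "int \<Rightarrow> (3 \<Rightarrow>\<^sub>0 nat) set" where
  "monomials s = {m. int (mdeg m) = s}"

lemma UNIV_3: "(UNIV :: 3 set) = {0, 1, 2}"
proof -
  have "card {0, 1, 2 :: 3} = CARD(3)" by simp
  then show ?thesis by (metis card_subset_eq finite subset_UNIV)
qed

text \<open>The degree and the first two exponents determine the third.\<close>

lemma bij_monomials:
  "bij_betw (\<lambda>m. (lookup m 0, lookup m 1)) (monomials (int k)) (SIGMA x:{..k}. {..k - x})"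
proof -
  have deg: "mdeg m = lookup m 0 + lookup m 1 + lookup m 2" for m
    unfolding mdeg_def UNIV_3 by simp
  show ?thesis
  proof (rule bij_betw_imageI)
    show "inj_on (\<lambda>m. (lookup m 0, lookup m 1)) (monomials (int k))"
    proof (rule inj_onI, rule poly_mapping_eqI)
      fix m m' and i :: 3 assume "m \<in> monomials (int k)" "m' \<in> monomials (int k)"
        "(lookup m 0, lookup m 1) = (lookup m' 0, lookup m' 1)"
      then have "lookup m 0 = lookup m' 0" "lookup m 1 = lookup m' 1" "lookup m 2 = lookup m' 2"
        by (simp_all add: monomials_def deg)
      moreover have "i \<in> {0, 1, 2}" by (metis UNIV_3 UNIV_I)
      ultimately show "lookup m i = lookup m' i" by blast
    qed
    show "(\<lambda>m. (lookup m 0, lookup m 1)) ` monomials (int k) = (SIGMA x:{..k}. {..k - x})"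
    proof (rule Set.set_eqI)
      fix p :: "nat \<times> nat"
      obtain x y where p: "p = (x, y)" by (cases p)
      show "p \<in> (\<lambda>m. (lookup m 0, lookup m 1)) ` monomials (int k) \<longleftrightarrow> p \<in> (SIGMA x:{..k}. {..k - x})"
      proof
        assume "p \<in> (SIGMA x:{..k}. {..k - x})"
        then have xy: "x + y \<le> k" using p by auto
        let ?m = "Poly_Mapping.single 0 x + Poly_Mapping.single 1 y + Poly_Mapping.single 2 (k - x - y) :: 3 \<Rightarrow>\<^sub>0 nat"
        have "?m \<in> monomials (int k)" using xy by (simp add: monomials_def)
        moreover have "p = (lookup ?m 0, lookup ?m 1)" using p by (simp add: lookup_add lookup_single)
        ultimately show "p \<in> (\<lambda>m. (lookup m 0, lookup m 1)) ` monomials (int k)" by blast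
      qed (auto simp: monomials_def deg)
    qed
  qed
qed

lemma finite_monomials: "finite (monomials s)"
proof (cases "s < 0")
  case True
  then show ?thesis by (auto simp: monomials_def)
next
  case False
  then show ?thesis using bij_betw_finite[OF bij_monomials[of "nat s"]] by simp
qed

lemma card_monomials: "card (monomials s) = (if s < 0 then 0 else nat ((s + 1) * (s + 2) div 2))"
proof (cases "s < 0")
  case True
  then show ?thesis by (auto simp: monomials_def)
next
  case False
  define k where "k = nat s"
  have s: "s = int k" using False by (simp add: k_def)
  have "card (monomials s) = card (SIGMA x:{..k}. {..k - x})"
    unfolding s by (rule bij_betw_same_card[OF bij_monomials])
  \<comment> \<open>Each first exponent \<open>x\<close> leaves \<open>k - x + 1\<close> second
    ones, written in the form that \<open>sum.nat_diff_reindex\<close> reverses.\<close>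
  also have "\<dots> = (\<Sum>x<Suc k. Suc (Suc k - Suc x))" by (simp add: lessThan_Suc_atMost)
  also have "\<dots> = (\<Sum>x<Suc k. Suc x)" by (rule sum.nat_diff_reindex)
  also have "2 * \<dots> = (k + 1) * (k + 2)" by (induction k) auto
  finally have "int (2 * card (monomials s)) = (s + 1) * (s + 2)" unfolding s by (simp add: algebra_simps)
  then show ?thesis using False by simp
qed

text \<open>The vectors with one monomial in one coordinate form a basis, indexed by pairs
  \<open>(i, m)\<close> where \<open>m\<close> has degree \<open>t - a i\<close>.\<close>

lemma free_part_basis:
  fixes a :: "nat \<Rightarrow> int"
  shows "kfinite n (free_part n a t :: 'k::field poly3 vec set)"
    and "kdim n (free_part n a t :: 'k::field poly3 vec set) = (\<Sum>i<n. card (monomials (t - a i)))"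
proof -
  let ?S = "free_part n a t :: 'k poly3 vec set"
  have S: "ksubspace n ?S" by (rule free_part_subspace)
  interpret vectorspace "class_ring :: 'k ring" "kspace n ?S" by (rule kspace_vectorspace[OF S])
  define I where "I = (SIGMA i:{..<n}. monomials (t - a i))"
  define e where "e = (\<lambda>(i, m :: 3 \<Rightarrow>\<^sub>0 nat). vec n (\<lambda>k :: nat. if k = i then Poly_Mapping.single m (1::'k) else 0))"
  have e: "lookup (e (i, m) $ k) m' = (if k = i \<and> m' = m then 1 else 0)" if "k < n" for i m k m'
    using that by (auto simp: e_def lookup_single when_def)
  have inj: "inj_on e I"
  proof (rule inj_onI, clarify)
    fix i m i' m' assume *: "(i, m) \<in> I" "(i', m') \<in> I" "e (i, m) = e (i', m')"
    then have "i < n" by (simp add: I_def)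
    then have "lookup (e (i', m') $ i) m = 1" using e[of i i m m] *(3) by simp
    then show "i = i' \<and> m = m'" using e[OF \<open>i < n\<close>, of i' m' m] by (auto split: if_splits)
  qed
  have finI: "finite I" by (simp add: I_def finite_monomials)
  have sub: "e ` I \<subseteq> ?S"
    by (auto simp: I_def e_def free_part_def homogeneous_iff monomials_def lookup_single when_def
        split: if_splits)
  \<comment> \<open>A scalar is recovered as the coefficient of \<open>m\<close> in coordinate
    \<open>i\<close>, which yields both existence and uniqueness in
    \<open>basis_criterion\<close>.\<close>
  have coord: "lookup (lincomb c (e ` I) $ i) m = (if (i, m) \<in> I then c (e (i, m)) else 0)"
    if "i < n" for c i m
  proof -
    have "lincomb c (e ` I) = finsum (kspace n ?S) (\<lambda>v. const3 (c v) \<cdot>\<^sub>v v) (e ` I)"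
      by (simp add: lincomb_def)
    also have "lookup (\<dots> $ i) m = (\<Sum>w\<in>e ` I. lookup ((const3 (c w) \<cdot>\<^sub>v w) $ i) m)"
      by (rule kspace_finsum_coeff[OF S]) (use finI sub S that in \<open>auto simp: ksubspace_def\<close>)
    also have "\<dots> = (\<Sum>p\<in>I. lookup ((const3 (c (e p)) \<cdot>\<^sub>v e p) $ i) m)"
      by (subst sum.reindex[OF inj]) simp
    also have "\<dots> = (\<Sum>p\<in>I. if p = (i, m) then c (e p) else 0)"
    proof (rule sum.cong)
      fix p assume "p \<in> I"
      obtain i' m' where p: "p = (i', m')" by (cases p)
      have "dim_vec (e p) = n" by (simp add: e_def p)
      then show "lookup ((const3 (c (e p)) \<cdot>\<^sub>v e p) $ i) m = (if p = (i, m) then c (e p) else 0)"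
        using that e[OF that, of i' m' m] by (auto simp: const3_mult p)
    qed simp
    finally show ?thesis using finI by simp
  qed
  have b: "basis (e ` I)"
  proof (subst basis_criterion)
    show "\<forall>v. v \<in> carrier (kspace n ?S) \<longrightarrow> (\<exists>!c. c \<in> e ` I \<rightarrow>\<^sub>E carrier class_ring \<and> lincomb c (e ` I) = v)"
    proof (intro allI impI)
      fix v assume "v \<in> carrier (kspace n ?S)"
      then have v: "v \<in> ?S" by simp
      have zero: "lookup (v $ i) m = 0" if "i < n" "(i, m) \<notin> I" for i m
        using v that by (auto simp: free_part_def homogeneous_iff I_def monomials_def)
      define c where "c = restrict (\<lambda>w. case inv_into I e w of (i, m) \<Rightarrow> lookup (v $ i) m) (e ` I)"
      have c: "c (e (i, m)) = lookup (v $ i) m" if "(i, m) \<in> I" for i m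
        using that inj by (simp add: c_def)
      have car: "lincomb d (e ` I) \<in> carrier_vec n" for d
      proof -
        have "lincomb d (e ` I) \<in> carrier (kspace n ?S)"
          by (rule lincomb_closed) (use sub in \<open>auto simp: class_ring_simps\<close>)
        then show ?thesis using S by (auto simp: ksubspace_def)
      qed
      have vc: "v \<in> carrier_vec n" using v by (simp add: free_part_def)
      show "\<exists>!c. c \<in> e ` I \<rightarrow>\<^sub>E carrier class_ring \<and> lincomb c (e ` I) = v"
      proof (rule ex1I[of _ c])
        have "lincomb c (e ` I) = v"
        proof (rule eq_vecI)
          fix i assume "i < dim_vec v"
          then have i: "i < n" using vc by simp
          show "lincomb c (e ` I) $ i = v $ i"
            by (rule poly_mapping_eqI) (use i zero c in \<open>auto simp: coord\<close>)
        qed (use car vc in simp)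
        then show "c \<in> e ` I \<rightarrow>\<^sub>E carrier class_ring \<and> lincomb c (e ` I) = v"
          by (auto simp: c_def)
      next
        fix c' assume c': "c' \<in> e ` I \<rightarrow>\<^sub>E carrier class_ring \<and> lincomb c' (e ` I) = v"
        show "c' = c"
        proof (rule extensionalityI[of _ "e ` I"])
          fix w assume "w \<in> e ` I"
          then obtain i m where im: "(i, m) \<in> I" "w = e (i, m)" by auto
          then have "i < n" by (simp add: I_def)
          then have "c' w = lookup (lincomb c' (e ` I) $ i) m" using im by (simp add: coord)
          also have "\<dots> = c w" using c' im c by metis
          finally show "c' w = c w" .
        qed (use c' in \<open>simp_all add: c_def PiE_def\<close>)
      qed
    qed
  qed (use finI sub in auto)
  have fin: "finite (e ` I)" using finI by simp
  show "kfinite n ?S"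
    unfolding kfinite_def fin_dim_def using b fin unfolding basis_def by blast
  have "kdim n ?S = card (e ` I)" unfolding kdim_def by (rule dim_basis[OF fin b])
  also have "\<dots> = card I" by (rule card_image[OF inj])
  also have "\<dots> = (\<Sum>i<n. card (monomials (t - a i)))"
    unfolding I_def by (rule card_SigmaI) (simp_all add: finite_monomials)
  finally show "kdim n ?S = (\<Sum>i<n. card (monomials (t - a i)))" .
qed

section \<open>The increments of the Hilbert function\<close>

definition pos_part :: "int \<Rightarrow> int" where "pos_part y = max y 0"

text \<open>\<open>hdiff y\<close> is the increment of the Hilbert function from degree \<open>y - 2\<close> to degree \<open>y - 1\<close>.\<close>

definition hdiff :: "nat \<Rightarrow> (nat \<Rightarrow> int) \<Rightarrow> (nat \<Rightarrow> int) \<Rightarrow> int \<Rightarrow> int \<Rightarrow> int" where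
  "hdiff n a b d y = (\<Sum>i<n. pos_part (y - a i)) - (\<Sum>j<n + 2. pos_part (y - b j))
     + (\<Sum>j<n + 2. pos_part (y - d + b j)) - (\<Sum>i<n. pos_part (y - d + a i))"

lemma pos_part_minus: "pos_part x - pos_part (- x) = x"
  by (auto simp: pos_part_def)

text \<open>Replacing \<open>y\<close> by \<open>d - y\<close> exchanges the first and last sums and
  the middle two, with opposite arguments. By \<open>pos_part_minus\<close> only linear terms remain
  in the total; those in \<open>y\<close> cancel, and the constants cancel by the choice of
  \<open>d\<close>.\<close>

lemma hdiff_reflect:
  assumes d: "d = (\<Sum>j<n + 2. b j) - (\<Sum>i<n. a i)"
  shows "hdiff n a b d (d - y) = - hdiff n a b d y"
proof -
  have "hdiff n a b d y + hdiff n a b d (d - y) =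
      (\<Sum>i<n. pos_part (y - a i) - pos_part (- (y - a i)))
      - (\<Sum>j<n + 2. pos_part (y - b j) - pos_part (- (y - b j)))
      + (\<Sum>j<n + 2. pos_part (y - d + b j) - pos_part (- (y - d + b j)))
      - (\<Sum>i<n. pos_part (y - d + a i) - pos_part (- (y - d + a i)))"
    unfolding hdiff_def sum_subtractf by (simp add: algebra_simps del: sum.lessThan_Suc add_2_eq_Suc')
  also have "\<dots> = 0"
    unfolding pos_part_minus using d
    by (simp add: sum.distrib sum_subtractf algebra_simps del: sum.lessThan_Suc)
  finally show ?thesis by simp
qed

text \<open>Up to \<open>d / 2\<close> the two reflected sums vanish. In the others each
  \<open>b i\<close> is paired with \<open>a i < b i\<close>, which leaves \<open>b n\<close> and
  \<open>b (n + 1)\<close> over; their terms vanish for \<open>y\<close> up to \<open>b n\<close>,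
  and beyond that all pairs are constant.\<close>

lemma hdiff_nonneg:
  assumes n: "n > 0" and a: "mono_on {..<n} a" and b: "mono_on {..<n + 2} b"
    and gap: "\<And>i. i < n \<Longrightarrow> a i < b i" and a0: "a 0 = 0"
    and d: "d = (\<Sum>j<n + 2. b j) - (\<Sum>i<n. a i)"
    and bound: "\<And>j. j < n + 2 \<Longrightarrow> 2 * b j \<le> d"
    and y: "2 * y \<le> d"
  shows "hdiff n a b d y \<ge> 0"
proof -
  have ab: "(\<Sum>i<n. b i - a i) \<ge> 0" using gap by (intro sum_nonneg) (simp add: less_imp_le)
  have dd: "d = (\<Sum>i<n. b i - a i) + b n + b (n + 1)" using d by (simp add: sum_subtractf)
  have bn: "b i \<le> b n" if "i \<le> n" for i using monotone_onD[OF b, of i n] that by auto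
  have bn1: "b n \<le> b (n + 1)" using monotone_onD[OF b, of n "n + 1"] by auto
  \<comment> \<open>With \<open>dd\<close> this gives
    \<open>d >= b n + b (n + 1) >= 2 * b n > 2 * a i\<close>.\<close>
  have "a i < b n" if "i < n" for i using gap[OF that] bn[of i] that by simp
  then have "2 * a i \<le> d" if "i < n" for i using that ab bn1 unfolding dd by fastforce
  then have "pos_part (y - d + a i) = 0" if "i < n" for i
    using that y unfolding pos_part_def by fastforce
  moreover have "pos_part (y - d + b j) = 0" if "j < n + 2" for j
    using bound[OF that] y unfolding pos_part_def by simp
  ultimately have "hdiff n a b d y = (\<Sum>i<n. pos_part (y - a i)) - (\<Sum>j<n + 2. pos_part (y - b j))"
    by (simp add: hdiff_def del: sum.lessThan_Suc add_2_eq_Suc')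
  also have "\<dots> = (\<Sum>i<n. pos_part (y - a i) - pos_part (y - b i)) - pos_part (y - b n) - pos_part (y - b (n + 1))"
    by (simp add: sum_subtractf)
  also have "\<dots> \<ge> 0"
  proof (cases "y \<le> b n")
    case True
    have "(\<Sum>i<n. pos_part (y - a i) - pos_part (y - b i)) \<ge> 0"
      using gap by (intro sum_nonneg) (fastforce simp: pos_part_def)
    then show ?thesis using True bn1 by (simp add: pos_part_def)
  next
    \<comment> \<open>Each pair has reached its final value \<open>b i - a i\<close>. What remains
      is \<open>d - b (n + 1) - y\<close> or \<open>d - 2 * y\<close>, according to whether
      \<open>y\<close> is at most \<open>b (n + 1)\<close>; both are nonnegative.\<close>
    case False
    have "pos_part (y - a i) - pos_part (y - b i) = b i - a i" if "i < n" for i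
      using False bn[of i] gap[OF that] that by (simp add: pos_part_def)
    then have "(\<Sum>i<n. pos_part (y - a i) - pos_part (y - b i)) = d - b n - b (n + 1)" by (simp add: dd)
    then show ?thesis using False y bound[of "n + 1"] by (simp add: pos_part_def)
  qed
  finally show ?thesis .
qed

lemma unimodal_of_hdiff:
  fixes h :: "int \<Rightarrow> nat"
  assumes h: "\<And>t. int (h (t + 1)) - int (h t) = hdiff n a b d (t + 2)"
    and d: "d = (\<Sum>j<n + 2. b j) - (\<Sum>i<n. a i)"
    and nonneg: "\<And>y. 2 * y \<le> d \<Longrightarrow> hdiff n a b d y \<ge> 0"
  shows "unimodal h"
  unfolding unimodal_def
\<comment> \<open>\<open>(d + 1) div 2\<close> is \<open>d / 2\<close> rounded up, and the 2 undoes
  the shift in \<open>hdiff n a b d (t + 2)\<close>. Before the peak \<open>t + 2\<close> is at most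
  \<open>d / 2\<close>; from it on, the reflected argument is.\<close>
proof (intro exI[of _ "(d + 1) div 2 - 2"] conjI allI impI)
  fix t assume "t < (d + 1) div 2 - 2"
  then have "2 * (t + 2) \<le> d" by presburger
  then show "h t \<le> h (t + 1)" using h[of t] nonneg[of "t + 2"] by simp
next
  fix t assume "t \<ge> (d + 1) div 2 - 2"
  then have "2 * (d - (t + 2)) \<le> d" by presburger
  then show "h (t + 1) \<le> h t" using h[of t] nonneg[of "d - (t + 2)"] hdiff_reflect[OF d, of "t + 2"] by simp
qed

text \<open>The dimension of the degree \<open>s\<close> part of \<open>R\<close>, a binomial
  coefficient. Negative degrees are cut off because the quadratic polynomial is positive again below
  -2.\<close>

definition npairs :: "int \<Rightarrow> nat" where
  "npairs s = (if s < 0 then 0 else nat ((s + 1) * (s + 2) div 2))"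

lemma npairs_diff: "int (npairs (s + 1)) - int (npairs s) = pos_part (s + 2)"
proof -
  consider "s < -1" | "s = -1" | "s \<ge> 0" by linarith
  then show ?thesis
  proof cases
    case 3
    have "(s + 2) * (s + 3) = (s + 1) * (s + 2) + (s + 2) * 2" by (simp add: algebra_simps)
    then have "(s + 2) * (s + 3) div 2 = (s + 1) * (s + 2) div 2 + (s + 2)" by simp
    moreover have "(s + 1) * (s + 2) div 2 \<ge> 0" using 3 by (simp add: pos_imp_zdiv_nonneg_iff)
    ultimately show ?thesis using 3 by (simp add: npairs_def pos_part_def add.assoc)
  qed (auto simp: npairs_def pos_part_def)
qed

section \<open>The Hilbert function of the cokernel\<close>

lemma mult_mat_vec_index:
  assumes "A \<in> carrier_mat m n" "v \<in> carrier_vec n" "i < m"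
  shows "(A *\<^sub>v v) $ i = (\<Sum>j<n. A $$ (i, j) * v $ j)"
  using assms by (simp add: scalar_prod_def atLeast0LessThan)

lemma mult_free_part:
  fixes A :: "'k::field poly3 mat"
  assumes A: "A \<in> carrier_mat m n" and v: "v \<in> free_part n \<beta> t"
    and hom: "\<And>i j. i < m \<Longrightarrow> j < n \<Longrightarrow> homogeneous (\<beta> j - \<alpha> i) (A $$ (i, j))"
  shows "A *\<^sub>v v \<in> free_part m \<alpha> t"
proof -
  have vc: "v \<in> carrier_vec n" using v by (simp add: free_part_def)
  have "homogeneous (t - \<alpha> i) ((A *\<^sub>v v) $ i)" if i: "i < m" for i
  proof -
    have "homogeneous (t - \<alpha> i) (A $$ (i, j) * v $ j)" if "j < n" for j
      using homogeneous_mult[OF hom[OF i that], of "t - \<beta> j" "v $ j"] v that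
      by (simp add: free_part_def)
    then show ?thesis unfolding mult_mat_vec_index[OF A vc i] by (intro homogeneous_sum) simp
  qed
  then show ?thesis using mult_mat_vec_carrier[OF A vc] by (simp add: free_part_def del: index_mult_mat_vec)
qed

text \<open>If coordinate \<open>j\<close> of \<open>v\<close> is replaced by its component of
  degree \<open>t - \<beta> j\<close>, the product changes only outside the degrees of
  \<open>A v\<close>, hence not at all. This restricts exactness over the ring to each
  degree.\<close>

lemma image_free_part:
  fixes A :: "'k::field poly3 mat"
  assumes A: "A \<in> carrier_mat m n" and v: "v \<in> carrier_vec n" "A *\<^sub>v v \<in> free_part m \<alpha> t"
    and hom: "\<And>i j. i < m \<Longrightarrow> j < n \<Longrightarrow> homogeneous (\<beta> j - \<alpha> i) (A $$ (i, j))"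
  shows "\<exists>w \<in> free_part n \<beta> t. A *\<^sub>v v = A *\<^sub>v w"
proof
  let ?w = "vec n (\<lambda>j. hcomp (t - \<beta> j) (v $ j))"
  show "?w \<in> free_part n \<beta> t" by (simp add: free_part_def homogeneous_hcomp)
  show "A *\<^sub>v v = A *\<^sub>v ?w"
  proof (rule eq_vecI)
    fix i assume "i < dim_vec (A *\<^sub>v ?w)"
    then have i: "i < m" using A by simp
    have "(A *\<^sub>v v) $ i = hcomp (t - \<alpha> i) ((A *\<^sub>v v) $ i)"
      using v(2) i hcomp_homogeneous[of "t - \<alpha> i" "(A *\<^sub>v v) $ i" "t - \<alpha> i"]
      by (simp only: free_part_def mem_Collect_eq simp_thms if_True)
    also have "\<dots> = hcomp (t - \<alpha> i) (\<Sum>j<n. A $$ (i, j) * v $ j)"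
      by (simp only: mult_mat_vec_index[OF A v(1) i])
    also have "\<dots> = (\<Sum>j<n. A $$ (i, j) * hcomp (t - \<beta> j) (v $ j))"
      unfolding hcomp_sum
    proof (rule sum.cong)
      fix j assume "j \<in> {..<n}"
      then show "hcomp (t - \<alpha> i) (A $$ (i, j) * v $ j) = A $$ (i, j) * hcomp (t - \<beta> j) (v $ j)"
        using hcomp_mult[OF hom[OF i, of j], of "t - \<beta> j" "v $ j"] by simp
    qed simp
    also have "\<dots> = (A *\<^sub>v ?w) $ i"
      using A i by (simp add: scalar_prod_def atLeast0LessThan)
    finally show "(A *\<^sub>v v) $ i = (A *\<^sub>v ?w) $ i" .
  qed (use A in simp)
qed

section \<open>The graded pieces of the cokernel as vector spaces\<close>

lemma mat_image_closed:
  fixes A :: "'r::comm_ring_1 mat"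
  assumes A: "A \<in> carrier_mat n m"
  shows "mat_image A \<subseteq> carrier_vec n" "0\<^sub>v n \<in> mat_image A"
    "u \<in> mat_image A \<Longrightarrow> v \<in> mat_image A \<Longrightarrow> u + v \<in> mat_image A"
    "u \<in> mat_image A \<Longrightarrow> c \<cdot>\<^sub>v u \<in> mat_image A"
proof -
  show "mat_image A \<subseteq> carrier_vec n" using A by (auto simp: mat_image_def)
  have "A *\<^sub>v 0\<^sub>v m = 0\<^sub>v n" using A by (intro eq_vecI) auto
  then show "0\<^sub>v n \<in> mat_image A"
    unfolding mat_image_def using A by (intro image_eqI[of _ _ "0\<^sub>v m"]) auto
  show "u + v \<in> mat_image A" if "u \<in> mat_image A" "v \<in> mat_image A"
  proof -
    from that A obtain x y where "x \<in> carrier_vec m" "y \<in> carrier_vec m" "u = A *\<^sub>v x" "v = A *\<^sub>v y"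
      by (auto simp: mat_image_def)
    then show ?thesis using A
      by (auto simp: mat_image_def mult_add_distrib_mat_vec[symmetric] intro!: imageI)
  qed
  show "c \<cdot>\<^sub>v u \<in> mat_image A" if "u \<in> mat_image A"
  proof -
    from that A obtain x where "x \<in> carrier_vec m" "u = A *\<^sub>v x" by (auto simp: mat_image_def)
    then show ?thesis using A
      by (auto simp: mat_image_def mult_mat_smult_vec[symmetric] intro!: imageI)
  qed
qed

definition vcoset :: "'r::comm_ring_1 mat \<Rightarrow> 'r vec \<Rightarrow> 'r vec set" where
  "vcoset A v = (\<lambda>h. h + v) ` mat_image A"

lemma vcoset_eq_iff:
  fixes A :: "'r::comm_ring_1 mat"
  assumes A: "A \<in> carrier_mat n m" and uv: "u \<in> carrier_vec n" "v \<in> carrier_vec n"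
  shows "vcoset A u = vcoset A v \<longleftrightarrow> u - v \<in> mat_image A"
proof
  note N = mat_image_closed[OF A]
  assume "vcoset A u = vcoset A v"
  moreover have "u \<in> vcoset A u" unfolding vcoset_def using N(2) uv by (intro image_eqI[of _ _ "0\<^sub>v n"]) auto
  ultimately obtain h where h: "h \<in> mat_image A" "u = h + v" by (auto simp: vcoset_def)
  then have "h \<in> carrier_vec n" using N(1) by auto
  then have "u - v = h" unfolding h(2) using uv by (intro eq_vecI) auto
  then show "u - v \<in> mat_image A" using h by simp
next
  note N = mat_image_closed[OF A]
  assume d: "u - v \<in> mat_image A"
  have "- (u - v) = (-1) \<cdot>\<^sub>v (u - v)" by (intro eq_vecI) auto
  then have d': "- (u - v) \<in> mat_image A" using N(4)[OF d, of "-1"] by simp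
  show "vcoset A u = vcoset A v"
  proof (intro equalityI subsetI)
    fix w assume "w \<in> vcoset A u"
    then obtain h where h: "h \<in> mat_image A" "w = h + u" by (auto simp: vcoset_def)
    then have "h \<in> carrier_vec n" using N(1) by auto
    then have "w = (h + (u - v)) + v" unfolding h(2) using uv by (intro eq_vecI) auto
    then show "w \<in> vcoset A v" unfolding vcoset_def using N(3)[OF h(1) d] by blast
  next
    fix w assume "w \<in> vcoset A v"
    then obtain h where h: "h \<in> mat_image A" "w = h + v" by (auto simp: vcoset_def)
    then have "h \<in> carrier_vec n" using N(1) by auto
    then have "w = (h + - (u - v)) + u" unfolding h(2) using uv by (intro eq_vecI) auto
    then show "w \<in> vcoset A u" unfolding vcoset_def using N(3)[OF h(1) d'] by blast
  qed
qed

text \<open>The set operations of the quotient record, unfolded once so that later arguments compute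
  with representatives.\<close>

lemma coker_part_simps:
  fixes A :: "'k::field poly3 mat"
  assumes A: "A \<in> carrier_mat n m"
  shows "carrier (coker_part a A t) = vcoset A ` free_part n a t"
    and "zero (coker_part a A t) = vcoset A (0\<^sub>v n)"
    and "u \<in> carrier_vec n \<Longrightarrow> v \<in> carrier_vec n \<Longrightarrow>
      add (coker_part a A t) (vcoset A u) (vcoset A v) = vcoset A (u + v)"
    and "v \<in> carrier_vec n \<Longrightarrow> smult (coker_part a A t) c (vcoset A v) = vcoset A (const3 c \<cdot>\<^sub>v v)"
proof -
  note N = mat_image_closed[OF A]
  have dim: "dim_row A = n" using A by simp
  have coset: "mat_image A +>\<^bsub>module_vec TYPE('k poly3) n\<^esub> v = vcoset A v" for v
    by (auto simp: a_r_coset_def' vcoset_def module_vec_simps)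
  show "carrier (coker_part a A t) = vcoset A ` free_part n a t"
    by (simp add: coker_part_def dim coset)
  have "vcoset A (0\<^sub>v n) = mat_image A" using N(1) unfolding vcoset_def by force
  then show "zero (coker_part a A t) = vcoset A (0\<^sub>v n)"
    by (simp add: coker_part_def coker_def quotient_module_def)
  show "add (coker_part a A t) (vcoset A u) (vcoset A v) = vcoset A (u + v)"
    if "u \<in> carrier_vec n" "v \<in> carrier_vec n"
  proof -
    have "add (coker_part a A t) (vcoset A u) (vcoset A v) = (\<Union>x\<in>vcoset A u. \<Union>y\<in>vcoset A v. {x + y})"
      by (simp add: coker_part_def coker_def quotient_module_def set_add_def' dim module_vec_simps)
    also have "\<dots> = vcoset A (u + v)"
    proof (intro equalityI subsetI)
      fix w assume "w \<in> (\<Union>x\<in>vcoset A u. \<Union>y\<in>vcoset A v. {x + y})"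
      then obtain h k where hk: "h \<in> mat_image A" "k \<in> mat_image A" "w = (h + u) + (k + v)"
        by (auto simp: vcoset_def)
      then have "h \<in> carrier_vec n" "k \<in> carrier_vec n" using N(1) by auto
      then have "w = (h + k) + (u + v)" unfolding hk(3) using that by (intro eq_vecI) auto
      then show "w \<in> vcoset A (u + v)" unfolding vcoset_def using N(3)[OF hk(1,2)] by blast
    next
      fix w assume "w \<in> vcoset A (u + v)"
      then obtain h where h: "h \<in> mat_image A" "w = h + (u + v)" by (auto simp: vcoset_def)
      then have "h \<in> carrier_vec n" using N(1) by auto
      then have "w = (h + u) + (0\<^sub>v n + v)" unfolding h(2) using that by (intro eq_vecI) auto
      then show "w \<in> (\<Union>x\<in>vcoset A u. \<Union>y\<in>vcoset A v. {x + y})"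
        unfolding vcoset_def using h(1) N(2) by blast
    qed
    finally show ?thesis .
  qed
  show "smult (coker_part a A t) c (vcoset A v) = vcoset A (const3 c \<cdot>\<^sub>v v)"
    if v: "v \<in> carrier_vec n"
  proof -
    have "smult (coker_part a A t) c (vcoset A v) = (\<Union>x\<in>vcoset A v. vcoset A (const3 c \<cdot>\<^sub>v x))"
      by (simp add: coker_part_def coker_def quotient_module_def dim coset module_vec_simps)
    \<comment> \<open>The scalar action unites the cosets of the multiples of all representatives;
      they coincide because the image is closed under scalars.\<close>
    also have "\<dots> = (\<Union>x\<in>vcoset A v. vcoset A (const3 c \<cdot>\<^sub>v v))"
    proof (rule SUP_cong)
      fix x assume "x \<in> vcoset A v"
      then obtain h where h: "h \<in> mat_image A" "x = h + v" by (auto simp: vcoset_def)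
      then have hc: "h \<in> carrier_vec n" using N(1) by auto
      then have "const3 c \<cdot>\<^sub>v x - const3 c \<cdot>\<^sub>v v = const3 c \<cdot>\<^sub>v h"
        unfolding h(2) using v by (intro eq_vecI) (auto simp: algebra_simps)
      then show "vcoset A (const3 c \<cdot>\<^sub>v x) = vcoset A (const3 c \<cdot>\<^sub>v v)"
        using vcoset_eq_iff[OF A, of "const3 c \<cdot>\<^sub>v x" "const3 c \<cdot>\<^sub>v v"] N(4)[OF h(1)] hc v h(2) by auto
    qed simp
    also have "\<dots> = vcoset A (const3 c \<cdot>\<^sub>v v)" using N(2) by (auto simp: vcoset_def)
    finally show ?thesis .
  qed
qed

lemma coker_part_vectorspace:
  fixes A :: "'k::field poly3 mat"
  assumes A: "A \<in> carrier_mat n m"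
  shows "vectorspace class_ring (coker_part a A t)"
proof -
  let ?S = "free_part n a t :: 'k poly3 vec set"
  have S: "ksubspace n ?S" by (rule free_part_subspace)
  have car: "v \<in> carrier_vec n" if "v \<in> ?S" for v using that by (simp add: free_part_def)
  have closed: "0\<^sub>v n \<in> ?S" "\<And>u v. u \<in> ?S \<Longrightarrow> v \<in> ?S \<Longrightarrow> u + v \<in> ?S"
    "\<And>c v. v \<in> ?S \<Longrightarrow> const3 c \<cdot>\<^sub>v v \<in> ?S"
    using S by (auto simp: ksubspace_def)
  have add: "u + v = v + u" "(u + v) + w = u + (v + w)" "v + 0\<^sub>v n = v" "v + const3 (- 1) \<cdot>\<^sub>v v = 0\<^sub>v n"
    if "u \<in> ?S" "v \<in> ?S" "w \<in> ?S" for u v w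
    using that[THEN car]
    by (auto simp: comm_add_vec assoc_add_vec[of _ n] const3_def single_uminus intro!: eq_vecI)
  have smult: "const3 (c * c') \<cdot>\<^sub>v v = const3 c \<cdot>\<^sub>v (const3 c' \<cdot>\<^sub>v v)"
    "const3 1 \<cdot>\<^sub>v v = v"
    "const3 (c + c') \<cdot>\<^sub>v v = const3 c \<cdot>\<^sub>v v + const3 c' \<cdot>\<^sub>v v"
    "const3 c \<cdot>\<^sub>v (v + w) = const3 c \<cdot>\<^sub>v v + const3 c \<cdot>\<^sub>v w"
    if "v \<in> ?S" "w \<in> ?S" for c c' v w
    using that[THEN car]
    by (auto simp: const3_simps smult_smult_assoc add_smult_distrib_vec smult_add_distrib_vec[of _ n])
  note simps = coker_part_simps[OF A] car closed
  show ?thesis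
  proof (rule vs_criteria)
    show "field (class_ring :: 'k ring)" by (rule class_field)
    show "\<forall>v\<in>carrier (coker_part a A t). \<exists>w\<in>carrier (coker_part a A t).
        v \<oplus>\<^bsub>coker_part a A t\<^esub> w = \<zero>\<^bsub>coker_part a A t\<^esub>"
    proof
      fix x assume "x \<in> carrier (coker_part a A t)"
      then obtain v where v: "v \<in> ?S" "x = vcoset A v" by (auto simp: simps)
      have "vcoset A v \<oplus>\<^bsub>coker_part a A t\<^esub> vcoset A (const3 (- 1) \<cdot>\<^sub>v v) = \<zero>\<^bsub>coker_part a A t\<^esub>"
        using v by (simp add: simps add)
      then show "\<exists>w\<in>carrier (coker_part a A t). x \<oplus>\<^bsub>coker_part a A t\<^esub> w = \<zero>\<^bsub>coker_part a A t\<^esub>"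
        unfolding v(2) using v(1) by (intro bexI[of _ "vcoset A (const3 (- 1) \<cdot>\<^sub>v v)"]) (auto simp: simps)
    qed
    show "\<forall>x y. x \<in> carrier (coker_part a A t) \<and> y \<in> carrier (coker_part a A t) \<longrightarrow>
        x \<oplus>\<^bsub>coker_part a A t\<^esub> y = y \<oplus>\<^bsub>coker_part a A t\<^esub> x"
    proof (intro allI impI)
      fix x y assume "x \<in> carrier (coker_part a A t) \<and> y \<in> carrier (coker_part a A t)"
      then obtain u v where "u \<in> ?S" "x = vcoset A u" "v \<in> ?S" "y = vcoset A v" by (auto simp: simps)
      then show "x \<oplus>\<^bsub>coker_part a A t\<^esub> y = y \<oplus>\<^bsub>coker_part a A t\<^esub> x"
        using add(1)[of u v u] by (simp add: simps)
    qed
  qed (use add(2,3) smult in \<open>auto simp: simps class_ring_simps\<close>)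
qed

text \<open>Rank-nullity for the projection of the degree \<open>t\<close> part of the target onto
  \<open>coker_part\<close>. Its kernel consists of the images of arbitrary vectors that fall into
  degree \<open>t\<close>; by \<open>image_free_part\<close> these are images of the degree
  \<open>t\<close> part of the source.\<close>

lemma hilbert_function_eq:
  fixes A :: "'k::field poly3 mat"
  assumes A: "A \<in> carrier_mat n m"
    and hom: "\<And>i j. i < n \<Longrightarrow> j < m \<Longrightarrow> homogeneous (b j - a i) (A $$ (i, j))"
  shows "hilbert_function a A t + kdim n ((\<lambda>v. A *\<^sub>v v) ` free_part m b t) =
    kdim n (free_part n a t :: 'k poly3 vec set)"
proof -
  let ?S = "free_part n a t :: 'k poly3 vec set"
  have S: "ksubspace n ?S" by (rule free_part_subspace)
  have car: "v \<in> carrier_vec n" if "v \<in> ?S" for v using that by (simp add: free_part_def)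
  have fin: "kfinite n ?S" by (rule free_part_basis)
  interpret L: linear_map class_ring "kspace n ?S" "coker_part a A t" "vcoset A"
    by (rule linear_mapI[OF kspace_vectorspace[OF S] coker_part_vectorspace[OF A]])
      (auto simp: coker_part_simps[OF A] car)
  have "{v \<in> ?S. vcoset A v = vcoset A (0\<^sub>v n)} = (\<lambda>v. A *\<^sub>v v) ` free_part m b t"
  proof (intro equalityI subsetI)
    fix v assume "v \<in> {v \<in> ?S. vcoset A v = vcoset A (0\<^sub>v n)}"
    then have v: "v \<in> ?S" "v - 0\<^sub>v n \<in> mat_image A" using vcoset_eq_iff[OF A] car by auto
    then obtain u where u: "u \<in> carrier_vec m" "v = A *\<^sub>v u" using A car by (auto simp: mat_image_def)
    then show "v \<in> (\<lambda>v. A *\<^sub>v v) ` free_part m b t"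
      using image_free_part[OF A u(1) _ hom, of t] v(1) by auto
  next
    fix v assume "v \<in> (\<lambda>v. A *\<^sub>v v) ` free_part m b t"
    then obtain u where u: "u \<in> free_part m b t" "v = A *\<^sub>v u" by auto
    then have "v \<in> ?S" using mult_free_part[OF A u(1) hom] by simp
    moreover have "v - 0\<^sub>v n \<in> mat_image A"
      using u A car[OF \<open>v \<in> ?S\<close>] by (auto simp: mat_image_def free_part_def)
    ultimately show "v \<in> {v \<in> ?S. vcoset A v = vcoset A (0\<^sub>v n)}"
      using vcoset_eq_iff[OF A] car by auto
  qed
  then have ker: "L.ker = (\<lambda>v. A *\<^sub>v v) ` free_part m b t"
    by (simp add: L.ker_def coker_part_simps[OF A])
  have im: "L.im = carrier (coker_part a A t)" by (simp add: L.im_def coker_part_simps[OF A])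
  have "(coker_part a A t)\<lparr>carrier := carrier (coker_part a A t)\<rparr> = coker_part a A t" by simp
  then show ?thesis
    using L.rank_nullity fin im ker
    by (simp add: hilbert_function_def kdim_def kfinite_def)
qed

text \<open>The border rows count as rows of degree \<open>b k\<close> and \<open>b l\<close>: their
  only nonzero entries are ones in columns \<open>k\<close> and \<open>l\<close>, of degree 0. So
  the bordered matrix satisfies the condition of \<open>homogeneous_det\<close>.\<close>

lemma br_map_homogeneous:
  fixes A :: "'k::comm_ring_1 poly3 mat"
  assumes A: "A \<in> carrier_mat n (n + 2)"
    and hom: "\<And>i j. i < n \<Longrightarrow> j < n + 2 \<Longrightarrow> homogeneous (b j - a i) (A $$ (i, j))"
    and d: "d = (\<Sum>j<n + 2. b j) - (\<Sum>i<n. a i)"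
    and k: "k < n + 2" and l: "l < n + 2"
  shows "homogeneous (d - b l - b k) (br_map A $$ (k, l))"
proof -
  define \<alpha> where "\<alpha> i = (if i < n then a i else if i = n then b k else b l)" for i
  have "homogeneous ((\<Sum>j<n + 2. b j) - (\<Sum>i<n + 2. \<alpha> i)) (det (bordered A (unit_row k) (unit_row l)))"
  proof (rule homogeneous_det[OF bordered_carrier[OF A]])
    fix i j assume "i < n + 2" "j < n + 2"
    then show "homogeneous (b j - \<alpha> i) (bordered A (unit_row k) (unit_row l) $$ (i, j))"
      using A hom by (auto simp: bordered_def unit_row_def \<alpha>_def homogeneous_one)
  qed
  moreover have "(\<Sum>i<n + 2. \<alpha> i) = (\<Sum>i<n. a i) + b k + b l" by (simp add: \<alpha>_def)
  ultimately show ?thesis using d by (simp only: br_map_index[OF A k l]) (simp add: algebra_simps)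
qed

text \<open>The shifts \<open>d - a i\<close>, \<open>d - b j\<close>, \<open>b j\<close>,
  \<open>a i\<close> of the four free modules give all three maps degree 0. In degree
  \<open>t\<close> the complex is then an exact sequence of finite-dimensional spaces, and repeated
  rank-nullity yields the alternating sum.\<close>

theorem hilbert_function_formula:
  fixes A :: "'k::field poly3 mat"
  assumes A: "A \<in> carrier_mat n (n + 2)" and char: "CHAR('k) \<noteq> 2" and fin: "cofinite_coker A"
    and hom: "\<And>i j. i < n \<Longrightarrow> j < n + 2 \<Longrightarrow> homogeneous (b j - a i) (A $$ (i, j))"
    and d: "d = (\<Sum>j<n + 2. b j) - (\<Sum>i<n. a i)"
  shows "int (hilbert_function a A t) = (\<Sum>i<n. int (npairs (t - a i))) - (\<Sum>j<n + 2. int (npairs (t - b j)))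
    + (\<Sum>j<n + 2. int (npairs (t - d + b j))) - (\<Sum>i<n. int (npairs (t - d + a i)))"
proof -
  let ?G = "free_part n a t :: 'k poly3 vec set"
  let ?F = "free_part (n + 2) b t :: 'k poly3 vec set"
  let ?F' = "free_part (n + 2) (\<lambda>j. d - b j) t :: 'k poly3 vec set"
  let ?G' = "free_part n (\<lambda>i. d - a i) t :: 'k poly3 vec set"
  have At: "transpose_mat A \<in> carrier_mat (n + 2) n" using A by simp
  note D = br_map_carrier[OF A]
  note exact = buchsbaum_rim_poly3[OF A char fin]
  have homT: "homogeneous ((d - a i) - (d - b j)) (transpose_mat A $$ (j, i))"
    if "j < n + 2" "i < n" for i j
    using A hom[OF that(2,1)] that by (simp add: algebra_simps)
  have homD: "homogeneous ((d - b l) - b k) (br_map A $$ (k, l))" if "k < n + 2" "l < n + 2" for k l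
    by (rule br_map_homogeneous[OF A hom d that])
  have sub: "ksubspace m (free_part m c t :: 'k poly3 vec set)" for m c by (rule free_part_subspace)
  have fd: "kfinite m (free_part m c t :: 'k poly3 vec set)" for m c by (rule free_part_basis)
  have car: "v \<in> carrier_vec m" if "v \<in> free_part m c t" for m c and v :: "'k poly3 vec"
    using that by (simp add: free_part_def)
  have img1: "transpose_mat A *\<^sub>v v \<in> ?F'" if "v \<in> ?G'" for v
    by (rule mult_free_part[OF At that homT])
  have img2: "br_map A *\<^sub>v v \<in> ?F" if "v \<in> ?F'" for v
    by (rule mult_free_part[OF D that homD])
  have img3: "A *\<^sub>v v \<in> ?G" if "v \<in> ?F" for v
    by (rule mult_free_part[OF A that hom])
  have zero: "0\<^sub>v m \<in> free_part m c t" for m c by (simp add: free_part_def)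
  have "{v \<in> ?G'. transpose_mat A *\<^sub>v v = 0\<^sub>v (n + 2)} = {0\<^sub>v n}"
    using exact(1) car zero At by (auto intro!: eq_vecI)
  then have 1: "kdim (n + 2) ((\<lambda>v. transpose_mat A *\<^sub>v v) ` ?G') = kdim n ?G'"
    using kdim_rank_nullity[where S = "?G'" and T = "?F'", OF At sub fd sub img1] by (simp add: kdim_zero)
  have "{v \<in> ?F'. br_map A *\<^sub>v v = 0\<^sub>v (n + 2)} = (\<lambda>v. transpose_mat A *\<^sub>v v) ` ?G'"
  proof (intro equalityI subsetI)
    fix u assume u: "u \<in> {v \<in> ?F'. br_map A *\<^sub>v v = 0\<^sub>v (n + 2)}"
    then obtain v where v: "v \<in> carrier_vec n" "u = transpose_mat A *\<^sub>v v" using exact(2)[of u] car by auto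
    then show "u \<in> (\<lambda>v. transpose_mat A *\<^sub>v v) ` ?G'"
      using image_free_part[OF At v(1) _ homT, of t] u by auto
  next
    fix u assume "u \<in> (\<lambda>v. transpose_mat A *\<^sub>v v) ` ?G'"
    then obtain v where v: "v \<in> ?G'" "u = transpose_mat A *\<^sub>v v" by auto
    have "br_map A *\<^sub>v u = (br_map A * transpose_mat A) *\<^sub>v v"
      unfolding v(2) using assoc_mult_mat_vec[OF D At car[OF v(1)]] by simp
    also have "\<dots> = 0\<^sub>v (n + 2)"
      unfolding br_map_mult_transpose[OF A] using car[OF v(1)] by (intro eq_vecI) auto
    finally show "u \<in> {v \<in> ?F'. br_map A *\<^sub>v v = 0\<^sub>v (n + 2)}"
      using img1[OF v(1)] v(2) by simp
  qed
  then have 2: "kdim (n + 2) ((\<lambda>v. br_map A *\<^sub>v v) ` ?F') + kdim n ?G' = kdim (n + 2) ?F'"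
    using kdim_rank_nullity[where S = "?F'" and T = ?F, OF D sub fd sub img2] 1 by simp
  have "{v \<in> ?F. A *\<^sub>v v = 0\<^sub>v n} = (\<lambda>v. br_map A *\<^sub>v v) ` ?F'"
  proof (intro equalityI subsetI)
    fix u assume u: "u \<in> {v \<in> ?F. A *\<^sub>v v = 0\<^sub>v n}"
    then obtain v where v: "v \<in> carrier_vec (n + 2)" "u = br_map A *\<^sub>v v" using exact(3)[of u] car by auto
    then show "u \<in> (\<lambda>v. br_map A *\<^sub>v v) ` ?F'"
      using image_free_part[OF D v(1) _ homD, of t] u by auto
  next
    fix u assume "u \<in> (\<lambda>v. br_map A *\<^sub>v v) ` ?F'"
    then obtain v where v: "v \<in> ?F'" "u = br_map A *\<^sub>v v" by auto
    have "A *\<^sub>v u = (A * br_map A) *\<^sub>v v"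
      unfolding v(2) using assoc_mult_mat_vec[OF A D car[OF v(1)]] by simp
    also have "\<dots> = 0\<^sub>v n"
      unfolding mult_br_map[OF A] using car[OF v(1)] by (intro eq_vecI) auto
    finally show "u \<in> {v \<in> ?F. A *\<^sub>v v = 0\<^sub>v n}"
      using img2[OF v(1)] v(2) by simp
  qed
  then have 3: "kdim n ((\<lambda>v. A *\<^sub>v v) ` ?F) + kdim (n + 2) ((\<lambda>v. br_map A *\<^sub>v v) ` ?F') = kdim (n + 2) ?F"
    using kdim_rank_nullity[where S = ?F and T = ?G, OF A sub fd sub img3] by simp
  have 4: "hilbert_function a A t + kdim n ((\<lambda>v. A *\<^sub>v v) ` ?F) = kdim n ?G"
    by (rule hilbert_function_eq[OF A hom])
  have dim: "int (kdim m (free_part m c t :: 'k poly3 vec set)) = (\<Sum>i<m. int (npairs (t - c i)))" for m c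
    by (simp add: free_part_basis(2) card_monomials npairs_def)
  have "int (hilbert_function a A t) = int (kdim n ?G) - int (kdim (n + 2) ?F)
      + int (kdim (n + 2) ?F') - int (kdim n ?G')"
    using 2 3 4 by linarith
  then show ?thesis unfolding dim by (simp only: diff_diff_eq2 add_diff_eq diff_add_eq)
qed

theorem proposition3p13:
  fixes n :: nat and a b :: "nat \<Rightarrow> int" and \<phi> :: "'k::alg_closed_field poly3 mat" and d d' :: int
  assumes "n > 0"
    and "mono_on {..<n} a"
    and "mono_on {..<n + 2} b"
    and "\<phi> \<in> carrier_mat n (n + 2)"
    and "\<And>i j. i < n \<Longrightarrow> j < n + 2 \<Longrightarrow> homogeneous (b j - a i) (\<phi> $$ (i, j))"
    and "\<And>i j. i < n \<Longrightarrow> j < n + 2 \<Longrightarrow> \<phi> $$ (i, j) \<noteq> 0 \<Longrightarrow> b j - a i > 0"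
    and "codimension class_ring (minor_ideal \<phi>) = 3"
    and "CHAR('k) \<noteq> 2"
    and "d = (\<Sum>j<n + 2. b j) - (\<Sum>i<n. a i)"
    and "d' = (\<Sum>i<n. (b i - a i))"
    and "a 0 = 0"
    and "(even d \<and> b (n + 1) < d' + b n + 2) \<or> (odd d \<and> b (n + 1) < d' + b n + 1)"
  shows "unimodal (hilbert_function a \<phi>)"
proof -
  note n = assms(1) and a = assms(2) and b = assms(3) and A = assms(4) and hom = assms(5)
    and pos = assms(6) and codim = assms(7) and char = assms(8) and d = assms(9)
  have fin: "cofinite_coker \<phi>"
    unfolding cofinite_coker_def using annihilates_coker_var_power[OF A hom codim] by blast
  have gap: "a i < b i" if "i < n" for i by (rule degree_gap[OF A char fin a b hom pos that])
  have "d = d' + b n + b (n + 1)" unfolding d assms(10) by (simp add: sum_subtractf)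
  \<comment> \<open>The claim is that \<open>b (n + 1) - d' - b n\<close> is at most 0. This
    difference has the parity of \<open>d\<close>: if even, being below 2 makes it at most 0; if
    odd, the bound 1 does so directly.\<close>
  then have "2 * b (n + 1) \<le> d" using assms(12) by presburger
  moreover have "b j \<le> b (n + 1)" if "j < n + 2" for j using monotone_onD[OF b, of j "n + 1"] that by auto
  ultimately have bound: "2 * b j \<le> d" if "j < n + 2" for j using that by fastforce
  show ?thesis
  proof (rule unimodal_of_hdiff[OF _ d])
    fix t
    have step: "int (npairs (t + 1 - x)) - int (npairs (t - x)) = pos_part (t + 2 - x)" for x
      using npairs_diff[of "t - x"] by (simp add: algebra_simps)
    have step': "int (npairs (t + 1 - d + x)) - int (npairs (t - d + x)) = pos_part (t + 2 - d + x)" for x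
      using npairs_diff[of "t - d + x"] by (simp add: algebra_simps)
    show "int (hilbert_function a \<phi> (t + 1)) - int (hilbert_function a \<phi> t) = hdiff n a b d (t + 2)"
      using hilbert_function_formula[OF A char fin hom d, of t]
        hilbert_function_formula[OF A char fin hom d, of "t + 1"]
      unfolding hdiff_def step[symmetric] step'[symmetric] sum_subtractf by linarith
  next
    show "hdiff n a b d y \<ge> 0" if "2 * y \<le> d" for y
      by (rule hdiff_nonneg[OF n a b gap assms(11) d bound that])
  qed
qed

end
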